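(* Let $p>3$ be a prime. Then $$G_{p-1}\equiv (-1)^{\frac{p-1}{2}}256^{p-1}+p^2\Big(E_{p-3}-8(-1)^{\frac{p-1}{2}}q_p(2)^2+\frac12\sum_{k=0}^{\frac{p-1}{2}}\frac{\binom{2k}{k}^2}{16^k}H_k^2\Big)\pmod{p^3},$$ and $$G_{\frac{p-1}{2}}\equiv\begin{cases}4^p x^2-2p \pmod{p^2} & \text{if } p\equiv 1 \pmod 4 \text{ and } p=x^2+4y^2 \text{ with } x,y\in\mathbb{Z},\\ 0\pmod{p^2} & \text{if } p\equiv 3\pmod 4.\end{cases}$$
   Context: For $n\ge0$, $G_n=\sum_{k=0}^n \binom{2k}{k}^2\binom{2n-2k}{n-k}4^{n-k}$. $q_p(2)=(2^{p-1}-1)/p$ (Fermat quotient). $H_0=0$ and $H_k=\sum_{i=1}^k 1/i$ for $k\ge1$. The Euler numbers $E_n$ are defined by $E_0=1$, $E_{2n-1}=0$, $E_{2n}=-\sum_{k=1}^n\binom{2n}{2k}E_{2n-2k}$ for $n\ge1$. Congruences between rational numbers whose denominators are prime to $p$ are understood in the ring of such rationals. *)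

theory Defs
  imports Complex_Main "HOL-Number_Theory.Number_Theory"
begin

definition G_seq :: "nat \<Rightarrow> nat" where
  "G_seq n = (\<Sum>k=0..n. ((2*k) choose k)^2 * ((2*n - 2*k) choose (n - k)) * 4^(n - k))"

definition fermat_quotient :: "nat \<Rightarrow> nat \<Rightarrow> rat" where
  "fermat_quotient p a = (of_nat a ^ (p - 1) - 1) / of_nat p"

text \<open>The function \<open>harm\<close> of HOL-Analysis needs a real normed field, which the rationals are not an
  instance of.\<close>

definition harmonic :: "nat \<Rightarrow> rat" where
  "harmonic n = (\<Sum>i=1..n. 1 / of_nat i)"

fun euler_number :: "nat \<Rightarrow> int" where
  "euler_number n =
     (if n = 0 then 1
      else if odd n then 0
      else - (\<Sum>k=1..n div 2. int (n choose (2*k)) * euler_number (n - 2*k)))"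

declare euler_number.simps [simp del]

lemma euler_number_0: "euler_number 0 = 1"
  by (subst euler_number.simps) simp

lemma euler_number_odd: "n \<ge> 1 \<Longrightarrow> euler_number (2*n - 1) = 0"
  by (subst euler_number.simps) simp

lemma euler_number_even:
  "n \<ge> 1 \<Longrightarrow>
     euler_number (2*n) = - (\<Sum>k=1..n. int ((2*n) choose (2*k)) * euler_number (2*n - 2*k))"
  by (subst euler_number.simps) simp

definition p_integral :: "nat \<Rightarrow> rat \<Rightarrow> bool" where
  "p_integral p x \<longleftrightarrow> coprime (snd (quotient_of x)) (int p)"

text \<open>Congruence modulo \<open>p ^ k\<close> in the ring of \<open>p\<close>-integral rationals. Both sides have to belong
  to that ring. Ordinary divisibility in the field \<^typ>\<open>rat\<close> would be trivial, so the cofactor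
  is required to be \<open>p\<close>-integral as well.\<close>

definition rat_cong_prime_power :: "nat \<Rightarrow> nat \<Rightarrow> rat \<Rightarrow> rat \<Rightarrow> bool" where
  "rat_cong_prime_power p k a b \<longleftrightarrow>
     p_integral p a \<and> p_integral p b \<and> (\<exists>c. p_integral p c \<and> a - b = of_nat p ^ k * c)"

end

(* Write u k = (2k choose k) / 4^k, h = (p - 1) / 2, q for the Fermat quotient and
   t k x = prod_{i<k} (i (i+1) - x (x+1)) / (i+1)^2 for (-1)^k (x choose k) (x+k choose k).

   A finite-difference identity gives
   G_n = 16^n sum_k (-1)^k (n choose k) (u k)^2 = 16^n sum_k (u k)^2 u (n - k).
   Moreover t k (-1/2) = (u k)^2, while t k h agrees with (u k)^2 modulo p^2 for k <= h.
   Sums of t k x times a weight over k <= N satisfy a first-order recursion x -> x - 1.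
   Going from x = -1/2 down to x = -p/2 evaluates sum_{k<p} (u k)^2 modulo p^3, and going from
   x = h down to 0 evaluates the sums weighted with harmonic numbers. The case k = h of the
   comparison of t k h with (u k)^2 is Morley's congruence, which gives H_h modulo p^2.
   Everything is then expressed through q and sum_j (-1)^j / (2j+1)^2, which is E_{p-3} / 2
   modulo p. This settles G_{p-1}.

   For G_h, expand both expressions for G_h / 16^h modulo p^2 around sum_k (u k)^3. For odd h
   the comparison forces the value 0; for even h it shows that the corrections cancel, leaving
   sum_k t k h * u k = (u (h/2))^2. The Jacobsthal sum of phi(s) phi(s^2 - 1), phi the Legendre
   symbol, equals 2x or -2x (Jacobsthal). Computing it modulo p^2 with Teichmueller
   representatives s^p gives (u (h/2))^2 = 4 x^2 - 2 p modulo p^2. *)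

theory Submission
  imports Defs
begin

section \<open>Alternating binomial sums\<close>

text \<open>\<open>legendre_term k\<close> is a function of x (x + 1), hence even about x = -1/2,
  and \<open>half\<close> = -1/2 + p/2; so passing from -1/2 to \<open>half\<close> costs only p^2.
  This replaces sums of (u k)^2 truncated at \<open>half\<close> by terminating ones with closed
  forms. The point -p/2 is chosen because every term with k > 0 carries the factor x there.

  The obstacle in the second congruence is that Euler's criterion and power sums determine character
  sums only modulo p. On p-th powers s^p both hold modulo p^2, but p-th powering is not additive: (1
  - s^2)^p differs from 1 - s^(2p) by p times a truncated logarithm, and that defect is the source
  of the correction term. The sign of the Jacobsthal sum is never determined; only its square
  enters, as only x^2 does. The summand -2p is the cross term of that square.\<close>

lemma harmonic_0 [simp]: "harmonic 0 = 0"
  by (simp add: harmonic_def)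

lemma harmonic_Suc: "harmonic (Suc n) = harmonic n + 1 / of_nat (Suc n)"
  by (simp add: harmonic_def)

text \<open>Pascal's rule: one of the n + 1 finite differences is carried out on g. This drives the
  inductions on n for the closed forms that follow.\<close>

lemma sum_alternating_binomial_Suc:
  fixes g :: "nat \<Rightarrow> 'a::comm_ring_1"
  shows "(\<Sum>k\<le>Suc n. (-1)^k * of_nat (Suc n choose k) * g k)
       = (\<Sum>k\<le>n. (-1)^k * of_nat (n choose k) * (g k - g (Suc k)))"
proof -
  have "(\<Sum>k\<le>Suc n. (-1)^k * of_nat (Suc n choose k) * g k)
      = g 0 - (\<Sum>k\<le>n. (-1)^k * of_nat (n choose k) * g (Suc k))
            - (\<Sum>k\<le>n. (-1)^k * of_nat (n choose Suc k) * g (Suc k))"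
    by (subst sum.atMost_Suc_shift) (simp add: sum_subtractf sum_negf algebra_simps sum.distrib)
  moreover have "(\<Sum>k\<le>Suc n. (-1)^k * of_nat (n choose k) * g k)
      = g 0 - (\<Sum>k\<le>n. (-1)^k * of_nat (n choose Suc k) * g (Suc k))"
    by (subst sum.atMost_Suc_shift) (simp add: sum_negf)
  moreover have "(\<Sum>k\<le>Suc n. (-1)^k * of_nat (n choose k) * g k)
      = (\<Sum>k\<le>n. (-1)^k * of_nat (n choose k) * g k)" by (simp add: binomial_eq_0)
  ultimately show ?thesis
    unfolding right_diff_distrib sum_subtractf by simp
qed

text \<open>Each difference in k lowers the lower index of the binomial coefficient by one, at the
  cost of a sign; n differences leave m choose r.\<close>

lemma sum_alternating_binomial_shift:
  "(\<Sum>k\<le>n. (-1)^k * of_nat (n choose k) * of_nat ((m + k) choose (r + n)))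
     = (-1)^n * (of_nat (m choose r) :: 'a::comm_ring_1)"
proof (induction n arbitrary: r)
  case (Suc n)
  have "(\<Sum>k\<le>Suc n. (-1)^k * of_nat (Suc n choose k) * of_nat ((m + k) choose (r + Suc n)))
      = (\<Sum>k\<le>n. (-1)^k * of_nat (n choose k) *
            (of_nat ((m + k) choose (r + Suc n)) - of_nat ((m + Suc k) choose (r + Suc n)) :: 'a))"
    by (rule sum_alternating_binomial_Suc)
  also have "\<dots> = - (\<Sum>k\<le>n. (-1)^k * of_nat (n choose k) * of_nat ((m + k) choose (r + n)))"
    by (simp flip: sum_negf)
  finally show ?case by (simp add: Suc.IH)
qed simp

text \<open>The partial fraction decomposition of n! / (x (x + 1) ... (x + n)).\<close>

lemma sum_alternating_binomial_inverse:
  fixes x :: rat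
  assumes "x > 0"
  shows "(\<Sum>k\<le>n. (-1)^k * of_nat (n choose k) * (1 / (x + of_nat k))) = fact n / (\<Prod>j\<le>n. x + of_nat j)"
  using assms
proof (induction n arbitrary: x)
  case (Suc n)
  have pos: "(\<Prod>j\<le>n. x + of_nat j) > 0" "(\<Prod>j\<le>n. x + 1 + of_nat j) > 0"
    using Suc.prems by (auto intro!: prod_pos add_pos_nonneg)
  have shift: "(\<Prod>j\<le>Suc n. x + of_nat j) = x * (\<Prod>j\<le>n. x + 1 + of_nat j)"
    by (subst prod.atMost_Suc_shift) (simp add: algebra_simps)
  have "(\<Sum>k\<le>Suc n. (-1)^k * of_nat (Suc n choose k) * (1 / (x + of_nat k)))
      = (\<Sum>k\<le>n. (-1)^k * of_nat (n choose k) * (1 / (x + of_nat k)))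
      - (\<Sum>k\<le>n. (-1)^k * of_nat (n choose k) * (1 / (x + 1 + of_nat k)))"
    by (subst sum_alternating_binomial_Suc) (simp add: algebra_simps sum_subtractf)
  also have "\<dots> = fact n / (\<Prod>j\<le>n. x + of_nat j) - fact n / (\<Prod>j\<le>n. x + 1 + of_nat j)"
    using Suc.IH[of x] Suc.IH[of "x + 1"] Suc.prems by simp
  also have "\<dots> = fact (Suc n) / (\<Prod>j\<le>Suc n. x + of_nat j)"
  proof -
    define a where "a = (\<Prod>j\<le>n. x + of_nat j)"
    define b where "b = (\<Prod>j\<le>n. x + 1 + of_nat j)"
    have ab: "a * (x + of_nat (Suc n)) = x * b"
      using shift by (simp add: a_def b_def)
    have "a > 0" "b > 0" using pos by (simp_all add: a_def b_def)
    have "fact n / a - fact n / b = fact n * (b - a) / (a * b)"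
      using \<open>a > 0\<close> \<open>b > 0\<close> by (simp add: field_simps)
    also have "\<dots> = fact n * (x * (b - a)) / (a * (x * b))"
      using Suc.prems \<open>a > 0\<close> \<open>b > 0\<close> by (simp add: divide_simps)
    also have "x * (b - a) = of_nat (Suc n) * a"
      using ab by (simp add: algebra_simps)
    also have "fact n * (of_nat (Suc n) * a) / (a * (x * b)) = fact (Suc n) / (x * b)"
      using \<open>a > 0\<close> by simp
    finally show ?thesis using shift by (simp add: a_def b_def)
  qed
  finally show ?case .
qed simp

text \<open>The sum is the coefficient of \<open>z ^ c\<close> in \<open>(1 + z) ^ n * ln (1 + z)\<close>, that is, the
  derivative of \<open>n choose c\<close> with respect to \<open>n\<close>.\<close>

lemma sum_alternating_binomial_log:
  "c \<le> n \<Longrightarrow> (\<Sum>r=1..c. (-1)^(r+1) * of_nat (n choose (c - r)) / of_nat r)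
     = of_nat (n choose c) * (harmonic n - harmonic (n - c))"
proof (induction n arbitrary: c)
  case (Suc n)
  show ?case
  proof (cases "c = 0")
    case False
    then obtain d where d: "c = Suc d" by (cases c) auto
    have dn: "d \<le> n" using Suc.prems d by simp
    have split: "(\<Sum>r=1..c. (-1)^(r+1) * of_nat (Suc n choose (c - r)) / of_nat r)
       = (\<Sum>r=1..Suc d. (-1)^(r+1) * of_nat (n choose (Suc d - r)) / of_nat r)
       + (\<Sum>r=1..d. (-1)^(r+1) * of_nat (n choose (d - r)) / (of_nat r :: rat))"
    proof -
      have "(\<Sum>r=1..d. (-1)^(r+1) * of_nat (Suc n choose (Suc d - r)) / of_nat r)
         = (\<Sum>r=1..d. (-1)^(r+1) * of_nat (n choose (Suc d - r)) / of_nat r)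
         + (\<Sum>r=1..d. (-1)^(r+1) * of_nat (n choose (d - r)) / (of_nat r :: rat))"
        unfolding sum.distrib[symmetric]
        by (intro sum.cong refl) (auto simp: Suc_diff_le field_simps)
      then show ?thesis by (simp add: d)
    qed
    show ?thesis
    proof (cases "d = n")
      case True
      \<comment> \<open>The induction hypothesis needs c \<le> n and says nothing about this sum.
        Reversed, it is the partial fraction sum at x = 1, with value 1 / (n + 1).\<close>
      have "(\<Sum>r=1..Suc n. (-1)^(r+1) * of_nat (n choose (Suc n - r)) / of_nat r)
          = (\<Sum>k\<le>n. (-1)^k * of_nat (n choose k) * (1 / (1 + of_nat k :: rat)))"
      proof (rule sum.reindex_bij_witness[of _ Suc "\<lambda>r. r - 1"])
        fix r assume r: "r \<in> {1..Suc n}"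
        then obtain k where k: "r = Suc k" by (cases r) auto
        with r have "n choose (n - k) = n choose k" by (simp flip: binomial_symmetric)
        with k show "(-1)^(r - 1) * of_nat (n choose (r - 1)) * (1 / (1 + of_nat (r - 1) :: rat))
            = (-1)^(r+1) * of_nat (n choose (Suc n - r)) / of_nat r" by simp
      qed auto
      also have "\<dots> = fact n / (\<Prod>j\<le>n. 1 + of_nat j)"
        by (rule sum_alternating_binomial_inverse) simp
      also have "(\<Prod>j\<le>n. 1 + of_nat j :: rat) = fact (Suc n)"
        by (induction n) (simp_all add: algebra_simps)
      finally have "(\<Sum>r=1..Suc n. (-1)^(r+1) * of_nat (n choose (Suc n - r)) / of_nat r)
          = 1 / (of_nat (Suc n) :: rat)" by simp
      then show ?thesis
        unfolding split using Suc.IH[of n] True d by (simp add: harmonic_Suc)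
    next
      case False
      then have dn: "Suc d \<le> n" using dn by simp
      then obtain e where e: "n = Suc d + e" using le_Suc_ex by blast
      have c1: "of_nat (Suc e) * of_nat (Suc n choose Suc d) = (of_nat (Suc n) * of_nat (n choose Suc d) :: rat)"
      proof -
        have "(Suc n - Suc d) * (Suc n choose Suc d) = Suc n * (n choose Suc d)"
          using binomial_absorb_comp[of "Suc n" "Suc d"] by simp
        then have "Suc e * (Suc n choose Suc d) = Suc n * (n choose Suc d)" by (simp add: e)
        then show ?thesis by (simp only: of_nat_mult[symmetric])
      qed
      have "of_nat (n choose Suc d) * (harmonic n - harmonic e)
          + of_nat (n choose d) * (harmonic n - harmonic (Suc e))
          = of_nat (Suc n choose Suc d) * (harmonic n - harmonic (Suc e))
            + of_nat (n choose Suc d) / of_nat (Suc e)"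
        by (simp add: harmonic_Suc algebra_simps del: of_nat_Suc)
      also have "of_nat (n choose Suc d) / (of_nat (Suc e) :: rat) = of_nat (Suc n choose Suc d) / of_nat (Suc n)"
        using c1 by (simp add: frac_eq_eq mult.commute del: of_nat_Suc binomial_Suc_Suc)
      finally have "of_nat (n choose Suc d) * (harmonic n - harmonic e)
          + of_nat (n choose d) * (harmonic n - harmonic (Suc e))
          = of_nat (Suc n choose Suc d) * (harmonic (Suc n) - harmonic (Suc e))"
        unfolding harmonic_Suc[of n] by (simp add: algebra_simps del: of_nat_Suc binomial_Suc_Suc)
      moreover have "n - d = Suc e" "n - Suc d = e" "Suc n - Suc d = Suc e" using e by auto
      ultimately show ?thesis
        unfolding split using Suc.IH[of "Suc d"] Suc.IH[of d] dn d by simp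
    qed
  qed simp
qed simp

lemma binomial_Suc_rat:
  "of_nat (n choose Suc k) = of_nat (n choose k) * (of_nat n - of_nat k) / (of_nat (Suc k) :: rat)"
proof (cases "k \<le> n")
  case True
  have "(n choose Suc k) * Suc k = (n choose k) * (n - k)"
    using binomial_absorb_comp[of n k] by (metis binomial_absorption mult.commute)
  then have "of_nat (n choose Suc k) * of_nat (Suc k) = (of_nat (n choose k) * of_nat (n - k) :: rat)"
    by (metis of_nat_mult)
  then show ?thesis
    using True by (simp add: of_nat_diff eq_divide_eq del: of_nat_Suc)
qed (simp add: binomial_eq_0)

lemma binomial_diagonal_rat:
  "of_nat ((n + Suc k) choose Suc k)
     = of_nat ((n + k) choose k) * (of_nat n + of_nat (Suc k)) / (of_nat (Suc k) :: rat)"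
proof -
  have "Suc k * ((n + Suc k) choose Suc k) = (n + Suc k) * ((n + k) choose k)"
    using binomial_absorption[of k "n + Suc k"] by simp
  then have "of_nat (Suc k) * of_nat ((n + Suc k) choose Suc k) = (of_nat (n + Suc k) * of_nat ((n + k) choose k) :: rat)"
    by (simp only: of_nat_mult[symmetric])
  then show ?thesis
    by (simp add: eq_divide_eq mult.commute del: of_nat_Suc)
qed

section \<open>Central binomial coefficients\<close>

text \<open>The coefficient of z^k in (1 - z)^(-1/2). This normalization turns all powers of 4 in
  \<open>G_seq n\<close> into the single factor 16^n.\<close>

definition cbinom :: "nat \<Rightarrow> rat" where
  "cbinom k = of_nat ((2*k) choose k) / 4^k"

lemma cbinom_0 [simp]: "cbinom 0 = 1"
  by (simp add: cbinom_def)

lemma cbinom_Suc: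
  "cbinom (Suc k) = cbinom k * (2 * of_nat k + 1) / (2 * of_nat k + 2)"
proof -
  define A C K F :: rat
    where "A = of_nat ((2*Suc k) choose Suc k)" and "C = of_nat ((2*k) choose k)"
      and "K = of_nat k + 1" and "F = fact k"
  have F: "F \<noteq> 0" and K: "K \<noteq> 0"
    using of_nat_0_le_iff[of k, where 'a = rat] by (auto simp: F_def K_def)
  have "C = fact (2*k) / (F * F)"
    unfolding C_def F_def by (subst binomial_fact) auto
  then have C: "C * (F * F) = fact (2*k)" using F by simp
  have "A = fact (2*Suc k) / (fact (Suc k) * fact (Suc k))"
    unfolding A_def by (subst binomial_fact) auto
  also have "\<dots> = fact (2*k) * (2 * of_nat k + 1) * (2 * K) / ((F * K) * (F * K))"
    by (simp add: F_def K_def algebra_simps)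
  also have "fact (2*k) = C * (F * F)" using C by simp
  also have "C * (F * F) * (2 * of_nat k + 1) * (2 * K) / ((F * K) * (F * K))
      = 2 * C * (2 * of_nat k + 1) / K"
  proof -
    have "C * (F * F) * s * (2 * K) / ((F * K) * (F * K)) = 2 * C * s / K" for s
      using F K by (simp add: divide_simps)
    then show ?thesis .
  qed
  finally have "cbinom (Suc k) = 2 * C * (2 * of_nat k + 1) / K / 4 ^ Suc k"
    by (simp only: cbinom_def A_def)
  also have "\<dots> = C / 4 ^ k * (2 * of_nat k + 1) / (2 * K)" by simp
  finally show ?thesis by (simp add: cbinom_def C_def K_def)
qed

text \<open>The \<open>cbinom i\<close> are the moments of the arcsine distribution on [0, 1], so
  the m-th difference is the integral of t^j (1 - t)^m, a beta value symmetric in j and m. For j = 0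
  this says that \<open>cbinom\<close> is its own binomial transform.\<close>

lemma cbinom_difference:
  "(\<Sum>i\<le>m. (-1)^i * of_nat (m choose i) * cbinom (i + j))
     = cbinom j * cbinom m / of_nat ((m + j) choose j)"
proof (induction m arbitrary: j)
  case (Suc m)
  let ?b = "of_nat ((m + j) choose j) :: rat"
  have b: "?b \<noteq> 0" by simp
  have b1: "of_nat ((Suc m + j) choose j) = ?b * (of_nat m + of_nat j + 1) / (of_nat m + 1)"
  proof -
    have "(Suc m + j - j) * ((Suc m + j) choose j) = (Suc m + j) * ((m + j) choose j)"
      using binomial_absorb_comp[of "Suc m + j" j] by simp
    then have "Suc m * ((Suc m + j) choose j) = (Suc m + j) * ((m + j) choose j)" by simp
    then have "of_nat (Suc m) * of_nat ((Suc m + j) choose j) = (of_nat (Suc m + j) * ?b :: rat)"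
      by (simp only: of_nat_mult[symmetric])
    then show ?thesis by (simp add: field_simps)
  qed
  have b2: "of_nat ((m + Suc j) choose Suc j) = ?b * (of_nat m + of_nat j + 1) / (of_nat j + 1)"
    unfolding binomial_diagonal_rat by (simp add: add.commute)
  have "(\<Sum>i\<le>Suc m. (-1)^i * of_nat (Suc m choose i) * cbinom (i + j))
      = (\<Sum>i\<le>m. (-1)^i * of_nat (m choose i) * cbinom (i + j))
      - (\<Sum>i\<le>m. (-1)^i * of_nat (m choose i) * cbinom (i + Suc j))"
    by (subst sum_alternating_binomial_Suc) (simp add: algebra_simps sum_subtractf)
  also have "\<dots> = cbinom j * cbinom m / ?b
      - cbinom (Suc j) * cbinom m / of_nat ((m + Suc j) choose Suc j)"
    by (simp only: Suc.IH)
  also have "\<dots> = cbinom j * cbinom (Suc m) / of_nat ((Suc m + j) choose j)"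
  proof -
    have nz: "of_nat m + of_nat j + (1::rat) \<noteq> 0" "of_nat m + (1::rat) \<noteq> 0" "of_nat j + (1::rat) \<noteq> 0"
      "2 * of_nat m + (2::rat) \<noteq> 0" "2 * of_nat j + (2::rat) \<noteq> 0"
      by (intro less_imp_neq[symmetric] add_nonneg_pos; simp)+
    define B where "B = ?b"
    define M where "M = (of_nat m :: rat)"
    define J where "J = (of_nat j :: rat)"
    show ?thesis
      unfolding cbinom_Suc b1 b2 using nz b
      unfolding B_def[symmetric] M_def[symmetric] J_def[symmetric]
      by (simp add: divide_simps) (simp add: algebra_simps)
  qed
  finally show ?case .
qed simp

lemma G_seq_cbinom:
  "of_nat (G_seq n) = 16 ^ n * (\<Sum>k\<le>n. cbinom k ^ 2 * cbinom (n - k))"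
proof -
  have "of_nat (((2*k) choose k)^2 * ((2*n - 2*k) choose (n - k)) * 4^(n - k))
      = 16 ^ n * (cbinom k ^ 2 * cbinom (n - k))" if "k \<le> n" for k
  proof -
    have "(16::rat)^n = 16^k * 16^(n-k)" using that by (simp flip: power_add)
    moreover have "(16::rat)^j = 4^j * 4^j" for j by (simp flip: power_mult_distrib)
    moreover have "2*n - 2*k = 2*(n-k)" by simp
    ultimately show ?thesis
      by (simp add: cbinom_def power2_eq_square)
  qed
  then show ?thesis
    unfolding G_seq_def by (simp add: sum_distrib_left atLeast0AtMost)
qed

text \<open>Expand one factor \<open>cbinom k\<close> as \<open>\<Sum>j. (-1)^j * (k choose j) * cbinom j\<close>
  and sum over \<open>k\<close> first; both steps are instances of \<open>cbinom_difference\<close>.\<close>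

lemma sum_cbinom_convolution:
  "(\<Sum>k\<le>n. cbinom k ^ 2 * cbinom (n - k))
     = (\<Sum>k\<le>n. (-1)^k * of_nat (n choose k) * cbinom k ^ 2)"
proof -
  have expand: "cbinom k = (\<Sum>j\<le>k. (-1)^j * of_nat (k choose j) * cbinom j)" for k
    using cbinom_difference[of k 0] by simp
  let ?f = "\<lambda>k j. (-1)^k * of_nat (n choose k) * cbinom k * ((-1)^j * of_nat (k choose j) * cbinom j)"
  have inner: "(\<Sum>k\<in>{j..n}. ?f k j) = cbinom j ^ 2 * cbinom (n - j)" if "j \<le> n" for j
  proof -
    have "(\<Sum>k\<in>{j..n}. ?f k j) = (\<Sum>i\<le>n - j. ?f (i + j) j)"
      using that by (intro sum.reindex_bij_witness[of _ "\<lambda>i. i + j" "\<lambda>k. k - j"]) auto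
    also have "\<dots> = (\<Sum>i\<le>n - j. of_nat (n choose j) * cbinom j *
                     ((-1)^i * of_nat ((n - j) choose i) * cbinom (i + j)))"
    proof (rule sum.cong[OF refl])
      fix i assume "i \<in> {..n - j}"
      then have "i + j \<le> n" using that by auto
      then have "(n choose (i + j)) * ((i + j) choose j) = (n choose j) * ((n - j) choose i)"
        using choose_mult[of j "i + j" n] by simp
      then have c: "of_nat (n choose (i + j)) * of_nat ((i + j) choose j)
          = (of_nat (n choose j) * of_nat ((n - j) choose i) :: rat)" by (metis of_nat_mult)
      have s: "(-1)^(i+j) * (-1)^j = ((-1)^i :: rat)"
        by (simp add: power_add mult.assoc flip: power_mult_distrib)
      have "?f (i + j) j = ((-1)^(i+j) * (-1)^j) * (of_nat (n choose (i + j)) * of_nat ((i + j) choose j))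
          * cbinom (i+j) * cbinom j" by (simp add: algebra_simps)
      then show "?f (i + j) j = of_nat (n choose j) * cbinom j *
                     ((-1)^i * of_nat ((n - j) choose i) * cbinom (i + j))"
        unfolding s c by (simp add: algebra_simps)
    qed
    also have "\<dots> = of_nat (n choose j) * cbinom j *
        (cbinom j * cbinom (n - j) / of_nat ((n - j + j) choose j))"
      by (simp only: sum_distrib_left[symmetric] cbinom_difference)
    also have "\<dots> = cbinom j ^ 2 * cbinom (n - j)"
      using that by (simp add: power2_eq_square)
    finally show ?thesis .
  qed
  have "(\<Sum>k\<le>n. (-1)^k * of_nat (n choose k) * cbinom k ^ 2) = (\<Sum>k\<le>n. \<Sum>j\<le>k. ?f k j)"
    unfolding sum_distrib_left[symmetric] expand[symmetric]
    by (simp only: power2_eq_square mult.assoc)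
  also have "\<dots> = (\<Sum>j\<le>n. \<Sum>k\<in>{j..n}. ?f k j)"
    unfolding sum.Sigma[OF finite_atMost ballI[OF finite_atMost]]
      sum.Sigma[OF finite_atMost ballI[OF finite_atLeastAtMost]]
    by (rule sum.reindex_bij_witness[of _ prod.swap prod.swap]) auto
  also have "\<dots> = (\<Sum>j\<le>n. cbinom j ^ 2 * cbinom (n - j))"
    using inner by simp
  finally show ?thesis by simp
qed

section \<open>Truncated hypergeometric sums\<close>

text \<open>The coefficient of z^k in the Legendre function P_x(1 - 2 z). Writing it through x (x +
  1) makes the symmetry x -> -1 - x visible.\<close>

definition legendre_term :: "nat \<Rightarrow> rat \<Rightarrow> rat" where
  "legendre_term k x = (\<Prod>i<k. (of_nat i * of_nat (Suc i) - x * (x + 1)) / of_nat (Suc i) ^ 2)"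

text \<open>The truncated Euler product of sin(pi x) / (pi x).\<close>

definition sine_product :: "nat \<Rightarrow> rat \<Rightarrow> rat" where
  "sine_product k x = (\<Prod>i<k. 1 - x ^ 2 / of_nat (Suc i) ^ 2)"

lemma legendre_term_0 [simp]: "legendre_term 0 x = 1"
  by (simp add: legendre_term_def)

lemma legendre_term_Suc:
  "legendre_term (Suc k) x
     = legendre_term k x * ((of_nat k * of_nat (Suc k) - x * (x + 1)) / of_nat (Suc k) ^ 2)"
  by (simp add: legendre_term_def)

lemma sine_product_0 [simp]: "sine_product 0 x = 1"
  by (simp add: sine_product_def)

lemma sine_product_Suc:
  "sine_product (Suc k) x = sine_product k x * (1 - x ^ 2 / of_nat (Suc k) ^ 2)"
  by (simp add: sine_product_def)

lemma of_nat_Suc_neq_0_rat: "of_nat k + 1 \<noteq> (0::rat)" "1 + of_nat k \<noteq> (0::rat)"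
  by (metis add.commute of_nat_Suc of_nat_eq_0_iff nat.distinct(1))+

section \<open>The recursion x -> x - 1 for weighted sums of \<open>legendre_term\<close>\<close>

text \<open>Each factor is (i - x) (i + 1 + x). Regrouping pairs i - x with i + x into i^2 - x^2,
  which leaves -x at the lower end and k + 1 + x at the upper end.\<close>

lemma legendre_term_Suc_sine:
  "legendre_term (Suc k) x = - (x * (of_nat (Suc k) + x) / of_nat (Suc k) ^ 2) * sine_product k x"
proof (induction k)
  case 0
  show ?case by (simp add: legendre_term_def algebra_simps)
next
  case (Suc k)
  define a where "a = (of_nat (Suc k) :: rat)"
  have a: "a \<noteq> 0" "a + 1 \<noteq> 0" using of_nat_Suc_neq_0_rat[of "Suc k"] by (simp_all add: a_def)
  have S: "of_nat (Suc (Suc k)) = a + 1" by (simp add: a_def)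
  show ?case
    unfolding legendre_term_Suc[of "Suc k"] Suc.IH sine_product_Suc S a_def[symmetric]
    using a by (simp add: divide_simps) (simp add: algebra_simps power2_eq_square)
qed

lemma sine_product_minus: "sine_product k (- x) = sine_product k x"
  by (simp add: sine_product_def)

lemma legendre_term_reflect: "legendre_term k (- 1 - x) = legendre_term k x"
  by (simp add: legendre_term_def algebra_simps)

lemma legendre_term_Suc_sine':
  "legendre_term (Suc k) (x - 1) = x * (of_nat (Suc k) - x) / of_nat (Suc k) ^ 2 * sine_product k x"
  using legendre_term_reflect[of "Suc k" "- x"] legendre_term_Suc_sine[of k "- x"]
  by (simp add: sine_product_minus)

text \<open>The combination of the two sums at \<open>x\<close> and \<open>x - 1\<close> has terms
  \<open>2 * (sine_product k x - sine_product (k - 1) x)\<close>, so Abel summation applies.\<close>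

lemma sum_legendre_term_step:
  "(\<Sum>k\<le>N. legendre_term k x * g k) + (\<Sum>k\<le>N. legendre_term k (x - 1) * g k)
     = 2 * (sine_product N x * g N + (\<Sum>k<N. sine_product k x * (g k - g (Suc k))))"
proof (induction N)
  case (Suc N)
  define a where "a = (of_nat (Suc N) :: rat)"
  have a: "a \<noteq> 0" by (simp add: a_def del: of_nat_Suc)
  have "legendre_term (Suc N) x + legendre_term (Suc N) (x - 1)
      = 2 * (sine_product (Suc N) x - sine_product N x)"
    unfolding legendre_term_Suc_sine[of N x] legendre_term_Suc_sine'[of N x] sine_product_Suc a_def[symmetric]
    using a by (simp add: divide_simps) (simp add: algebra_simps power2_eq_square)
  then have "legendre_term (Suc N) x * g (Suc N) + legendre_term (Suc N) (x - 1) * g (Suc N)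
      = 2 * (sine_product (Suc N) x - sine_product N x) * g (Suc N)"
    by (simp only: distrib_right[symmetric])
  with Suc.IH show ?case by (simp add: algebra_simps)
qed (simp add: algebra_simps)

section \<open>Closed forms at natural x for harmonic weights\<close>

lemma sine_product_eq_0: "n > 0 \<Longrightarrow> n \<le> k \<Longrightarrow> sine_product k (of_nat n) = 0"
  unfolding sine_product_def by (subst prod_zero_iff) (auto intro!: bexI[of _ "n - 1"])

lemma legendre_term_of_nat:
  "legendre_term k (of_nat n) = (-1)^k * of_nat (n choose k) * of_nat ((n + k) choose k)"
proof (induction k)
  case (Suc k)
  define a where "a = (of_nat (Suc k) :: rat)"
  have a: "a \<noteq> 0" by (simp add: a_def del: of_nat_Suc)
  have 1: "of_nat (n choose Suc k) = of_nat (n choose k) * (of_nat n - (a - 1)) / a"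
    by (simp add: binomial_Suc_rat a_def)
  have 2: "of_nat ((n + Suc k) choose Suc k) = of_nat ((n + k) choose k) * (of_nat n + a) / a"
    unfolding binomial_diagonal_rat a_def ..
  have ka: "of_nat k = a - 1" by (simp add: a_def)
  show ?case
    unfolding legendre_term_Suc Suc.IH 1 2 ka a_def[symmetric]
    using a by (simp add: divide_simps) (simp add: algebra_simps power2_eq_square)
qed simp

lemma legendre_term_eq_0: "n < k \<Longrightarrow> legendre_term k (of_nat n) = 0"
  by (simp add: legendre_term_of_nat)

lemma legendre_term_minus_half: "legendre_term k (- 1 / 2) = cbinom k ^ 2"
proof (induction k)
  case (Suc k)
  have a: "of_nat k + (1::rat) \<noteq> 0" by (rule of_nat_Suc_neq_0_rat)
  have e: "2 * of_nat k + 2 = 2 * (of_nat k + 1 :: rat)" "of_nat (Suc k) = (of_nat k + 1 :: rat)" by simp_all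
  show ?case
    unfolding legendre_term_Suc Suc.IH cbinom_Suc e
    using a by (simp add: divide_simps) (simp add: algebra_simps power2_eq_square)
qed simp

text \<open>At x = n + 1 the boundary term of the general recursion vanishes because
  \<open>sine_product\<close> has a zero there, and both sums terminate by themselves.\<close>

lemma sum_legendre_term_Suc:
  "(\<Sum>k\<le>Suc n. legendre_term k (of_nat (Suc n)) * g k) + (\<Sum>k\<le>n. legendre_term k (of_nat n) * g k)
     = 2 * (\<Sum>k\<le>n. sine_product k (of_nat (Suc n)) * (g k - g (Suc k)))"
proof -
  have "(\<Sum>k\<le>n. legendre_term k (of_nat n) * g k) = (\<Sum>k\<le>Suc n. legendre_term k (of_nat n) * g k)"
    by (simp add: legendre_term_eq_0)
  moreover have "(\<Sum>k\<le>Suc n. legendre_term k (of_nat (Suc n)) * g k)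
      + (\<Sum>k\<le>Suc n. legendre_term k (of_nat (Suc n) - 1) * g k)
     = 2 * (\<Sum>k\<le>n. sine_product k (of_nat (Suc n)) * (g k - g (Suc k)))"
    by (subst sum_legendre_term_step)
      (simp add: sine_product_eq_0[of "Suc n" "Suc n"] lessThan_Suc_atMost del: of_nat_Suc)
  moreover have "of_nat (Suc n) - 1 = (of_nat n :: rat)" by simp
  ultimately show ?thesis by (simp only:)
qed

text \<open>The extra factor n clears the only obstruction to writing the product with binomial
  coefficients, which makes the alternating binomial sums applicable.\<close>

lemma sine_product_of_nat:
  "sine_product k (of_nat n) * of_nat n
     = (-1)^k * of_nat ((n + k) choose k) * of_nat (n choose Suc k) * of_nat (Suc k)"
proof (induction k)
  case (Suc k)
  define a where "a = (of_nat (Suc k) :: rat)"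
  have a: "a \<noteq> 0" by (simp add: a_def del: of_nat_Suc)
  have 1: "of_nat (n choose Suc (Suc k)) * of_nat (Suc (Suc k)) = of_nat (n choose Suc k) * (of_nat n - a)"
    unfolding binomial_Suc_rat[of n "Suc k"] a_def by (simp del: of_nat_Suc)
  have 2: "of_nat ((n + Suc k) choose Suc k) = of_nat ((n + k) choose k) * (of_nat n + a) / a"
    unfolding binomial_diagonal_rat a_def ..
  have "sine_product (Suc k) (of_nat n) * of_nat n
      = (sine_product k (of_nat n) * of_nat n) * (1 - of_nat n ^ 2 / a ^ 2)"
    by (simp add: sine_product_Suc a_def)
  also have "\<dots> = (-1)^k * of_nat ((n + k) choose k) * of_nat (n choose Suc k) * a * (1 - of_nat n ^ 2 / a ^ 2)"
    by (simp only: Suc.IH a_def)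
  also have "\<dots> = (-1)^(Suc k) * of_nat ((n + Suc k) choose Suc k) * (of_nat (n choose Suc k) * (of_nat n - a))"
    unfolding 2 using a by (simp add: divide_simps) (simp add: algebra_simps power2_eq_square)
  finally show ?case by (simp only: 1[symmetric] mult.assoc)
qed simp

lemma sum_sine_product_over_Suc:
  "(\<Sum>k\<le>n. sine_product k (of_nat (Suc n)) / of_nat (Suc k)) = (-1)^n / of_nat (Suc n)"
proof -
  let ?N = "of_nat (Suc n) :: rat"
  have "(\<Sum>k\<le>n. sine_product k ?N / of_nat (Suc k)) * ?N
     = (\<Sum>k\<le>n. (-1)^k * of_nat (Suc n choose Suc k) * of_nat ((n + Suc k) choose Suc n))"
    unfolding sum_distrib_right
  proof (rule sum.cong[OF refl])
    fix k
    have "sine_product k ?N / of_nat (Suc k) * ?N = (sine_product k ?N * ?N) / of_nat (Suc k)" by simp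
    also have "\<dots> = (-1)^k * of_nat ((Suc n + k) choose k) * of_nat (Suc n choose Suc k)"
      unfolding sine_product_of_nat by (simp del: of_nat_Suc binomial_Suc_Suc)
    also have "(Suc n + k) choose k = (n + Suc k) choose Suc n"
      using binomial_symmetric[of k "Suc n + k"] by simp
    finally show "sine_product k ?N / of_nat (Suc k) * ?N
        = (-1)^k * of_nat (Suc n choose Suc k) * of_nat ((n + Suc k) choose Suc n)" by simp
  qed
  \<comment> \<open>The index shift adds the term k = 0, which is zero since n choose (n + 1)
    is.\<close>
  also have "\<dots> = - (\<Sum>k\<le>Suc n. (-1)^k * of_nat (Suc n choose k) * of_nat ((n + k) choose (0 + Suc n)))"
    by (subst sum.atMost_Suc_shift) (simp add: sum_negf del: binomial_Suc_Suc)
  also have "\<dots> = (-1)^n"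
    unfolding sum_alternating_binomial_shift by simp
  finally show ?thesis by (simp add: field_simps del: of_nat_Suc)
qed

text \<open>The weight enters the recursion only through its differences -1 / (k + 1). Hence (-1)^n
  times the sum grows by 2 / (n + 1) at each step, without alternation.\<close>

lemma sum_legendre_term_harmonic:
  "(\<Sum>k\<le>n. legendre_term k (of_nat n) * harmonic k) = 2 * (-1)^n * harmonic n"
proof (induction n)
  case (Suc n)
  have "(\<Sum>k\<le>n. sine_product k (of_nat (Suc n)) * (harmonic k - harmonic (Suc k)))
      = - ((-1)^n / of_nat (Suc n))"
    unfolding sum_sine_product_over_Suc[symmetric] by (simp add: harmonic_Suc sum_negf)
  then show ?case
    using sum_legendre_term_Suc[of n harmonic] Suc.IH
    by (simp add: harmonic_Suc[of n] algebra_simps del: of_nat_Suc sum.atMost_Suc)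
qed simp

definition harmonic2 :: "nat \<Rightarrow> rat" where
  "harmonic2 n = (\<Sum>i=1..n. 1 / of_nat i ^ 2)"

lemma harmonic2_0 [simp]: "harmonic2 0 = 0"
  by (simp add: harmonic2_def)

lemma harmonic2_Suc: "harmonic2 (Suc n) = harmonic2 n + 1 / of_nat (Suc n) ^ 2"
  by (simp add: harmonic2_def)

text \<open>Telescoping: x^2 / (k + 1)^2 times \<open>sine_product k x\<close> is the drop from
  \<open>sine_product k x\<close> to the next product.\<close>

lemma sum_sine_product_over_Suc_square:
  "x ^ 2 * (\<Sum>k<n. sine_product k x / of_nat (Suc k) ^ 2) = 1 - sine_product n x"
  by (induction n) (simp_all add: sine_product_Suc algebra_simps)

text \<open>Here two consecutive sums add up to -2 / (n + 1)^2 with no sign, so unrolling produces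
  an alternating sum. This is how an Euler number gets in, in contrast to the weight
  \<open>harmonic\<close>.\<close>

lemma sum_legendre_term_harmonic2:
  "(\<Sum>k\<le>n. legendre_term k (of_nat n) * harmonic2 k)
     = - 2 * (-1)^n * (\<Sum>j=1..n. (-1)^j / of_nat j ^ 2)"
proof (induction n)
  case (Suc n)
  let ?N = "of_nat (Suc n) :: rat"
  have N: "?N ^ 2 \<noteq> 0" by (simp del: of_nat_Suc)
  have "?N ^ 2 * (\<Sum>k\<le>n. sine_product k ?N / of_nat (Suc k) ^ 2) = 1"
    using sum_sine_product_over_Suc_square[of ?N "Suc n"]
    by (simp add: sine_product_eq_0[of "Suc n" "Suc n"] lessThan_Suc_atMost del: of_nat_Suc)
  then have "(\<Sum>k\<le>n. sine_product k ?N / of_nat (Suc k) ^ 2) = 1 / ?N ^ 2"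
    using N by (metis nonzero_mult_div_cancel_left)
  then have "(\<Sum>k\<le>n. sine_product k ?N * (harmonic2 k - harmonic2 (Suc k))) = - (1 / ?N ^ 2)"
    by (simp add: harmonic2_Suc sum_negf)
  moreover have "(-1)^n * (-1)^n = (1::rat)" by (simp flip: power_mult_distrib)
  ultimately show ?case
    using sum_legendre_term_Suc[of n harmonic2] Suc.IH
    by (simp add: algebra_simps del: of_nat_Suc sum.atMost_Suc)
qed simp

section \<open>The weight \<open>cbinom\<close>: a recursion of step two in x\<close>

text \<open>A contiguity relation. With its mirror image for x - 1 it makes every term of the
  telescoping identity below a rational multiple of \<open>legendre_term k x\<close>.\<close>

lemma legendre_term_Suc_add_1:
  "legendre_term (Suc k) (x + 1)
     = - ((of_nat (Suc k) + x) * (of_nat (Suc k) + 1 + x)) / of_nat (Suc k) ^ 2 * legendre_term k x"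
proof (induction k)
  case 0
  show ?case by (simp add: legendre_term_def algebra_simps)
next
  case (Suc k)
  define a where "a = (of_nat (Suc k) :: rat)"
  have a: "a \<noteq> 0" "a + 1 \<noteq> 0" using of_nat_Suc_neq_0_rat[of "Suc k"] by (simp_all add: a_def)
  have S: "of_nat (Suc (Suc k)) = a + 1" and k: "of_nat k = a - 1" by (simp_all add: a_def)
  show ?case
    unfolding legendre_term_Suc[of "Suc k" "x + 1"] Suc.IH legendre_term_Suc[of k x] S a_def[symmetric] k
    using a by (simp add: divide_simps) (simp add: algebra_simps power2_eq_square)
qed

lemma legendre_term_Suc_diff_1:
  "legendre_term (Suc k) (x - 1)
     = - ((of_nat k - x) * (of_nat (Suc k) - x)) / of_nat (Suc k) ^ 2 * legendre_term k x"
  using legendre_term_reflect[of "Suc k" "- x"] legendre_term_Suc_add_1[of k "- 1 - x"]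
  by (simp add: legendre_term_reflect algebra_simps)

text \<open>A creative-telescoping certificate for the recursion between x - 1 and x + 1. The right
  side vanishes as soon as x is a natural number below K.\<close>

lemma sum_legendre_term_cbinom_telescope:
  "(\<Sum>k\<le>K. ((x + 1) ^ 2 * legendre_term k (x + 1) - x ^ 2 * legendre_term k (x - 1)) * cbinom k)
     = (2 * x + 1) * (2 * of_nat K + 1) * legendre_term K x * cbinom K"
proof (induction K)
  case 0
  show ?case by (simp add: power2_eq_square algebra_simps)
next
  case (Suc k)
  define a where "a = (of_nat (Suc k) :: rat)"
  have a: "a \<noteq> 0" by (simp add: a_def del: of_nat_Suc)
  have k: "of_nat k = a - 1" by (simp add: a_def)
  have e: "2 * (a - 1) + 2 = 2 * a" by simp
  show ?case
    unfolding sum.atMost_Suc Suc.IH cbinom_Suc legendre_term_Suc_add_1 legendre_term_Suc_diff_1 legendre_term_Suc[of k x] a_def[symmetric] k e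
    using a by (simp add: divide_simps) (simp add: algebra_simps power2_eq_square)
qed

lemma sum_legendre_term_cbinom_step:
  "of_nat (n + 2) ^ 2 * (\<Sum>k\<le>n + 2. legendre_term k (of_nat (n + 2)) * cbinom k)
     = of_nat (n + 1) ^ 2 * (\<Sum>k\<le>n. legendre_term k (of_nat n) * cbinom k)"
proof -
  let ?x = "of_nat (n + 1) :: rat"
  have x: "?x + 1 = of_nat (n + 2)" "?x - 1 = of_nat n" by simp_all
  have "(\<Sum>k\<le>n. legendre_term k (of_nat n) * cbinom k)
      = (\<Sum>k\<le>n + 2. legendre_term k (of_nat n) * cbinom k)"
    by (simp add: legendre_term_eq_0)
  moreover have "(\<Sum>k\<le>n + 2. ((?x + 1) ^ 2 * legendre_term k (?x + 1) - ?x ^ 2 * legendre_term k (?x - 1)) * cbinom k) = 0"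
    by (subst sum_legendre_term_cbinom_telescope) (simp add: legendre_term_eq_0 del: of_nat_add of_nat_Suc)
  ultimately show ?thesis
    unfolding x by (simp only: left_diff_distrib sum_subtractf mult.assoc sum_distrib_left[symmetric])
qed

text \<open>Analytically this is the mean of P_n(cos theta) over the circle, by the moment
  interpretation of \<open>cbinom\<close>; parity makes it vanish for odd n. The proof iterates the
  recursion of step two from n = 0 and n = 1.\<close>

lemma sum_legendre_term_cbinom:
  "(\<Sum>k\<le>2 * m. legendre_term k (of_nat (2 * m)) * cbinom k) = cbinom m ^ 2"
  "(\<Sum>k\<le>2 * m + 1. legendre_term k (of_nat (2 * m + 1)) * cbinom k) = 0"
proof (induction m)
  case 0
  show "(\<Sum>k\<le>2 * 0. legendre_term k (of_nat (2 * 0)) * cbinom k) = cbinom 0 ^ 2" by simp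
  show "(\<Sum>k\<le>2 * 0 + 1. legendre_term k (of_nat (2 * 0 + 1)) * cbinom k) = 0"
    by (simp add: legendre_term_def cbinom_def)
next
  case (Suc m)
  have e: "2 * Suc m = 2 * m + 2" "2 * Suc m + 1 = (2 * m + 1) + 2" by simp_all
  have a: "of_nat m + 1 \<noteq> (0::rat)" by (rule of_nat_Suc_neq_0_rat)
  show "(\<Sum>k\<le>2 * Suc m. legendre_term k (of_nat (2 * Suc m)) * cbinom k) = cbinom (Suc m) ^ 2"
  proof -
    define X where "X = (\<Sum>k\<le>2 * m + 2. legendre_term k (of_nat (2 * m + 2)) * cbinom k)"
    have "of_nat (2 * m + 2) ^ 2 * X = of_nat (2 * m + 1) ^ 2 * cbinom m ^ 2"
      unfolding X_def using sum_legendre_term_cbinom_step[of "2 * m"] Suc.IH(1) by simp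
    then have "(2 * (of_nat m + 1)) ^ 2 * X = (2 * of_nat m + 1) ^ 2 * cbinom m ^ 2"
      by (simp add: algebra_simps)
    then have "X = (2 * of_nat m + 1) ^ 2 * cbinom m ^ 2 / (2 * (of_nat m + 1)) ^ 2"
      using a by (simp add: eq_divide_eq mult.commute)
    also have "\<dots> = cbinom (Suc m) ^ 2"
      unfolding cbinom_Suc by (simp add: power_divide power2_eq_square algebra_simps)
    finally show ?thesis unfolding X_def e .
  qed
  have "of_nat (2 * m + 1 + 2) ^ 2 * (\<Sum>k\<le>2 * Suc m + 1. legendre_term k (of_nat (2 * Suc m + 1)) * cbinom k) = 0"
    unfolding e(2) sum_legendre_term_cbinom_step Suc.IH by simp
  moreover have "of_nat (2 * m + 1 + 2) ^ 2 \<noteq> (0::rat)"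
    unfolding power_eq_0_iff of_nat_eq_0_iff by simp
  ultimately show "(\<Sum>k\<le>2 * Suc m + 1. legendre_term k (of_nat (2 * Suc m + 1)) * cbinom k) = 0"
    by (simp only: mult_eq_0_iff simp_thms)
qed

section \<open>Congruences between \<open>p\<close>-integral rationals\<close>

text \<open>Trades the reduced fraction of the definition for an arbitrary one, so that closure
  under sums and products needs no cancellation.\<close>

lemma p_integral_iff:
  assumes "prime p"
  shows "p_integral p x \<longleftrightarrow> (\<exists>a b. \<not> int p dvd b \<and> x = of_int a / of_int b)"
proof
  assume "p_integral p x"
  obtain a b where q: "quotient_of x = (a, b)" by force
  then have "coprime b (int p)" using \<open>p_integral p x\<close> by (simp add: p_integral_def)
  then have "\<not> int p dvd b"
    using prime_gt_1_nat[OF assms] coprime_common_divisor[of b "int p" "int p"] by auto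
  moreover have "x = of_int a / of_int b" using q by (rule quotient_of_div)
  ultimately show "\<exists>a b. \<not> int p dvd b \<and> x = of_int a / of_int b" by blast
next
  assume "\<exists>a b. \<not> int p dvd b \<and> x = of_int a / of_int b"
  then obtain a b where ab: "\<not> int p dvd b" "x = of_int a / of_int b" by blast
  obtain c d where q: "quotient_of x = (c, d)" by force
  have x: "x = of_int c / of_int d" using q by (rule quotient_of_div)
  have "d > 0" using q by (rule quotient_of_denom_pos)
  have "b \<noteq> 0" using ab(1) by auto
  have "(of_int (a * d) :: rat) = of_int (c * b)"
    using x ab(2) \<open>d > 0\<close> \<open>b \<noteq> 0\<close> by (simp add: field_simps)
  then have "a * d = c * b" by (simp only: of_int_eq_iff)
  then have "d dvd c * b" by (metis dvd_triv_right)
  moreover have "coprime d c" using quotient_of_coprime[OF q] by (simp add: coprime_commute)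
  ultimately have "d dvd b" by (simp add: coprime_dvd_mult_right_iff)
  then have "\<not> int p dvd d" using ab(1) dvd_trans by blast
  then have "coprime (int p) d" using assms by (intro prime_imp_coprime) auto
  then show "p_integral p x" by (simp add: p_integral_def q coprime_commute)
qed

locale prime_gt_3 =
  fixes p :: nat
  assumes prime_p: "prime p" and p_gt_3: "p > 3"
begin

abbreviation "P \<equiv> (of_nat p :: rat)"

definition half :: nat where "half = (p - 1) div 2"

lemma odd_p: "odd p"
  using prime_p p_gt_3 prime_odd_nat by simp

lemma p_eq: "p = 2 * half + 1"
  using odd_p by (auto simp: half_def elim: oddE)

lemma P_eq: "P = 2 * of_nat half + 1"
  by (subst p_eq) simp

lemma half_gt_1: "half > 1"
  using p_gt_3 p_eq by linarith

lemma p_neq_0 [simp]: "p \<noteq> 0"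
  using p_gt_3 by simp

section \<open>The ring of \<open>p\<close>-integral rationals and its congruences\<close>

lemma p_integral_of_int: "p_integral p (of_int a)"
  unfolding p_integral_iff[OF prime_p] using prime_gt_1_nat[OF prime_p]
  by (intro exI[of _ a] exI[of _ 1]) auto

lemma p_integral_0: "p_integral p 0" using p_integral_of_int[of 0] by simp
lemma p_integral_1: "p_integral p 1" using p_integral_of_int[of 1] by simp
lemma p_integral_numeral: "p_integral p (numeral n)" using p_integral_of_int[of "numeral n"] by simp
lemma p_integral_of_nat: "p_integral p (of_nat n)" using p_integral_of_int[of "int n"] by simp

lemma p_integral_add: assumes "p_integral p x" "p_integral p y" shows "p_integral p (x + y)"
proof -
  from assms obtain a b c d where 1: "\<not> int p dvd b" "x = of_int a / of_int b"
    and 2: "\<not> int p dvd d" "y = of_int c / of_int d" unfolding p_integral_iff[OF prime_p] by blast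
  have "b \<noteq> 0" "d \<noteq> 0" using 1 2 by auto
  then have "x + y = of_int (a * d + c * b) / of_int (b * d)" using 1 2 by (simp add: field_simps)
  moreover have "\<not> int p dvd b * d"
    using 1 2 prime_p by (simp add: prime_dvd_mult_iff)
  ultimately show ?thesis unfolding p_integral_iff[OF prime_p] by blast
qed

lemma p_integral_mult: assumes "p_integral p x" "p_integral p y" shows "p_integral p (x * y)"
proof -
  from assms obtain a b c d where 1: "\<not> int p dvd b" "x = of_int a / of_int b"
    and 2: "\<not> int p dvd d" "y = of_int c / of_int d" unfolding p_integral_iff[OF prime_p] by blast
  have "x * y = of_int (a * c) / of_int (b * d)" using 1 2 by simp
  moreover have "\<not> int p dvd b * d"
    using 1 2 prime_p by (simp add: prime_dvd_mult_iff)
  ultimately show ?thesis unfolding p_integral_iff[OF prime_p] by blast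
qed

lemma p_integral_uminus: "p_integral p x \<Longrightarrow> p_integral p (- x)"
  using p_integral_mult[OF p_integral_of_int[of "-1"]] by simp

lemma p_integral_diff: "p_integral p x \<Longrightarrow> p_integral p y \<Longrightarrow> p_integral p (x - y)"
  using p_integral_add[OF _ p_integral_uminus] by simp

lemma p_integral_power: "p_integral p x \<Longrightarrow> p_integral p (x ^ n)"
  by (induction n) (auto intro: p_integral_mult p_integral_1)

lemma p_integral_sum: "(\<And>i. i \<in> A \<Longrightarrow> p_integral p (f i)) \<Longrightarrow> p_integral p (sum f A)"
  by (induction A rule: infinite_finite_induct) (auto intro: p_integral_add p_integral_0)

lemma p_integral_prod: "(\<And>i. i \<in> A \<Longrightarrow> p_integral p (f i)) \<Longrightarrow> p_integral p (prod f A)"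
  by (induction A rule: infinite_finite_induct) (auto intro: p_integral_mult p_integral_1)

lemma p_integral_inverse_of_nat: "\<not> p dvd n \<Longrightarrow> p_integral p (1 / of_nat n)"
  unfolding p_integral_iff[OF prime_p]
  by (intro exI[of _ 1] exI[of _ "int n"]) simp

lemma p_integral_divide_of_nat: "p_integral p x \<Longrightarrow> \<not> p dvd n \<Longrightarrow> p_integral p (x / of_nat n)"
  using p_integral_mult[OF _ p_integral_inverse_of_nat] by fastforce

lemma p_integral_divide_of_nat_power:
  "p_integral p x \<Longrightarrow> \<not> p dvd n \<Longrightarrow> p_integral p (x / of_nat n ^ k)"
  using p_integral_divide_of_nat[of x "n ^ k"] prime_dvd_power_nat[OF prime_p] by auto

lemma not_dvd_less: "0 < n \<Longrightarrow> n < p \<Longrightarrow> \<not> p dvd n"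
  using dvd_imp_le by auto

lemma not_dvd_power_2: "\<not> p dvd 2 ^ k"
  using prime_dvd_power_nat[OF prime_p, of 2 k] not_dvd_less[of 2] p_gt_3 by auto

lemma p_integral_divide_numerals:
  assumes "p_integral p x"
  shows "p_integral p (x / 2)" "p_integral p (x / 3)" "p_integral p (x / 4)"
    "p_integral p (x / 2 ^ k)" "p_integral p (x / 4 ^ k)" "p_integral p (x / 16 ^ k)"
proof -
  show "p_integral p (x / 2)" "p_integral p (x / 2 ^ k)"
    using p_integral_divide_of_nat[OF assms not_dvd_power_2[of 1]]
      p_integral_divide_of_nat[OF assms not_dvd_power_2[of k]] by simp_all
  show "p_integral p (x / 3)"
    using p_integral_divide_of_nat[OF assms not_dvd_less[of 3]] p_gt_3 by simp
  show "p_integral p (x / 4)"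
    using p_integral_divide_of_nat[OF assms not_dvd_power_2[of 2]] by simp
  show "p_integral p (x / 4 ^ k)"
    using p_integral_divide_of_nat[OF assms not_dvd_power_2[of "2 * k"]] by (simp add: power_mult)
  show "p_integral p (x / 16 ^ k)"
    using p_integral_divide_of_nat[OF assms not_dvd_power_2[of "4 * k"]] by (simp add: power_mult)
qed

lemmas p_integral_intros = p_integral_0 p_integral_1 p_integral_numeral p_integral_of_nat p_integral_of_int
  p_integral_add p_integral_diff p_integral_uminus p_integral_mult p_integral_power
  p_integral_sum p_integral_prod p_integral_divide_numerals p_integral_divide_of_nat

text \<open>Unlike in \<open>rat_cong_prime_power\<close>, the two sides need not be integral
  themselves. Congruences can thus be added and chained without side conditions; integrality is
  asked for only where products are formed.\<close>

definition pcong :: "nat \<Rightarrow> rat \<Rightarrow> rat \<Rightarrow> bool" where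
  "pcong k x y \<longleftrightarrow> (\<exists>c. p_integral p c \<and> x - y = P ^ k * c)"

lemma pcongI: "x - y = P ^ k * c \<Longrightarrow> p_integral p c \<Longrightarrow> pcong k x y"
  unfolding pcong_def by blast

lemma pcongE:
  assumes "pcong k x y"
  obtains c where "p_integral p c" "x = y + P ^ k * c"
proof -
  from assms obtain c where "p_integral p c" "x - y = P ^ k * c" unfolding pcong_def by blast
  then show ?thesis using that by (metis add_diff_cancel_left' diff_add_cancel add.commute)
qed

lemma pcong_refl [simp]: "pcong k x x"
  by (rule pcongI[of _ _ _ 0]) (simp_all add: p_integral_0)

lemma pcong_sym: "pcong k x y \<Longrightarrow> pcong k y x"
  by (erule pcongE, rule pcongI[of _ _ _ "- _"]) (auto intro: p_integral_uminus)

lemma pcong_add: "pcong k x y \<Longrightarrow> pcong k x' y' \<Longrightarrow> pcong k (x + x') (y + y')"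
  by (elim pcongE, rule pcongI[of _ _ _ "_ + _"])
    (auto intro: p_integral_add simp: algebra_simps)

lemma pcong_trans [trans]: "pcong k x y \<Longrightarrow> pcong k y z \<Longrightarrow> pcong k x z"
  by (elim pcongE, rule pcongI[of _ _ _ "_ + _"])
    (auto intro: p_integral_add simp: algebra_simps)

lemma pcong_eq_trans [trans]: "pcong k x y \<Longrightarrow> y = z \<Longrightarrow> pcong k x z" "x = y \<Longrightarrow> pcong k y z \<Longrightarrow> pcong k x z"
  by simp_all

lemma pcong_uminus: "pcong k x y \<Longrightarrow> pcong k (- x) (- y)"
  by (erule pcongE, rule pcongI[of _ _ _ "- _"]) (auto intro: p_integral_uminus)

lemma pcong_diff: "pcong k x y \<Longrightarrow> pcong k x' y' \<Longrightarrow> pcong k (x - x') (y - y')"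
  using pcong_add[OF _ pcong_uminus] by fastforce

lemma pcong_scale: "p_integral p z \<Longrightarrow> pcong k x y \<Longrightarrow> pcong k (z * x) (z * y)"
  by (erule pcongE, rule pcongI[of _ _ _ "z * _"])
    (auto intro: p_integral_mult simp: algebra_simps)

lemma pcong_integral: "pcong k x y \<Longrightarrow> p_integral p y \<Longrightarrow> p_integral p x"
  by (erule pcongE) (auto intro!: p_integral_intros)

lemma pcong_mult:
  assumes "pcong k x y" "pcong k x' y'" "p_integral p y" "p_integral p y'"
  shows "pcong k (x * x') (y * y')"
proof -
  have "pcong k (x * x') (x * y')"
    using assms pcong_integral by (intro pcong_scale) auto
  also have "pcong k (x * y') (y * y')"
    using pcong_scale[OF assms(4,1)] by (simp add: mult.commute)
  finally show ?thesis .
qed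

lemma pcong_power: "pcong k x y \<Longrightarrow> p_integral p y \<Longrightarrow> pcong k (x ^ n) (y ^ n)"
  by (induction n) (auto intro!: pcong_mult p_integral_power)

lemma pcong_sum: "(\<And>i. i \<in> A \<Longrightarrow> pcong k (f i) (g i)) \<Longrightarrow> pcong k (sum f A) (sum g A)"
  by (induction A rule: infinite_finite_induct) (auto intro: pcong_add)

lemma pcong_weaken: "pcong k x y \<Longrightarrow> j \<le> k \<Longrightarrow> pcong j x y"
proof (erule pcongE)
  fix c assume "j \<le> k" "p_integral p c" "x = y + P ^ k * c"
  then show "pcong j x y"
    by (intro pcongI[of _ _ _ "P ^ (k - j) * c"])
      (auto intro!: p_integral_mult p_integral_power p_integral_of_nat simp: mult.assoc[symmetric] simp flip: power_add)
qed

lemma pcong_mult_P: "pcong (j + k) (P ^ j * x) (P ^ j * y) \<longleftrightarrow> pcong k x y"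
proof -
  have "P ^ j * x - P ^ j * y = P ^ (j + k) * c \<longleftrightarrow> x - y = P ^ k * c" for c
    by (simp add: power_add mult.assoc flip: right_diff_distrib)
  then show ?thesis by (simp add: pcong_def)
qed

lemma pcong_mult_P1: "pcong k x y \<Longrightarrow> pcong (Suc k) (P * x) (P * y)"
  using pcong_mult_P[of 1 k x y] by simp

lemma pcong_P_0: "p_integral p c \<Longrightarrow> pcong k (P ^ k * c) 0"
  by (rule pcongI) simp_all

lemma pcong_cancel:
  "pcong k (z * x) (z * y) \<Longrightarrow> p_integral p (1 / z) \<Longrightarrow> z \<noteq> 0 \<Longrightarrow> pcong k x y"
  using pcong_scale[of "1 / z" k "z * x" "z * y"] by simp

lemma pcong_divide_of_nat:
  "pcong k x y \<Longrightarrow> \<not> p dvd n \<Longrightarrow> pcong k (x / of_nat n) (y / of_nat n)"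
  using pcong_scale[OF p_integral_inverse_of_nat] by fastforce

text \<open>The denominator of the cofactor is prime to p, so divisibility by p^k can be read off
  among the integers.\<close>

lemma pcong_of_int: "pcong k (of_int a) (of_int b) \<longleftrightarrow> [a = b] (mod int p ^ k)"
proof
  assume "pcong k (of_int a) (of_int b)"
  then obtain c where c: "p_integral p c" "of_int a - of_int b = P ^ k * c" unfolding pcong_def by blast
  then obtain d e where de: "\<not> int p dvd e" "c = of_int d / of_int e" unfolding p_integral_iff[OF prime_p] by blast
  then have "e \<noteq> 0" by auto
  then have "(of_int ((a - b) * e) :: rat) = of_int (int p ^ k * d)"
    using c(2) de(2) by (simp add: field_simps)
  then have "(a - b) * e = int p ^ k * d" by (simp only: of_int_eq_iff)
  then have "int p ^ k dvd (a - b) * e" by simp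
  moreover have "coprime (int p ^ k) e" using de(1) prime_p by (auto intro: prime_imp_coprime)
  ultimately have "int p ^ k dvd a - b" by (simp add: coprime_dvd_mult_left_iff)
  then show "[a = b] (mod int p ^ k)" by (simp add: cong_iff_dvd_diff)
next
  assume "[a = b] (mod int p ^ k)"
  then obtain c where "a - b = int p ^ k * c" by (auto simp: cong_iff_dvd_diff dvd_def)
  then have "of_int a - of_int b = P ^ k * of_int c"
    by (metis of_int_diff of_int_mult of_int_power of_int_of_nat_eq)
  then show "pcong k (of_int a) (of_int b)" by (rule pcongI) (rule p_integral_of_int)
qed

text \<open>Every product of two or more of the small terms contains p^(2j). It serves with j = 2
  for factors 1 - p^2 a and with j = 1 for factors 1 - p a.\<close>

lemma pcong_prod_one_add:
  assumes "\<And>i. i \<in> A \<Longrightarrow> p_integral p (a i)"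
  shows "pcong (2 * j) (\<Prod>i\<in>A. 1 + P ^ j * a i) (1 + P ^ j * (\<Sum>i\<in>A. a i))"
  using assms
proof (induction A rule: infinite_finite_induct)
  case (insert x A)
  let ?s = "\<Sum>i\<in>A. a i"
  have s: "p_integral p ?s" using insert.prems by (intro p_integral_sum) auto
  have ax: "p_integral p (a x)" using insert.prems by auto
  have "pcong (2 * j) ((1 + P ^ j * a x) * (\<Prod>i\<in>A. 1 + P ^ j * a i)) ((1 + P ^ j * a x) * (1 + P ^ j * ?s))"
    using insert.prems by (intro pcong_scale insert.IH p_integral_intros) auto
  also have "pcong (2 * j) ((1 + P ^ j * a x) * (1 + P ^ j * ?s)) (1 + P ^ j * (a x + ?s))"
  proof (rule pcongI)
    have "P ^ (2 * j) = P ^ j * P ^ j" by (simp add: mult_2 power_add)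
    then show "(1 + P ^ j * a x) * (1 + P ^ j * ?s) - (1 + P ^ j * (a x + ?s)) = P ^ (2 * j) * (a x * ?s)"
      by (simp only:) (simp add: algebra_simps)
  qed (intro p_integral_mult s ax)
  finally show ?case using insert.hyps by simp
qed simp_all

end

section \<open>Harmonic numbers modulo powers of \<open>p\<close>\<close>

definition odd_harmonic :: "nat \<Rightarrow> rat" where
  "odd_harmonic n = (\<Sum>i<n. 1 / of_nat (2 * i + 1))"

definition odd_harmonic2 :: "nat \<Rightarrow> rat" where
  "odd_harmonic2 n = (\<Sum>i<n. 1 / of_nat (2 * i + 1) ^ 2)"

context prime_gt_3
begin

lemma p_integral_cbinom: "p_integral p (cbinom k)"
  by (simp add: cbinom_def p_integral_intros)

lemma p_integral_harmonic: "k < p \<Longrightarrow> p_integral p (harmonic k)"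
  unfolding harmonic_def by (intro p_integral_sum p_integral_inverse_of_nat not_dvd_less) auto

lemma p_integral_harmonic2: "k < p \<Longrightarrow> p_integral p (harmonic2 k)"
  unfolding harmonic2_def
  by (intro p_integral_sum p_integral_divide_of_nat_power p_integral_1 not_dvd_less) auto

lemma half_less: "k \<le> half \<Longrightarrow> i < k \<Longrightarrow> 2 * i + 1 < p"
  using p_eq by simp

lemma half_less_p: "k \<le> half \<Longrightarrow> k < p"
  using p_eq by simp

lemma p_integral_odd_harmonic: "k \<le> half \<Longrightarrow> p_integral p (odd_harmonic k)"
  unfolding odd_harmonic_def
  by (intro p_integral_sum p_integral_inverse_of_nat not_dvd_less half_less[of k]) auto

lemma p_integral_odd_harmonic2: "k \<le> half \<Longrightarrow> p_integral p (odd_harmonic2 k)"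
  unfolding odd_harmonic2_def
  by (intro p_integral_sum p_integral_divide_of_nat_power p_integral_1 not_dvd_less half_less[of k]) auto

text \<open>In this range p occurs in (2k)! but not in k!.\<close>

lemma cbinom_large:
  assumes "half < k" "k < p"
  shows "pcong 1 (cbinom k) 0"
proof -
  have "p dvd fact (2 * k)"
    using assms p_eq prime_dvd_fact_iff[OF prime_p] by simp
  moreover have "fact (2 * k) = fact k * fact k * ((2 * k) choose k)"
    using binomial_fact_lemma[of k "2 * k"] by simp
  moreover have "\<not> p dvd fact k" using assms prime_dvd_fact_iff[OF prime_p] by simp
  ultimately have "p dvd ((2 * k) choose k)" using prime_p by (simp add: prime_dvd_mult_iff)
  then obtain c where "(2 * k) choose k = p * c" by (auto elim: dvdE)
  then show ?thesis
    by (intro pcongI[of _ _ _ "of_nat c / 4 ^ k"]) (simp_all add: cbinom_def p_integral_intros)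
qed

text \<open>For x = \<open>half\<close>, 4 (i (i + 1) - x (x + 1)) = (2i + 1)^2 - p^2. Splitting off
  (2i + 1)^2 gives the factor of \<open>cbinom k ^ 2\<close> and leaves 1 - p^2 / (2i +
  1)^2.\<close>

lemma legendre_term_half:
  "legendre_term k (of_nat half) = cbinom k ^ 2 * (\<Prod>i<k. 1 + P ^ 2 * (- 1 / of_nat (2 * i + 1) ^ 2))"
proof (induction k)
  case (Suc k)
  define a where "a = (of_nat (2 * k + 1) :: rat)"
  have a: "a \<noteq> 0" by (simp add: a_def del: of_nat_add of_nat_Suc)
  have a1: "a + 1 \<noteq> 0" using of_nat_Suc_neq_0_rat(1)[of "2 * k + 1"] by (simp add: a_def)
  have k: "of_nat k = (a - 1) / 2" and S: "of_nat (Suc k) = (a + 1) / 2"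
    and h: "of_nat half = (P - 1) / 2" by (simp_all add: a_def P_eq)
  have e: "2 * ((a - 1) / 2) + 1 = a" "2 * ((a - 1) / 2) + 2 = a + 1" by (simp_all add: field_simps)
  define X where "X = (\<Prod>i<k. 1 + P ^ 2 * (- 1 / of_nat (2 * i + 1) ^ 2))"
  show ?case
    unfolding legendre_term_Suc Suc.IH cbinom_Suc prod.lessThan_Suc a_def[symmetric] X_def[symmetric]
    unfolding k S h e
    using a a1 by (simp add: divide_simps) (simp add: algebra_simps power2_eq_square)
qed simp

lemma pcong_legendre_term_half:
  assumes "k \<le> half"
  shows "pcong 4 (legendre_term k (of_nat half)) (cbinom k ^ 2 * (1 - P ^ 2 * odd_harmonic2 k))"
proof -
  have "pcong (2 * 2) (\<Prod>i<k. 1 + P ^ 2 * (- 1 / of_nat (2 * i + 1) ^ 2))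
      (1 + P ^ 2 * (\<Sum>i<k. - 1 / of_nat (2 * i + 1) ^ 2))"
    using assms
    by (intro pcong_prod_one_add p_integral_divide_of_nat_power p_integral_uminus p_integral_1
         not_dvd_less half_less[of k]) auto
  then have "pcong 4 (\<Prod>i<k. 1 + P ^ 2 * (- 1 / of_nat (2 * i + 1) ^ 2)) (1 - P ^ 2 * odd_harmonic2 k)"
    by (simp add: odd_harmonic2_def sum_negf)
  then show ?thesis
    unfolding legendre_term_half by (intro pcong_scale p_integral_power p_integral_cbinom)
qed

lemma pcong_legendre_term_half_2:
  assumes "k \<le> half"
  shows "pcong 2 (legendre_term k (of_nat half)) (cbinom k ^ 2)"
proof -
  have "pcong 2 (legendre_term k (of_nat half)) (cbinom k ^ 2 * (1 - P ^ 2 * odd_harmonic2 k))"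
    using pcong_legendre_term_half[OF assms] by (rule pcong_weaken) simp
  also have "pcong 2 \<dots> (cbinom k ^ 2)"
    by (rule pcongI[of _ _ _ "- (cbinom k ^ 2 * odd_harmonic2 k)"])
       (auto simp: algebra_simps intro!: p_integral_intros p_integral_odd_harmonic2 p_integral_cbinom assms)
  finally show ?thesis .
qed

section \<open>Sums of inverse powers under i -> p - i\<close>

lemma pcong_inverse_reflect:
  assumes "0 < i" "i < p"
  shows "pcong 1 (1 / of_nat (p - i)) (- 1 / of_nat i)"
    and "pcong 1 (1 / of_nat (p - i) ^ 2) (1 / of_nat i ^ 2)"
proof -
  have i: "\<not> p dvd i" "\<not> p dvd p - i" "i \<noteq> 0" "p - i > 0"
    using assms not_dvd_less[of i] not_dvd_less[of "p - i"] by auto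
  have int: "p_integral p (1 / of_nat (p - i))" "p_integral p (1 / of_nat i)"
    using i by (auto intro: p_integral_inverse_of_nat simp del: of_nat_diff)
  have "1 / of_nat (p - i) - (- 1 / of_nat i) = P ^ 1 * (1 / of_nat (p - i) * (1 / of_nat i))"
    using assms i by (simp add: field_simps of_nat_diff)
  then show c: "pcong 1 (1 / of_nat (p - i)) (- 1 / of_nat i)"
    by (rule pcongI) (intro p_integral_mult int)
  have "pcong 1 ((1 / of_nat (p - i)) ^ 2) ((- 1 / of_nat i) ^ 2)"
    using int by (intro pcong_power c) (auto dest: p_integral_uminus)
  then show "pcong 1 (1 / of_nat (p - i) ^ 2) (1 / of_nat i ^ 2)"
    by (simp add: power_divide)
qed

text \<open>Summing \<open>1 / i ^ 2\<close> over all nonzero residues by pairing \<open>i\<close> with \<open>p - i\<close> gives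
  \<open>2 * harmonic2 half\<close>; by parity of \<open>i\<close> it gives \<open>harmonic2 half / 2\<close>.\<close>

lemma odd_harmonic2_reflect: "pcong 1 (odd_harmonic2 half) (harmonic2 half / 4)"
proof -
  have "odd_harmonic2 half = (\<Sum>i=1..half. 1 / of_nat (p - 2 * i) ^ 2)"
    unfolding odd_harmonic2_def
    by (rule sum.reindex_bij_witness[of _ "\<lambda>i. half - i" "\<lambda>i. half - i"])
       (use p_eq in \<open>auto intro!: arg_cong[where f = "\<lambda>n. 1 / of_nat n ^ 2"]\<close>)
  also have "pcong 1 \<dots> (\<Sum>i=1..half. 1 / of_nat (2 * i) ^ 2)"
    using p_eq by (intro pcong_sum pcong_inverse_reflect) auto
  also have "\<dots> = harmonic2 half / 4"
    by (simp add: harmonic2_def power_mult_distrib sum_divide_distrib mult.commute)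
  finally show ?thesis .
qed

lemma sum_split_half:
  fixes f :: "nat \<Rightarrow> rat"
  shows "(\<Sum>i=1..p - 1. f i) = (\<Sum>i=1..half. f i) + (\<Sum>i=1..half. f (p - i))"
    and "(\<Sum>i=1..p - 1. f i) = (\<Sum>i=1..half. f (2 * i)) + (\<Sum>i<half. f (2 * i + 1))"
proof -
  have "{1..p - 1} = {1..half} \<union> {half + 1..p - 1}" using p_eq by auto
  then have "(\<Sum>i=1..p - 1. f i) = (\<Sum>i=1..half. f i) + (\<Sum>i=half + 1..p - 1. f i)"
    by (simp add: sum.union_disjoint)
  also have "(\<Sum>i=half + 1..p - 1. f i) = (\<Sum>i=1..half. f (p - i))"
    using p_eq by (intro sum.reindex_bij_witness[of _ "\<lambda>i. p - i" "\<lambda>i. p - i"]) auto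
  finally show "(\<Sum>i=1..p - 1. f i) = (\<Sum>i=1..half. f i) + (\<Sum>i=1..half. f (p - i))" .
  have "(\<Sum>i=1..2 * n. f i) = (\<Sum>i=1..n. f (2 * i)) + (\<Sum>i<n. f (2 * i + 1))" for n
    by (induction n) (simp_all add: algebra_simps)
  then show "(\<Sum>i=1..p - 1. f i) = (\<Sum>i=1..half. f (2 * i)) + (\<Sum>i<half. f (2 * i + 1))"
    using p_eq by (metis add_diff_cancel_right')
qed

lemma harmonic2_half: "pcong 1 (harmonic2 half) 0"
  and harmonic2_p_minus_1: "pcong 1 (harmonic2 (p - 1)) 0"
proof -
  have "harmonic2 (p - 1) = (\<Sum>i=1..half. 1 / of_nat i ^ 2) + (\<Sum>i=1..half. 1 / of_nat (p - i) ^ 2)"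
    unfolding harmonic2_def by (rule sum_split_half)
  also have "pcong 1 \<dots> ((\<Sum>i=1..half. 1 / of_nat i ^ 2) + (\<Sum>i=1..half. 1 / of_nat i ^ 2))"
    using p_eq by (intro pcong_add pcong_refl pcong_sum pcong_inverse_reflect) auto
  also have "\<dots> = 2 * harmonic2 half" by (simp add: harmonic2_def)
  finally have 1: "pcong 1 (harmonic2 (p - 1)) (2 * harmonic2 half)" .
  have "harmonic2 (p - 1) = (\<Sum>i=1..half. 1 / of_nat (2 * i) ^ 2) + odd_harmonic2 half"
    unfolding harmonic2_def odd_harmonic2_def by (rule sum_split_half)
  also have "\<dots> = harmonic2 half / 4 + odd_harmonic2 half"
    by (simp add: harmonic2_def power_mult_distrib sum_divide_distrib mult.commute)
  also have "pcong 1 \<dots> (harmonic2 half / 4 + harmonic2 half / 4)"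
    by (intro pcong_add pcong_refl odd_harmonic2_reflect)
  finally have 2: "pcong 1 (harmonic2 (p - 1)) (harmonic2 half / 4 + harmonic2 half / 4)" .
  have "pcong 1 (2 * harmonic2 half) (harmonic2 half / 4 + harmonic2 half / 4)"
    using pcong_trans[OF pcong_sym[OF 1] 2] .
  then have "pcong 1 (2 * harmonic2 half - (harmonic2 half / 4 + harmonic2 half / 4)) 0"
    using pcong_diff[OF _ pcong_refl[of 1 "harmonic2 half / 4 + harmonic2 half / 4"]] by fastforce
  \<comment> \<open>The two evaluations 2 H and H / 2 of the same sum differ by 3/2 H, and 2/3 is
    \<open>p\<close>-integral because p > 3.\<close>
  then have "pcong 1 (2 / 3 * (2 * harmonic2 half - (harmonic2 half / 4 + harmonic2 half / 4))) (2 / 3 * 0)"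
    by (intro pcong_scale p_integral_intros)
  then show h: "pcong 1 (harmonic2 half) 0" by simp
  have "pcong 1 (2 * harmonic2 half) (2 * 0)" by (intro pcong_scale p_integral_intros h)
  with 1 show "pcong 1 (harmonic2 (p - 1)) 0" using pcong_trans by fastforce
qed

lemma odd_harmonic2_half: "pcong 1 (odd_harmonic2 half) 0"
proof -
  have "pcong 1 (1 / 4 * harmonic2 half) (1 / 4 * 0)"
    by (intro pcong_scale harmonic2_half p_integral_intros)
  then show ?thesis using pcong_trans[OF odd_harmonic2_reflect] by simp
qed

text \<open>Wolstenholme's theorem. Each pair 1/i + 1/(p - i) equals p / (i (p - i)), which yields
  one factor p; the remaining sum is minus \<open>harmonic2 half\<close> modulo p, which yields the
  second.\<close>

lemma harmonic_p_minus_1: "pcong 2 (harmonic (p - 1)) 0"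
proof -
  have "harmonic (p - 1) = (\<Sum>i=1..half. 1 / of_nat i) + (\<Sum>i=1..half. 1 / of_nat (p - i))"
    unfolding harmonic_def by (rule sum_split_half)
  also have "\<dots> = (\<Sum>i=1..half. P * (1 / of_nat (p - i) * (1 / of_nat i)))"
    unfolding sum.distrib[symmetric]
    by (rule sum.cong[OF refl]) (use p_eq in \<open>simp add: of_nat_diff field_simps\<close>)
  also have "\<dots> = P * (\<Sum>i=1..half. 1 / of_nat (p - i) * (1 / of_nat i))"
    by (simp add: sum_distrib_left)
  finally have e: "harmonic (p - 1) = P * (\<Sum>i=1..half. 1 / of_nat (p - i) * (1 / of_nat i))" .
  have "pcong 1 (\<Sum>i=1..half. 1 / of_nat (p - i) * (1 / of_nat i)) (\<Sum>i=1..half. - 1 / of_nat i * (1 / of_nat i))"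
  proof (intro pcong_sum)
    fix i assume "i \<in> {1..half}"
    then have i: "0 < i" "i < p" using p_eq by auto
    have "p_integral p (1 / of_nat i)" using i by (intro p_integral_inverse_of_nat not_dvd_less)
    then show "pcong 1 (1 / of_nat (p - i) * (1 / of_nat i)) (- 1 / of_nat i * (1 / of_nat i))"
      using pcong_scale[OF _ pcong_inverse_reflect(1)[OF i], of "1 / of_nat i"] by (simp add: mult.commute)
  qed
  also have "(\<Sum>i=1..half. - 1 / of_nat i * (1 / of_nat i)) = - harmonic2 half"
    by (simp add: harmonic2_def power2_eq_square sum_negf)
  also have "pcong 1 \<dots> (- 0)" by (intro pcong_uminus harmonic2_half)
  finally have "pcong (Suc 1) (P * (\<Sum>i=1..half. 1 / of_nat (p - i) * (1 / of_nat i))) (P * - 0)"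
    by (rule pcong_mult_P1)
  then show ?thesis unfolding e by (simp add: numeral_2_eq_2)
qed

section \<open>Morley's congruence, Fermat quotients and \<open>harmonic half\<close>\<close>

lemma not_dvd_choose: "n < p \<Longrightarrow> k \<le> n \<Longrightarrow> \<not> p dvd (n choose k)"
  using binomial_fact_lemma[of k n] prime_dvd_fact_iff[OF prime_p, of n]
  by (metis dvd_mult linorder_not_less)

lemma not_dvd_central: "\<not> p dvd ((2 * half) choose half)"
  using p_eq by (intro not_dvd_choose) auto

lemma power_2_p_minus_1: "2 ^ (p - 1) = (4::rat) ^ half"
  by (subst p_eq) (simp add: power_mult)

text \<open>At k = \<open>half\<close> both sides contain the central binomial coefficient, which is
  prime to p and cancels. The precision is p^3 because the coefficient of p^2 is
  \<open>odd_harmonic2 half\<close>, itself divisible by p.\<close>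

lemma morley: "pcong 3 (cbinom half) ((-1) ^ half * 2 ^ (p - 1))"
proof -
  let ?C = "of_nat ((2 * half) choose half) :: rat"
  have C0: "?C \<noteq> 0" by simp
  have "pcong 3 (legendre_term half (of_nat half)) (cbinom half ^ 2 * (1 - P ^ 2 * odd_harmonic2 half))"
    using pcong_legendre_term_half[of half] pcong_weaken by auto
  also have "pcong 3 \<dots> (cbinom half ^ 2)"
  proof -
    obtain c where "p_integral p c" "odd_harmonic2 half = P * c"
      using odd_harmonic2_half unfolding pcong_def by auto
    then show ?thesis
      by (intro pcongI[of _ _ _ "- (cbinom half ^ 2 * c)"])
         (auto simp: algebra_simps power2_eq_square power3_eq_cube intro!: p_integral_intros p_integral_cbinom)
  qed
  finally have "pcong 3 ((-1) ^ half * ?C) ((?C / 4 ^ half) ^ 2)"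
    by (simp add: legendre_term_of_nat cbinom_def mult_2)
  then have "pcong 3 (?C * (-1) ^ half) (?C * (?C / 16 ^ half))"
    by (simp add: power_divide power2_eq_square mult.commute power_mult_distrib[symmetric])
  then have "pcong 3 ((-1) ^ half) (?C / 16 ^ half)"
    using C0 by (rule pcong_cancel[OF _ p_integral_inverse_of_nat[OF not_dvd_central]])
  then have "pcong 3 (4 ^ half * (-1) ^ half) (4 ^ half * (?C / 16 ^ half))"
    by (intro pcong_scale p_integral_intros)
  moreover have "4 ^ half * (?C / 16 ^ half) = cbinom half"
    using power_mult_distrib[of "4::rat" 4 half] by (simp add: cbinom_def)
  ultimately show ?thesis
    unfolding power_2_p_minus_1 by (auto intro: pcong_sym simp: mult.commute)
qed

abbreviation "fq \<equiv> fermat_quotient p 2"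

lemma p_integral_fq: "p_integral p fq"
proof -
  have "[2 ^ (p - 1) = 1] (mod p)"
    using fermat_theorem[OF prime_p, of 2] not_dvd_power_2[of 1] by simp
  then have "p dvd 2 ^ (p - 1) - 1" by (simp add: cong_altdef_nat)
  then obtain c where "2 ^ (p - 1) - 1 = p * c" by (auto elim: dvdE)
  then have "2 ^ (p - 1) = p * c + 1"
    by (metis add.commute le_add_diff_inverse one_le_power one_le_numeral)
  then have "(of_nat (2 ^ (p - 1)) :: rat) = of_nat (p * c + 1)" by (simp only:)
  then have "fq = of_nat c" by (simp add: fermat_quotient_def)
  then show ?thesis by (simp add: p_integral_of_nat)
qed

lemma power_2_fq: "2 ^ (p - 1) = 1 + P * fq"
  by (simp add: fermat_quotient_def)

lemma choose_p_minus_1: "(-1) ^ k * of_nat ((p - 1) choose k) = (\<Prod>i<k. 1 - P / of_nat (Suc i))"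
  if "k \<le> p - 1"
  using that
proof (induction k)
  case (Suc k)
  define a where "a = (of_nat (Suc k) :: rat)"
  have a: "a \<noteq> 0" by (simp add: a_def del: of_nat_Suc)
  have e: "of_nat ((p - 1) choose Suc k) = of_nat ((p - 1) choose k) * (P - a) / a"
    using Suc.prems by (simp add: binomial_Suc_rat a_def of_nat_diff)
  have IH: "(-1) ^ k * of_nat ((p - 1) choose k) = (\<Prod>i<k. 1 - P / of_nat (Suc i))"
    using Suc by simp
  show ?case
    unfolding prod.lessThan_Suc IH[symmetric] a_def[symmetric] e
    using a by (simp add: field_simps)
qed simp

text \<open>The coefficient of p^2 is the second elementary symmetric function of 1, 1/2, ..., 1/k,
  expressed through power sums.\<close>

lemma pcong_choose_p_minus_1:
  assumes "k \<le> p - 1"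
  shows "pcong 3 ((-1) ^ k * of_nat ((p - 1) choose k))
    (1 - P * harmonic k + P ^ 2 / 2 * (harmonic k ^ 2 - harmonic2 k))"
  unfolding choose_p_minus_1[OF assms] using assms
proof (induction k)
  case (Suc k)
  define a where "a = (1 / of_nat (Suc k) :: rat)"
  have "Suc k < p" using Suc.prems p_gt_3 by linarith
  then have int: "p_integral p a" "p_integral p (harmonic k)" "p_integral p (harmonic2 k)"
    using not_dvd_less[of "Suc k"] unfolding a_def
    by (auto intro!: p_integral_inverse_of_nat p_integral_harmonic p_integral_harmonic2 simp del: of_nat_Suc)
  have "pcong 3 ((1 - P * a) * (\<Prod>i<k. 1 - P / of_nat (Suc i)))
     ((1 - P * a) * (1 - P * harmonic k + P ^ 2 / 2 * (harmonic k ^ 2 - harmonic2 k)))"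
    using Suc by (intro pcong_scale) (auto intro!: p_integral_intros int)
  also have "pcong 3 \<dots> (1 - P * (harmonic k + a) + P ^ 2 / 2 * ((harmonic k + a) ^ 2 - (harmonic2 k + a ^ 2)))"
    by (rule pcongI[of _ _ _ "- a * (harmonic k ^ 2 - harmonic2 k) / 2"])
       (auto intro!: p_integral_intros int simp: field_simps power2_eq_square power3_eq_cube)
  finally show ?case
    by (simp add: harmonic_Suc harmonic2_Suc a_def mult.commute power_divide)
qed simp

text \<open>The coefficient (p - 1) choose \<open>half\<close> is central, so (-1)^half times it is
  (1 + p q)^2 modulo p^3 by Morley's congruence, while the product expansion gives it in terms of H
  = \<open>harmonic half\<close>. Dividing the comparison by p gives H = -2 q modulo p; inserting
  H^2 = 4 q^2 into the quadratic term gives H modulo p^2.\<close>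

lemma harmonic_half: "pcong 2 (harmonic half) (- 2 * fq + P * fq ^ 2)"
  and harmonic_half_1: "pcong 1 (harmonic half) (- 2 * fq)"
proof -
  let ?H = "harmonic half"
  have H: "p_integral p ?H" by (simp add: p_integral_harmonic half_less_p)
  note q = p_integral_fq
  have "2 * half = p - 1" using p_eq by simp
  then have c: "cbinom half = of_nat ((p - 1) choose half) / 2 ^ (p - 1)"
    by (simp only: cbinom_def power_2_p_minus_1)
  have s: "(-1) ^ half * (-1) ^ half = (1::rat)" by (simp flip: power_mult_distrib)
  have "pcong 3 ((-1) ^ half * 2 ^ (p - 1) * cbinom half) ((-1) ^ half * 2 ^ (p - 1) * ((-1) ^ half * 2 ^ (p - 1)))"
    by (intro pcong_scale morley p_integral_intros)
  moreover have "(-1) ^ half * 2 ^ (p - 1) * ((-1) ^ half * 2 ^ (p - 1)) = (2 ^ (p - 1)) ^ 2 * (((-1) ^ half * (-1) ^ half) :: rat)"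
    by (simp only: power2_eq_square mult_ac)
  ultimately have "pcong 3 ((-1) ^ half * of_nat ((p - 1) choose half)) ((1 + P * fq) ^ 2)"
    unfolding s c power_2_fq[symmetric] by simp
  from pcong_trans[OF pcong_sym[OF this] pcong_choose_p_minus_1[of half]]
  have "pcong 3 ((1 + P * fq) ^ 2) (1 - P * ?H + P ^ 2 / 2 * (?H ^ 2 - harmonic2 half))"
    using half_less_p[of half] by simp
  then have 1: "pcong (1 + 2) (P ^ 1 * (2 * fq + P * fq ^ 2)) (P ^ 1 * (- ?H + P / 2 * (?H ^ 2 - harmonic2 half)))"
    unfolding pcong_def by (simp add: algebra_simps power2_eq_square power3_eq_cube)
  have 2: "pcong 2 (2 * fq + P * fq ^ 2) (- ?H + P / 2 * (?H ^ 2 - harmonic2 half))"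
    using 1 unfolding pcong_mult_P .
  obtain c where c: "p_integral p c" "harmonic2 half = P * c"
    using harmonic2_half unfolding pcong_def by auto
  obtain d where d: "p_integral p d" "2 * fq + P * fq ^ 2 - (- ?H + P / 2 * (?H ^ 2 - harmonic2 half)) = P ^ 2 * d"
    using 2 unfolding pcong_def by auto
  \<comment> \<open>All that is known so far only to be integral goes into e, so that H = -2 q + p e
    holds exactly and can be squared.\<close>
  define e where "e = P * d - fq ^ 2 + (?H ^ 2 - harmonic2 half) / 2"
  have e: "p_integral p e" unfolding e_def c(2) by (intro p_integral_intros H q c d)
  have He: "?H = - 2 * fq + P * e"
    using d(2) by (simp add: e_def field_simps power2_eq_square)
  show "pcong 1 ?H (- 2 * fq)"
    by (rule pcongI[of _ _ _ e]) (simp_all add: e He)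
  have H2: "?H ^ 2 = 4 * fq ^ 2 + P * (- 4 * fq * e + P * e ^ 2)"
    unfolding He by (simp add: power2_eq_square algebra_simps)
  have X: "P / 2 * (?H ^ 2 - P * c)
      = 2 * P * fq ^ 2 + P ^ 2 * ((- 4 * fq * e + P * e ^ 2 - c) / 2)"
    unfolding H2 by (simp add: field_simps power2_eq_square)
  have "?H - (- 2 * fq + P * fq ^ 2) = P / 2 * (?H ^ 2 - P * c) - 2 * P * fq ^ 2 + P ^ 2 * d"
    using d(2) unfolding c(2) by (simp add: algebra_simps)
  then have "?H - (- 2 * fq + P * fq ^ 2) = P ^ 2 * (d + (- 4 * fq * e + P * e ^ 2 - c) / 2)"
    unfolding X by (simp add: algebra_simps)
  then show "pcong 2 ?H (- 2 * fq + P * fq ^ 2)"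
    by (rule pcongI) (intro p_integral_intros q e c d)
qed

end

section \<open>Euler numbers\<close>

lemma euler_number_odd_eq_0: "odd n \<Longrightarrow> euler_number n = 0"
  by (subst euler_number.simps) (auto elim: oddE)

lemma sum_binomial_euler_number:
  assumes "even n" "n > 0"
  shows "(\<Sum>k\<le>n. int (n choose k) * euler_number k) = 0"
proof -
  obtain m where m: "n = 2 * m" "m \<ge> 1" using assms by (auto elim!: evenE)
  have "(\<Sum>k\<le>n. int (n choose k) * euler_number k)
      = (\<Sum>k\<in>{k. k \<le> n \<and> even k}. int (n choose k) * euler_number k)"
    by (rule sum.mono_neutral_right) (auto simp: euler_number_odd_eq_0)
  also have "\<dots> = (\<Sum>k=0..m. int ((2 * m) choose (2 * k)) * euler_number (2 * m - 2 * k))"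
  proof (rule sum.reindex_bij_witness[of _ "\<lambda>k. 2 * m - 2 * k" "\<lambda>k. m - k div 2"])
    fix k assume "k \<in> {k. k \<le> n \<and> even k}"
    then have k: "2 * (m - k div 2) = 2 * m - k" "k \<le> 2 * m" by (auto simp: m(1) elim!: evenE)
    then have "(2 * m) choose (2 * (m - k div 2)) = (2 * m) choose k"
      by (metis binomial_symmetric)
    then show "int ((2 * m) choose (2 * (m - k div 2))) * euler_number (2 * m - 2 * (m - k div 2))
        = int (n choose k) * euler_number k"
      using k by (simp add: m(1))
  qed (auto simp: m(1) elim!: evenE)
  also have "\<dots> = euler_number (2 * m) + (\<Sum>k=1..m. int ((2 * m) choose (2 * k)) * euler_number (2 * m - 2 * k))"
    by (simp add: sum.atLeast_Suc_atMost)
  also have "\<dots> = 0" using euler_number_even[OF m(2)] by simp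
  finally show ?thesis .
qed

text \<open>Coefficient form of E(z) (exp z + exp (-z)) = 2, where E is the exponential generating
  function of the Euler numbers.\<close>

lemma sum_binomial_euler_number_parity:
  "(\<Sum>k\<le>n. int (n choose k) * euler_number k * (1 + (-1) ^ (n - k))) = (if n = 0 then 2 else 0)"
proof (cases "even n")
  case True
  have "(\<Sum>k\<le>n. int (n choose k) * euler_number k * (1 + (-1) ^ (n - k)))
      = (\<Sum>k\<le>n. 2 * (int (n choose k) * euler_number k))"
  proof (rule sum.cong[OF refl])
    fix k assume "k \<in> {..n}"
    then show "int (n choose k) * euler_number k * (1 + (-1) ^ (n - k)) = 2 * (int (n choose k) * euler_number k)"
      using True by (cases "even k") (auto simp: euler_number_odd_eq_0)
  qed
  also have "\<dots> = 2 * (\<Sum>k\<le>n. int (n choose k) * euler_number k)" by (rule sum_distrib_left[symmetric])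
  finally show ?thesis
    using True sum_binomial_euler_number[of n] by (auto simp: euler_number_0)
next
  case False
  have "int (n choose k) * euler_number k * (1 + (-1) ^ (n - k)) = 0" if "k \<le> n" for k
    using False that by (cases "even k") (auto simp: euler_number_odd_eq_0)
  then show ?thesis using False by (auto intro!: sum.neutral)
qed

text \<open>\<open>euler_polynomial n x\<close> is \<open>2 ^ n\<close> times the classical Euler polynomial at \<open>(x + 1) / 2\<close>.\<close>

definition euler_polynomial :: "nat \<Rightarrow> int \<Rightarrow> int" where
  "euler_polynomial n x = (\<Sum>k\<le>n. int (n choose k) * euler_number k * x ^ (n - k))"

text \<open>The classical E_n(y + 1) + E_n(y) = 2 y^n at y = x / 2. Expanding (x + 1)^m + (x - 1)^m
  and collecting powers of x reduces it to the preceding identity.\<close>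

lemma euler_polynomial_step:
  "euler_polynomial n (x + 1) + euler_polynomial n (x - 1) = 2 * x ^ n"
proof -
  let ?f = "\<lambda>k i. int (n choose k) * euler_number k * (int ((n - k) choose i) * (1 + (-1) ^ i) * x ^ (n - k - i))"
  have "(x + 1) ^ m + (x - 1) ^ m = (\<Sum>i\<le>m. int (m choose i) * (1 + (-1) ^ i) * x ^ (m - i))" for m
    using binomial_ring[of 1 x m] binomial_ring[of "-1" x m]
    by (simp add: algebra_simps sum.distrib)
  then have "euler_polynomial n (x + 1) + euler_polynomial n (x - 1) = (\<Sum>k\<le>n. \<Sum>i\<le>n - k. ?f k i)"
    unfolding euler_polynomial_def sum.distrib[symmetric] distrib_left[symmetric]
    by (simp add: sum_distrib_left)
  also have "\<dots> = (\<Sum>j\<le>n. \<Sum>k\<le>j. ?f k (j - k))"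
    unfolding sum.Sigma[OF finite_atMost ballI[OF finite_atMost]]
    by (rule sum.reindex_bij_witness[of _ "\<lambda>(j, k). (k, j - k)" "\<lambda>(k, i). (k + i, k)"]) auto
  also have "\<dots> = (\<Sum>j\<le>n. int (n choose j) * x ^ (n - j) *
      (\<Sum>k\<le>j. int (j choose k) * euler_number k * (1 + (-1) ^ (j - k))))"
    unfolding sum_distrib_left
  proof (intro sum.cong refl)
    fix j k assume "j \<in> {..n}" "k \<in> {..j}"
    then have jk: "k \<le> j" "j \<le> n" by auto
    then have e1: "int (n choose k) * int ((n - k) choose (j - k)) = int (n choose j) * int (j choose k)"
      using choose_mult[OF jk] by (metis of_nat_mult)
    have e2: "n - k - (j - k) = n - j" using jk by simp
    have "?f k (j - k) = (int (n choose k) * int ((n - k) choose (j - k)))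
        * (euler_number k * (1 + (-1) ^ (j - k)) * x ^ (n - k - (j - k)))"
      by (simp only: mult_ac)
    then show "?f k (j - k)
        = int (n choose j) * x ^ (n - j) * (int (j choose k) * euler_number k * (1 + (-1) ^ (j - k)))"
      unfolding e1 e2 by (simp only: mult_ac)
  qed
  also have "\<dots> = (\<Sum>j\<in>{0}. int (n choose j) * x ^ (n - j) *
      (\<Sum>k\<le>j. int (j choose k) * euler_number k * (1 + (-1) ^ (j - k))))"
    by (rule sum.mono_neutral_right) (auto simp: sum_binomial_euler_number_parity)
  also have "\<dots> = 2 * x ^ n" by (simp add: sum_binomial_euler_number_parity euler_number_0)
  finally show ?thesis .
qed

text \<open>With alternating signs the step relation telescopes at the even integers. For m =
  \<open>half\<close> the upper end is p - 1, which is -1 modulo p.\<close>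

lemma sum_alternating_odd_power:
  "2 * (\<Sum>j<m. (-1) ^ j * int (2 * j + 1) ^ n)
     = euler_polynomial n 0 - (-1) ^ m * euler_polynomial n (int (2 * m))"
proof (induction m)
  case (Suc m)
  have "euler_polynomial n (int (2 * Suc m)) + euler_polynomial n (int (2 * m)) = 2 * int (2 * m + 1) ^ n"
    using euler_polynomial_step[of n "int (2 * m + 1)"] by (simp add: algebra_simps)
  then have "2 * ((-1) ^ m * int (2 * m + 1) ^ n)
      = (-1) ^ m * (euler_polynomial n (int (2 * Suc m)) + euler_polynomial n (int (2 * m)))"
    by simp
  with Suc.IH show ?case
    by (simp only: sum.lessThan_Suc distrib_left power_Suc)
qed simp

lemma euler_polynomial_0: "euler_polynomial n 0 = euler_number n"
proof -
  have "euler_polynomial n 0 = (\<Sum>k\<in>{n}. int (n choose k) * euler_number k * 0 ^ (n - k))"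
    unfolding euler_polynomial_def by (rule sum.mono_neutral_right) auto
  then show ?thesis by simp
qed

lemma euler_polynomial_minus_1:
  assumes "even n" "n > 0"
  shows "euler_polynomial n (-1) = 0"
proof -
  have "euler_polynomial n 1 = 0"
    using sum_binomial_euler_number[OF assms] by (simp add: euler_polynomial_def)
  then show ?thesis using euler_polynomial_step[of n 0] assms by simp
qed

section \<open>The descent from x = -1/2 to x = -p/2\<close>

text \<open>Compares the two factorizations of \<open>legendre_term (Suc k) (x - 1)\<close>, through
  the sine products at x and at x - 1.\<close>

lemma sine_product_shift:
  "x * (of_nat (Suc k) - x) * sine_product k x = - ((x - 1) * (of_nat (Suc k) + (x - 1)) * sine_product k (x - 1))"
proof -
  define S where "S = (of_nat (Suc k) :: rat)"
  have "S \<noteq> 0" by (simp add: S_def del: of_nat_Suc)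
  then have "x * (S - x) * sine_product k x = S ^ 2 * (x * (S - x) / S ^ 2 * sine_product k x)"
    by simp
  also have "x * (S - x) / S ^ 2 * sine_product k x
      = - ((x - 1) * (S + (x - 1)) / S ^ 2) * sine_product k (x - 1)"
    unfolding S_def legendre_term_Suc_sine[symmetric] legendre_term_Suc_sine'[symmetric] ..
  also have "S ^ 2 * (- ((x - 1) * (S + (x - 1)) / S ^ 2) * sine_product k (x - 1))
      = - ((x - 1) * (S + (x - 1)) * sine_product k (x - 1))"
    using \<open>S \<noteq> 0\<close> by simp
  finally show ?thesis unfolding S_def .
qed

text \<open>With constant weight only the boundary term of the recursion survives. For n =
  \<open>half\<close> the endpoint -1/2 - n is -p/2.\<close>

lemma sum_legendre_term_descent:
  "(\<Sum>k\<le>N. legendre_term k (- 1 / 2))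
     = (-1) ^ n * (\<Sum>k\<le>N. legendre_term k (- 1 / 2 - of_nat n))
       + 2 * (\<Sum>j<n. (-1) ^ j * sine_product N (of_nat (2 * j + 1) / 2))"
proof (induction n)
  case (Suc n)
  have "(\<Sum>k\<le>N. legendre_term k (- 1 / 2 - of_nat n)) + (\<Sum>k\<le>N. legendre_term k (- 1 / 2 - of_nat (Suc n)))
      = 2 * sine_product N (- 1 / 2 - of_nat n)"
    using sum_legendre_term_step[where N = N and x = "- 1 / 2 - of_nat n" and g = "\<lambda>_. 1"] by (simp add: algebra_simps)
  moreover have "sine_product N (- 1 / 2 - of_nat n) = sine_product N (of_nat (2 * n + 1) / 2)"
  proof -
    have "- 1 / 2 - of_nat n = - (of_nat (2 * n + 1) / (2::rat))" by (simp add: field_simps)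
    then show ?thesis by (simp only: sine_product_minus)
  qed
  ultimately have e: "(\<Sum>k\<le>N. legendre_term k (- 1 / 2 - of_nat n))
      = 2 * sine_product N (of_nat (2 * n + 1) / 2) - (\<Sum>k\<le>N. legendre_term k (- 1 / 2 - of_nat (Suc n)))"
    by simp
  show ?case unfolding Suc.IH e by (simp add: algebra_simps del: of_nat_Suc of_nat_add)
qed simp

context prime_gt_3
begin

lemma fermat_rat: "\<not> p dvd a \<Longrightarrow> pcong 1 (of_nat a ^ (p - 1)) 1"
  using fermat_theorem[OF prime_p, of a] pcong_of_int[of 1 "int a ^ (p - 1)" 1]
  by (simp add: cong_int_iff[of _ 1, simplified] flip: of_nat_power)

text \<open>Fermat's theorem turns inverse squares into (p - 3)-rd powers. In the telescoped sum the
  value at 2 * \<open>half\<close>, congruent to -1, vanishes for even positive degree, and the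
  value at 0 is the Euler number.\<close>

lemma sum_alternating_inverse_odd_square:
  "pcong 1 (\<Sum>j<half. (-1) ^ j / of_nat (2 * j + 1) ^ 2) (of_int (euler_number (p - 3)) / 2)"
proof -
  define n where "n = p - 3"
  have "n = 2 * (half - 1)" using p_eq half_gt_1 unfolding n_def by arith
  then have n: "even n" "n > 0" "p - 1 = n + 2" using p_gt_3 half_gt_1 by (auto simp: n_def)
  have "[euler_polynomial n (int (2 * half)) = euler_polynomial n (-1)] (mod int p)"
    unfolding euler_polynomial_def
    by (intro cong_sum cong_mult cong_refl cong_pow) (simp add: cong_iff_dvd_diff, subst p_eq, simp add: add.commute)
  then have "[(-1) ^ half * euler_polynomial n (int (2 * half)) = (-1) ^ half * 0] (mod int p)"
    unfolding euler_polynomial_minus_1[OF n(1,2)] by (intro cong_mult cong_refl)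
  then have "[2 * (\<Sum>j<half. (-1) ^ j * int (2 * j + 1) ^ n) = euler_number n - (-1) ^ half * 0] (mod int p)"
    unfolding sum_alternating_odd_power euler_polynomial_0 by (intro cong_diff cong_refl)
  then have "pcong 1 (of_int (2 * (\<Sum>j<half. (-1) ^ j * int (2 * j + 1) ^ n))) (of_int (euler_number n))"
    unfolding pcong_of_int by simp
  then have "pcong 1 (1 / 2 * of_int (2 * (\<Sum>j<half. (-1) ^ j * int (2 * j + 1) ^ n))) (1 / 2 * of_int (euler_number n))"
    by (intro pcong_scale p_integral_intros)
  then have 1: "pcong 1 (\<Sum>j<half. (-1) ^ j * of_nat (2 * j + 1) ^ n) (of_int (euler_number n) / 2)"
    by simp
  have "pcong 1 (\<Sum>j<half. (-1) ^ j / of_nat (2 * j + 1) ^ 2) (\<Sum>j<half. (-1) ^ j * of_nat (2 * j + 1) ^ n)"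
  proof (rule pcong_sum)
    fix j assume "j \<in> {..<half}"
    then have nd: "\<not> p dvd 2 * j + 1" using half_less[of half j] by (intro not_dvd_less) auto
    define b where "b = (of_nat (2 * j + 1) :: rat)"
    have b: "b \<noteq> 0" by (simp add: b_def del: of_nat_add of_nat_Suc)
    have "pcong 1 ((-1) ^ j / b ^ 2 * (b ^ (p - 1))) ((-1) ^ j / b ^ 2 * 1)"
      unfolding b_def by (intro pcong_scale fermat_rat nd p_integral_divide_of_nat_power p_integral_intros)
    moreover have "(-1) ^ j / b ^ 2 * (b ^ (p - 1)) = (-1) ^ j * b ^ n"
      using b unfolding n(3) power_add by simp
    ultimately show "pcong 1 ((-1) ^ j / of_nat (2 * j + 1) ^ 2) ((-1) ^ j * of_nat (2 * j + 1) ^ n)"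
      unfolding b_def by (simp add: pcong_sym)
  qed
  from pcong_trans[OF this 1] show ?thesis by (simp add: n_def)
qed

text \<open>The odd number 2j + 1 is p - 2i with i = \<open>half\<close> - j, so up to a sign the
  sum over odd numbers is a quarter of this one.\<close>

lemma sum_alternating_inverse_square:
  "pcong 1 (\<Sum>j=1..half. (-1) ^ j / of_nat j ^ 2) (2 * (-1) ^ half * of_int (euler_number (p - 3)))"
proof -
  let ?T = "\<Sum>j=1..half. (-1) ^ j / (of_nat j :: rat) ^ 2"
  have s: "(-1) ^ half * (-1) ^ half = (1::rat)" by (simp flip: power_mult_distrib)
  have "(\<Sum>j<half. (-1) ^ j / of_nat (2 * j + 1) ^ 2)
      = (\<Sum>i=1..half. (-1) ^ half * (-1) ^ i * (1 / (of_nat (p - 2 * i) :: rat) ^ 2))"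
  proof (rule sum.reindex_bij_witness[of _ "\<lambda>i. half - i" "\<lambda>i. half - i"])
    fix j assume "j \<in> {..<half}"
    then have j: "j < half" by simp
    then have "p - 2 * (half - j) = 2 * j + 1" using p_eq by simp
    moreover have "(-1) ^ half * (-1) ^ (half - j) = ((-1) ^ j :: rat)"
      using j by (simp add: minus_one_power_iff)
    ultimately show "(-1) ^ half * (-1) ^ (half - j) * (1 / of_nat (p - 2 * (half - j)) ^ 2)
        = (-1) ^ j / (of_nat (2 * j + 1) :: rat) ^ 2" by simp
  qed auto
  also have "pcong 1 \<dots> (\<Sum>i=1..half. (-1) ^ half * (-1) ^ i * (1 / (of_nat (2 * i) :: rat) ^ 2))"
    using p_eq by (intro pcong_sum pcong_scale pcong_inverse_reflect p_integral_intros) auto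
  also have "\<dots> = (-1) ^ half / 4 * ?T"
    by (simp add: sum_distrib_left power_mult_distrib mult.commute)
  finally have "pcong 1 ((-1) ^ half / 4 * ?T) (of_int (euler_number (p - 3)) / 2)"
    using pcong_trans[OF pcong_sym sum_alternating_inverse_odd_square] by blast
  then have "pcong 1 (4 * (-1) ^ half * ((-1) ^ half / 4 * ?T)) (4 * (-1) ^ half * (of_int (euler_number (p - 3)) / 2))"
    by (intro pcong_scale p_integral_intros)
  moreover have "4 * (-1) ^ half * ((-1) ^ half / 4 * ?T) = ((-1) ^ half * (-1) ^ half) * ?T"
    by (simp add: mult.assoc)
  ultimately show ?thesis unfolding s by (simp add: mult_ac)
qed

section \<open>\<open>G_seq (p - 1)\<close> modulo \<open>p ^ 3\<close>\<close>

text \<open>In the Vandermonde sum for 2p choose p all but the two outer squares are divisible by p,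
  and 4^p is 4 modulo p. The value starts the induction on j in
  \<open>sine_product_odd_half\<close>.\<close>

lemma cbinom_p: "pcong 1 (cbinom p) (1 / 2)"
proof -
  have "(\<Sum>k\<le>p. (p choose k) ^ 2) = (2 * p) choose p" by (rule choose_square_sum)
  moreover have "(\<Sum>k\<le>p. (p choose k) ^ 2) = 2 + (\<Sum>k\<in>{1..p - 1}. (p choose k) ^ 2)"
  proof -
    have "{..p} = {0, p} \<union> {1..p - 1}" using p_gt_3 by auto
    then have "(\<Sum>k\<le>p. (p choose k) ^ 2) = (\<Sum>k\<in>{0, p}. (p choose k) ^ 2) + (\<Sum>k\<in>{1..p - 1}. (p choose k) ^ 2)"
      using p_gt_3 by (simp only:) (rule sum.union_disjoint, auto)
    then show ?thesis using p_gt_3 by simp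
  qed
  moreover have "p dvd (\<Sum>k\<in>{1..p - 1}. (p choose k) ^ 2)"
  proof (rule dvd_sum)
    fix k assume "k \<in> {1..p - 1}"
    then have "p dvd (p choose k)" using p_gt_3 by (intro dvd_choose_prime prime_p) auto
    then show "p dvd (p choose k) ^ 2" by (simp add: power2_eq_square)
  qed
  ultimately obtain c where c: "(2 * p) choose p = 2 + p * c" by (metis dvdE)
  have "2 ^ p = 2 * (1 + P * fq)" using p_gt_3 power_Suc[of "2::rat" "p - 1"] unfolding power_2_fq[symmetric] by simp
  moreover have "(4::rat) ^ p = 2 ^ p * 2 ^ p" by (simp flip: power_mult_distrib)
  ultimately have 4: "4 ^ p = 4 * (1 + P * fq) ^ 2" by (simp add: power2_eq_square algebra_simps)
  have "cbinom p - 1 / 2 = P ^ 1 * ((of_nat c - 4 * fq - 2 * P * fq ^ 2) / 4 ^ p)"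
  proof -
    have "cbinom p - 1 / 2 = ((2 + P * of_nat c) - 4 ^ p / 2) / 4 ^ p"
      unfolding cbinom_def c by (simp add: diff_divide_distrib)
    also have "(2 + P * of_nat c) - 4 ^ p / 2 = P * (of_nat c - 4 * fq - 2 * P * fq ^ 2)"
      unfolding 4 by (simp add: algebra_simps power2_eq_square)
    finally show ?thesis by simp
  qed
  then show ?thesis by (rule pcongI) (intro p_integral_intros p_integral_fq)
qed

lemma not_dvd_double_diff: "0 < n \<Longrightarrow> n < p \<Longrightarrow> \<not> p dvd 2 * p - n"
proof
  assume n: "0 < n" "n < p" and "p dvd 2 * p - n"
  then have "p dvd 2 * p - (2 * p - n)" by (metis dvd_diff_nat dvd_triv_right)
  moreover have "2 * p - (2 * p - n) = n" using n by simp
  ultimately show False using n not_dvd_less by simp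
qed

text \<open>With b = 2j + 1, the factors (2i - b) (2i + b) / (2i)^2 contain p exactly where 2i = p +
  b or 2i = p - b, hence the order p^2. The unit part is known at b = 1 through
  \<open>cbinom p\<close> and is carried from b to b + 2 by
  \<open>sine_product_shift\<close>.\<close>

lemma sine_product_odd_half:
  "j < half \<Longrightarrow> pcong 3 (sine_product (p - 1) (of_nat (2 * j + 1) / 2)) (- (P ^ 2 / of_nat (2 * j + 1) ^ 2))"
proof (induction j)
  case 0
  obtain c where c: "p_integral p c" "cbinom p = 1 / 2 + P * c"
    using cbinom_p by (auto elim: pcongE)
  define R where "R = sine_product (p - 1) (1 / 2)"
  have Sp: "Suc (p - 1) = p" using p_gt_3 by simp
  define d where "d = (of_nat (2 * p - 1) :: rat)"
  have d: "d \<noteq> 0" "P = (d + 1) / 2" using p_gt_3 by (simp_all add: d_def of_nat_diff)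
  have dint: "p_integral p (1 / d)"
    unfolding d_def using p_gt_3 by (intro p_integral_inverse_of_nat not_dvd_double_diff) auto
  \<comment> \<open>For x = 1/2 the point x - 1 is -1/2, where \<open>legendre_term p\<close> is
    \<open>cbinom p ^ 2\<close>.\<close>
  have "cbinom p ^ 2 = 1 / 2 * (P - 1 / 2) / P ^ 2 * R"
    using legendre_term_Suc_sine'[of "p - 1" "1 / 2"] legendre_term_minus_half[of p]
    unfolding Sp R_def by simp
  then have "P ^ 2 * cbinom p ^ 2 = 1 / 2 * (P - 1 / 2) * R"
    by (simp add: field_simps)
  also have "\<dots> = d / 4 * R" by (simp add: d(2) field_simps)
  finally have R: "R = 4 * P ^ 2 * cbinom p ^ 2 / d" using d(1) by (simp add: field_simps)
  have "R - (- (P ^ 2)) = P ^ 2 * (4 * cbinom p ^ 2 + d) / d"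
    unfolding R using d(1) by (simp add: field_simps)
  \<comment> \<open>Modulo p this is 4 / 4 + (2p - 1) = 0: the additional factor that raises the
    precision from p^2 to p^3.\<close>
  also have "4 * cbinom p ^ 2 + d = P * (2 + 4 * c + 4 * P * c ^ 2)"
    unfolding c(2) using d(2) by (simp add: algebra_simps power2_eq_square)
  finally have "R - (- (P ^ 2)) = P ^ 3 * ((2 + 4 * c + 4 * P * c ^ 2) * (1 / d))"
    by (simp add: power2_eq_square power3_eq_cube)
  then have "pcong 3 R (- (P ^ 2))"
    by (rule pcongI) (intro p_integral_intros c dint)
  then show ?case by (simp add: R_def)
next
  case (Suc j)
  define b where "b = (of_nat (2 * j + 1) :: rat)"
  define R where "R = sine_product (p - 1) ((b + 2) / 2)"
  define R' where "R' = sine_product (p - 1) (b / 2)"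
  define d where "d = (of_nat (2 * p - (2 * j + 3)) :: rat)"
  have j: "2 * j + 3 < p" using half_less[of half "Suc j"] Suc.prems by simp
  have nd: "\<not> p dvd 2 * j + 1" "\<not> p dvd 2 * j + 3"  "\<not> p dvd 2 * p - (2 * j + 3)"
    using not_dvd_less[of "2 * j + 1"] not_dvd_less[of "2 * j + 3"] not_dvd_double_diff[of "2 * j + 3"] j
    by simp_all
  have b2: "of_nat (2 * j + 3) = b + 2" by (simp add: b_def)
  have nz: "b \<noteq> 0" "b + 2 \<noteq> 0" "d \<noteq> 0"
    using j by (simp_all add: b_def d_def of_nat_diff flip: b2 del: of_nat_add)
  have P: "2 * P = d + b + 2" using j by (simp add: d_def b_def of_nat_diff)
  have int: "p_integral p (1 / b)" "p_integral p (1 / (b + 2))" "p_integral p (1 / d)" "p_integral p b"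
    unfolding b2[symmetric] unfolding b_def d_def
    by (rule p_integral_inverse_of_nat p_integral_of_nat nd)+
  have Sp: "of_nat (Suc (p - 1)) = P" using p_gt_3 by simp
  have bm: "(b + 2) / 2 - 1 = b / 2" by (simp add: field_simps)
  have "(b + 2) / 2 * (P - (b + 2) / 2) * R = - (b / 2 * (P + b / 2) * R')"
    using sine_product_shift[of "(b + 2) / 2" "p - 1"] unfolding Sp bm R_def R'_def .
  then have "(b + 2) * (2 * P - (b + 2)) * R = - (b * (2 * P + b) * R')"
    by (simp add: field_simps)
  then have "(b + 2) * d * R = - (b * (2 * P + b) * R')"
    unfolding P by simp
  then have R: "R = - (b * (2 * P + b) * R') / ((b + 2) * d)"
    using nz by (metis mult_eq_0_iff nonzero_mult_div_cancel_left)
  have "pcong 3 R' (- (P ^ 2 / b ^ 2))"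
    using Suc.IH Suc.prems by (simp add: R'_def b_def)
  then obtain c where c: "p_integral p c" "R' = - (P ^ 2 / b ^ 2) + P ^ 3 * c" by (auto elim: pcongE)
  have factor: "P ^ 2 * (P * (4 * b + 4) * u * v ^ 2 * w) - P ^ 3 * c * b * (2 * P + b) * v * w
      = P ^ 3 * ((4 * b + 4) * u * v ^ 2 * w - c * b * (2 * P + b) * v * w)" for u v w
    by (simp add: algebra_simps power2_eq_square power3_eq_cube)
  have "R - (- (P ^ 2 / (b + 2) ^ 2))
      = P ^ 2 * (((2 * P + b) * (b + 2) + b * d) * (1 / b) * (1 / (b + 2)) ^ 2 * (1 / d))
        - P ^ 3 * c * b * (2 * P + b) * (1 / (b + 2)) * (1 / d)"
  proof -
    define \<beta> \<gamma> \<delta> where inv: "\<beta> = 1 / b" "\<gamma> = 1 / (b + 2)" "\<delta> = 1 / d"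
    have 1: "b * \<beta> = 1" "(b + 2) * \<gamma> = 1" "d * \<delta> = 1" using nz by (simp_all add: inv)
    have "R = - (b * (2 * P + b) * (- (P ^ 2 * \<beta> ^ 2) + P ^ 3 * c)) * \<gamma> * \<delta>"
      unfolding R c(2) inv by (simp add: power_divide)
    moreover have "P ^ 2 / (b + 2) ^ 2 = P ^ 2 * \<gamma> ^ 2" by (simp add: inv power_divide)
    ultimately have "R - (- (P ^ 2 / (b + 2) ^ 2))
        = P ^ 2 * ((b * \<beta>) * (2 * P + b) * \<beta> * \<gamma> * \<delta> + \<gamma> ^ 2) - P ^ 3 * c * b * (2 * P + b) * \<gamma> * \<delta>"
      by (simp add: algebra_simps power2_eq_square)
    also have "(b * \<beta>) * (2 * P + b) * \<beta> * \<gamma> * \<delta> + \<gamma> ^ 2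
        = (2 * P + b) * ((b + 2) * \<gamma>) * \<beta> * \<gamma> * \<delta> + (b * \<beta>) * (d * \<delta>) * \<gamma> ^ 2"
      unfolding 1 by simp
    also have "\<dots> = ((2 * P + b) * (b + 2) + b * d) * \<beta> * \<gamma> ^ 2 * \<delta>"
      by (simp add: algebra_simps power2_eq_square)
    finally show ?thesis unfolding inv[symmetric] .
  qed
  \<comment> \<open>Modulo p, d is -(b + 2), so the two products cancel; this is what reproduces the
    shape -p^2 / b^2 at b + 2.\<close>
  also have "(2 * P + b) * (b + 2) + b * d = P * (4 * b + 4)"
  proof -
    have d: "d = 2 * P - b - 2" using P by simp
    show ?thesis unfolding d by (simp add: algebra_simps)
  qed
  finally have "R - (- (P ^ 2 / (b + 2) ^ 2))
      = P ^ 3 * ((4 * b + 4) * (1 / b) * (1 / (b + 2)) ^ 2 * (1 / d) - c * b * (2 * P + b) * (1 / (b + 2)) * (1 / d))"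
    unfolding factor .
  then have "pcong 3 R (- (P ^ 2 / (b + 2) ^ 2))"
    by (rule pcongI) (intro p_integral_intros c int)
  moreover have "2 * Suc j + 1 = 2 * j + 3" by simp
  ultimately show ?case unfolding R_def b2[symmetric] by (simp only:)
qed

text \<open>For k > 0 the factor x supplies a p, and the sine product is 1 modulo p^2. So the sum is
  1 plus multiples of p H and p^2 H2, where the full sums H of 1/i and H2 of 1/i^2 over i < p are
  divisible by p^2 and p.\<close>

lemma sum_legendre_term_minus_half_p: "pcong 3 (\<Sum>k\<le>p - 1. legendre_term k (- P / 2)) 1"
proof -
  let ?R = "\<lambda>k. sine_product k (- P / 2)"
  let ?h = "\<lambda>k. \<Sum>i<k. - 1 / 4 / (of_nat (Suc i) :: rat) ^ 2"
  let ?g = "\<lambda>k. P / 2 * (1 / of_nat (Suc k)) - P ^ 2 / 4 * (1 / of_nat (Suc k) ^ 2)"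
  have step: "pcong 3 (legendre_term (Suc k) (- P / 2)) (?g k)"
    if "k < p - 1" for k
  proof -
    define a where "a = (1 / of_nat (Suc k) :: rat)"
    let ?a = "a / 2 - P * a ^ 2 / 4"
    have nd: "\<not> p dvd Suc i" if "i \<le> k" for i using that \<open>k < p - 1\<close> by (intro not_dvd_less) auto
    have a: "p_integral p a" unfolding a_def using nd[of k] by (intro p_integral_inverse_of_nat) auto
    have "?R k = (\<Prod>i<k. 1 + P ^ 2 * (- 1 / 4 / of_nat (Suc i) ^ 2))"
      by (simp add: sine_product_def power_divide)
    also have "pcong (2 * 2) \<dots> (1 + P ^ 2 * ?h k)"
      using nd by (intro pcong_prod_one_add p_integral_divide_of_nat_power p_integral_intros) auto
    finally have "pcong 4 (?R k) (1 + P ^ 2 * ?h k)" by simp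
    then have "pcong 2 (?R k) (1 + P ^ 2 * ?h k)"
      by (rule pcong_weaken) simp
    also have "pcong 2 \<dots> (1 + 0)"
      using nd by (intro pcong_add pcong_refl pcong_P_0 p_integral_sum p_integral_divide_of_nat_power p_integral_intros) auto
    finally have "pcong 2 (?a * ?R k) (?a * (1 + 0))"
      by (intro pcong_scale p_integral_intros a)
    then have "pcong (Suc 2) (P * (?a * ?R k)) (P * (?a * (1 + 0)))"
      by (rule pcong_mult_P1)
    moreover have "P * (?a * ?R k) = legendre_term (Suc k) (- P / 2)"
      unfolding legendre_term_Suc_sine a_def
      by (simp add: field_simps power2_eq_square del: of_nat_Suc)
    moreover have "P * (?a * (1 + 0)) = ?g k"
      unfolding a_def by (simp add: algebra_simps power2_eq_square)
    ultimately show ?thesis by simp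
  qed
  have "(\<Sum>k\<le>p - 1. legendre_term k (- P / 2)) = 1 + (\<Sum>k<p - 1. legendre_term (Suc k) (- P / 2))"
    by (subst sum.atMost_shift) simp
  also have "pcong 3 \<dots> (1 + (\<Sum>k<p - 1. ?g k))"
    by (intro pcong_add pcong_refl pcong_sum step) auto
  also have "\<dots> = 1 + (P / 2 * harmonic (p - 1) - P ^ 2 / 4 * harmonic2 (p - 1))"
    unfolding harmonic_def harmonic2_def sum_subtractf sum_distrib_left[symmetric]
    by (simp only: sum.atLeast1_atMost_eq One_nat_def)
  also have "pcong 3 \<dots> (1 + (0 - 0))"
  proof (intro pcong_add pcong_refl pcong_diff)
    obtain c where c: "p_integral p c" "harmonic (p - 1) = P ^ 2 * c"
      using harmonic_p_minus_1 unfolding pcong_def by auto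
    show "pcong 3 (P / 2 * harmonic (p - 1)) 0"
      by (rule pcongI[of _ _ _ "c / 2"]) (auto simp: c(2)[simplified] power2_eq_square power3_eq_cube intro!: p_integral_intros c)
    obtain c where c: "p_integral p c" "harmonic2 (p - 1) = P * c"
      using harmonic2_p_minus_1 unfolding pcong_def by auto
    show "pcong 3 (P ^ 2 / 4 * harmonic2 (p - 1)) 0"
      by (rule pcongI[of _ _ _ "c / 4"]) (auto simp: c(2)[simplified] power2_eq_square power3_eq_cube intro!: p_integral_intros c)
  qed
  finally show ?thesis by simp
qed

lemma sum_cbinom_square:
  "pcong 3 (\<Sum>k\<le>p - 1. cbinom k ^ 2) ((-1) ^ half - P ^ 2 * of_int (euler_number (p - 3)))"
proof -
  let ?A = "\<Sum>j<half. (-1) ^ j / (of_nat (2 * j + 1) :: rat) ^ 2"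
  have "(\<Sum>k\<le>p - 1. cbinom k ^ 2) = (\<Sum>k\<le>p - 1. legendre_term k (- 1 / 2))"
    by (simp only: legendre_term_minus_half)
  also have "\<dots> = (-1) ^ half * (\<Sum>k\<le>p - 1. legendre_term k (- P / 2))
       + 2 * (\<Sum>j<half. (-1) ^ j * sine_product (p - 1) (of_nat (2 * j + 1) / 2))"
  proof -
    have "- 1 / 2 - of_nat half = - P / 2" by (simp add: P_eq field_simps)
    then show ?thesis using sum_legendre_term_descent[of "p - 1" half] by simp
  qed
  also have "pcong 3 \<dots> ((-1) ^ half * 1 + 2 * (\<Sum>j<half. (-1) ^ j * - (P ^ 2 / of_nat (2 * j + 1) ^ 2)))"
    by (intro pcong_add pcong_scale pcong_sum sum_legendre_term_minus_half_p sine_product_odd_half p_integral_intros) auto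
  also have "\<dots> = (-1) ^ half - P ^ 2 * (2 * ?A)"
    by (simp add: sum_distrib_left sum_negf mult_ac)
  also have "pcong 3 \<dots> ((-1) ^ half - P ^ 2 * (2 * (of_int (euler_number (p - 3)) / 2)))"
  proof (intro pcong_diff pcong_refl)
    have "pcong (2 + 1) (P ^ 2 * (2 * ?A)) (P ^ 2 * (2 * (of_int (euler_number (p - 3)) / 2)))"
      unfolding pcong_mult_P by (intro pcong_scale sum_alternating_inverse_odd_square p_integral_intros)
    then show "pcong 3 (P ^ 2 * (2 * ?A)) (P ^ 2 * (2 * (of_int (euler_number (p - 3)) / 2)))" by simp
  qed
  finally show ?thesis by simp
qed

text \<open>For \<open>k > half\<close> the factor \<open>cbinom k ^ 2\<close> is divisible by \<open>p ^ 2\<close>, so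
  the first-order correction matters only for \<open>k \<le> half\<close>.\<close>

lemma G_seq_p_minus_1_expand:
  "pcong 3 (\<Sum>k\<le>p - 1. (-1) ^ k * of_nat ((p - 1) choose k) * cbinom k ^ 2)
     ((\<Sum>k\<le>p - 1. cbinom k ^ 2)
      - P * (\<Sum>k\<le>half. cbinom k ^ 2 * harmonic k)
      + P ^ 2 * (1 / 2 * (\<Sum>k\<le>half. cbinom k ^ 2 * harmonic k ^ 2)
        - 1 / 2 * (\<Sum>k\<le>half. cbinom k ^ 2 * harmonic2 k)))"
proof -
  let ?g = "\<lambda>k. - P * harmonic k + P ^ 2 / 2 * (harmonic k ^ 2 - harmonic2 k)"
  have "pcong 3 (\<Sum>k\<le>p - 1. (-1) ^ k * of_nat ((p - 1) choose k) * cbinom k ^ 2)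
      (\<Sum>k\<le>p - 1. cbinom k ^ 2 + (if k \<le> half then cbinom k ^ 2 * ?g k else 0))"
  proof (rule pcong_sum)
    fix k assume "k \<in> {..p - 1}"
    then have k: "k \<le> p - 1" "k < p" using p_gt_3 by auto
    note int = p_integral_harmonic[OF k(2)] p_integral_harmonic2[OF k(2)]
    have "pcong 3 (cbinom k ^ 2 * ((-1) ^ k * of_nat ((p - 1) choose k)))
        (cbinom k ^ 2 * (1 - P * harmonic k + P ^ 2 / 2 * (harmonic k ^ 2 - harmonic2 k)))"
      by (intro pcong_scale p_integral_power p_integral_cbinom pcong_choose_p_minus_1 k)
    then have 1: "pcong 3 ((-1) ^ k * of_nat ((p - 1) choose k) * cbinom k ^ 2)
        (cbinom k ^ 2 + cbinom k ^ 2 * ?g k)"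
      by (simp add: algebra_simps)
    have "pcong 3 (cbinom k ^ 2 * ?g k) 0" if large: "half < k"
    proof -
      obtain c where c: "p_integral p c" "cbinom k = P * c"
        using cbinom_large[OF large k(2)] unfolding pcong_def by auto
      show ?thesis
        by (rule pcongI[of _ _ _ "c ^ 2 * (- harmonic k + P / 2 * (harmonic k ^ 2 - harmonic2 k))"])
           (auto simp: c(2) field_simps power2_eq_square power3_eq_cube intro!: p_integral_intros c int)
    qed
    with 1 show "pcong 3 ((-1) ^ k * of_nat ((p - 1) choose k) * cbinom k ^ 2)
        (cbinom k ^ 2 + (if k \<le> half then cbinom k ^ 2 * ?g k else 0))"
      using pcong_trans[OF 1 pcong_add[OF pcong_refl[of 3 "cbinom k ^ 2"]]] by auto
  qed
  also have "(\<Sum>k\<le>p - 1. cbinom k ^ 2 + (if k \<le> half then cbinom k ^ 2 * ?g k else 0))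
      = (\<Sum>k\<le>p - 1. cbinom k ^ 2) + (\<Sum>k\<le>half. cbinom k ^ 2 * ?g k)"
  proof -
    have "(\<Sum>k\<le>p - 1. if k \<le> half then cbinom k ^ 2 * ?g k else 0) = (\<Sum>k\<le>half. cbinom k ^ 2 * ?g k)"
      by (rule sum.mono_neutral_cong_right) (use p_eq in auto)
    then show ?thesis by (simp add: sum.distrib)
  qed
  also have "\<dots> = (\<Sum>k\<le>p - 1. cbinom k ^ 2)
      - P * (\<Sum>k\<le>half. cbinom k ^ 2 * harmonic k)
      + P ^ 2 * (1 / 2 * (\<Sum>k\<le>half. cbinom k ^ 2 * harmonic k ^ 2)
        - 1 / 2 * (\<Sum>k\<le>half. cbinom k ^ 2 * harmonic2 k))"
    by (simp add: algebra_simps sum.distrib sum_subtractf sum_distrib_left sum_negf sum_divide_distrib diff_divide_distrib)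
  finally show ?thesis .
qed

text \<open>The Euler number appears twice: -E from the sum of squares, +2E from the weight
  \<open>harmonic2\<close>. The weight \<open>harmonic\<close> contributes only the Fermat quotient,
  and the weight \<open>harmonic k ^ 2\<close> stays unevaluated.\<close>

lemma G_seq_p_minus_1:
  "pcong 3 (of_nat (G_seq (p - 1)))
     ((-1) ^ half * 256 ^ (p - 1)
      + P ^ 2 * (of_int (euler_number (p - 3)) - 8 * (-1) ^ half * fq ^ 2
          + 1 / 2 * (\<Sum>k\<le>half. cbinom k ^ 2 * harmonic k ^ 2)))"
proof -
  let ?E = "of_int (euler_number (p - 3)) :: rat"
  let ?s = "(-1) ^ half :: rat"
  let ?S1 = "\<Sum>k\<le>half. cbinom k ^ 2 * harmonic k"
  let ?S2 = "\<Sum>k\<le>half. cbinom k ^ 2 * harmonic2 k"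
  let ?V1 = "2 * ?s * (- 2 * fq + P * fq ^ 2)"
  define A where "A = (\<Sum>k\<le>half. cbinom k ^ 2 * harmonic k ^ 2)"
  have A: "p_integral p A"
    unfolding A_def
    by (intro p_integral_sum p_integral_mult p_integral_power p_integral_cbinom p_integral_harmonic half_less_p) auto
  have ss: "?s * ?s = 1" by (simp flip: power_mult_distrib)
  have S1: "pcong 2 ?S1 ?V1"
  proof -
    have "pcong 2 ?S1 (\<Sum>k\<le>half. legendre_term k (of_nat half) * harmonic k)"
    proof (rule pcong_sum)
      fix k assume "k \<in> {..half}"
      then have k: "k \<le> half" by simp
      show "pcong 2 (cbinom k ^ 2 * harmonic k) (legendre_term k (of_nat half) * harmonic k)"
        using pcong_scale[OF p_integral_harmonic[OF half_less_p[OF k]] pcong_sym[OF pcong_legendre_term_half_2[OF k]]]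
        by (simp add: mult.commute)
    qed
    also have "\<dots> = 2 * ?s * harmonic half" by (rule sum_legendre_term_harmonic)
    also have "pcong 2 \<dots> ?V1"
      by (intro pcong_scale harmonic_half p_integral_intros)
    finally show ?thesis .
  qed
  have S2: "pcong 1 ?S2 (- 4 * ?E)"
  proof -
    have "pcong 1 ?S2 (\<Sum>k\<le>half. legendre_term k (of_nat half) * harmonic2 k)"
    proof (rule pcong_sum)
      fix k assume "k \<in> {..half}"
      then have k: "k \<le> half" by simp
      show "pcong 1 (cbinom k ^ 2 * harmonic2 k) (legendre_term k (of_nat half) * harmonic2 k)"
        using pcong_scale[OF p_integral_harmonic2[OF half_less_p[OF k]]
            pcong_sym[OF pcong_weaken[OF pcong_legendre_term_half_2[OF k], of 1]]]
        by (simp add: mult.commute)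
    qed
    also have "\<dots> = - 2 * ?s * (\<Sum>j=1..half. (-1) ^ j / of_nat j ^ 2)" by (rule sum_legendre_term_harmonic2)
    also have "pcong 1 \<dots> (- 2 * ?s * (2 * ?s * ?E))"
      by (intro pcong_scale sum_alternating_inverse_square p_integral_intros)
    also have "\<dots> = - 4 * (?s * ?s) * ?E" by simp
    finally show ?thesis unfolding ss by simp
  qed
  have "of_nat (G_seq (p - 1)) = 16 ^ (p - 1) * (\<Sum>k\<le>p - 1. (-1) ^ k * of_nat ((p - 1) choose k) * cbinom k ^ 2)"
    unfolding G_seq_cbinom sum_cbinom_convolution ..
  also have "pcong 3 \<dots> (16 ^ (p - 1) * ((\<Sum>k\<le>p - 1. cbinom k ^ 2)
      - P * ?S1
      + P ^ 2 * (1 / 2 * A - 1 / 2 * ?S2)))"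
    unfolding A_def by (intro pcong_scale G_seq_p_minus_1_expand p_integral_intros)
  also have "pcong 3 \<dots> (16 ^ (p - 1) * ((?s - P ^ 2 * ?E) - P * ?V1
      + P ^ 2 * (1 / 2 * A - 1 / 2 * (- 4 * ?E))))"
  proof -
    have 1: "pcong 3 (P * ?S1) (P * ?V1)"
      using pcong_mult_P1[OF S1] by simp
    have "pcong (2 + 1) (P ^ 2 * (1 / 2 * A - 1 / 2 * ?S2)) (P ^ 2 * (1 / 2 * A - 1 / 2 * (- 4 * ?E)))"
      unfolding pcong_mult_P by (intro pcong_diff pcong_refl pcong_scale S2 p_integral_intros)
    then have 2: "pcong 3 (P ^ 2 * (1 / 2 * A - 1 / 2 * ?S2)) (P ^ 2 * (1 / 2 * A - 1 / 2 * (- 4 * ?E)))"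
      by simp
    show ?thesis
      by (intro pcong_scale pcong_add[OF pcong_diff[OF sum_cbinom_square 1] 2] p_integral_intros)
  qed
  also have "pcong 3 \<dots> (?s * 256 ^ (p - 1) + P ^ 2 * (?E - 8 * ?s * fq ^ 2 + 1 / 2 * A))"
  proof -
    define f where "f = fq"
    have f: "p_integral p f" by (simp add: f_def p_integral_fq)
    have 16: "16 ^ (p - 1) = (1 + P * f) ^ 4"
      unfolding f_def power_2_fq[symmetric] by (simp flip: power_mult) (simp add: mult.commute[of "p - Suc 0"] power_mult)
    have 256: "256 ^ (p - 1) = (1 + P * f) ^ 8"
      unfolding f_def power_2_fq[symmetric] by (simp flip: power_mult) (simp add: mult.commute[of "p - Suc 0"] power_mult)
    define B where "B = ?E + 1 / 2 * A"
    have B: "p_integral p B" unfolding B_def by (intro p_integral_intros A)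
    define y where "y = P * f"
    have poly': "(1 + y) ^ 4 - 1 = y * (4 + 6 * y + 4 * y ^ 2 + y ^ 3)"
      by (simp add: eval_nat_numeral algebra_simps)
    \<comment> \<open>With y = p q the powers of 16 and 256 are (1 + y)^4 and (1 + y)^8. Up to y^2
      the first product is s (1 + 8 y + 20 y^2), while s (1 + y)^8 is s (1 + 8 y + 28 y^2): hence
      the base 256 and the coefficient -8.\<close>
    have poly: "(1 + y) ^ 4 * (s + 4 * s * y - 2 * s * y ^ 2) - s * (1 + y) ^ 8 + 8 * s * y ^ 2
        = s * y ^ 3 * (- 36 - 65 * y - 60 * y ^ 2 - 30 * y ^ 3 - 8 * y ^ 4 - y ^ 5)" for s
      by (simp add: eval_nat_numeral algebra_simps)
    have "(1 + y) ^ 4 * ((?s - P ^ 2 * ?E) - P * (2 * ?s * (- 2 * f + P * f ^ 2)) + P ^ 2 * (1 / 2 * A - 1 / 2 * (- 4 * ?E)))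
        - (?s * (1 + y) ^ 8 + P ^ 2 * (?E - 8 * ?s * f ^ 2 + 1 / 2 * A))
      = ((1 + y) ^ 4 * (?s + 4 * ?s * y - 2 * ?s * y ^ 2) - ?s * (1 + y) ^ 8 + 8 * ?s * y ^ 2)
        + P ^ 2 * B * ((1 + y) ^ 4 - 1)"
      by (simp add: B_def y_def algebra_simps power2_eq_square)
    also have "\<dots> = P ^ 3 * (?s * f ^ 3 * (- 36 - 65 * y - 60 * y ^ 2 - 30 * y ^ 3 - 8 * y ^ 4 - y ^ 5)
        + B * f * (4 + 6 * y + 4 * y ^ 2 + y ^ 3))"
      unfolding poly poly' by (simp add: y_def algebra_simps power2_eq_square power3_eq_cube)
    finally show ?thesis
      unfolding 16 256 f_def[symmetric] y_def[symmetric]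
      by (rule pcongI) (auto intro!: p_integral_intros f B simp: y_def)
  qed
  finally show ?thesis unfolding A_def .
qed

section \<open>Jacobsthal sums\<close>

abbreviation residues_p :: "int set" where "residues_p \<equiv> {0..<int p}"

definition \<phi> :: "int \<Rightarrow> int" where "\<phi> a = Legendre a (int p)"

lemma prime_int_p: "prime (int p)"
  using prime_p by simp

lemma sum_residues_affine:
  fixes f :: "int \<Rightarrow> 'b::comm_monoid_add"
  assumes per: "\<And>a b. [a = b] (mod int p) \<Longrightarrow> f a = f b" and c: "\<not> int p dvd c"
  shows "(\<Sum>a\<in>residues_p. f (c * a + d)) = (\<Sum>a\<in>residues_p. f a)"
proof -
  let ?g = "\<lambda>a. (c * a + d) mod int p"
  have p: "int p > 0" using p_gt_3 by simp
  have inj: "inj_on ?g residues_p"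
  proof (rule inj_onI)
    fix a b assume ab: "a \<in> residues_p" "b \<in> residues_p" "?g a = ?g b"
    then have "[c * a + d = c * b + d] (mod int p)" by (simp add: cong_def)
    then have "int p dvd c * a + d - (c * b + d)" by (simp add: cong_iff_dvd_diff)
    then have "int p dvd c * (a - b)" by (simp add: algebra_simps)
    then have "int p dvd a - b" using c prime_int_p by (simp add: prime_dvd_mult_iff)
    then have "[a = b] (mod int p)" by (simp add: cong_iff_dvd_diff)
    with ab show "a = b" by (auto simp: cong_def)
  qed
  have "?g ` residues_p \<subseteq> residues_p" using p by auto
  then have "bij_betw ?g residues_p residues_p"
    using inj by (simp add: bij_betw_def endo_inj_surj)
  then have "(\<Sum>a\<in>residues_p. f a) = (\<Sum>a\<in>residues_p. f (?g a))"
    by (rule sum.reindex_bij_betw[symmetric])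
  also have "\<dots> = (\<Sum>a\<in>residues_p. f (c * a + d))"
    by (intro sum.cong refl per) (simp add: cong_def)
  finally show ?thesis by simp
qed

section \<open>The quadratic character and its correlations\<close>

lemma \<phi>_values: "\<phi> a \<in> {-1, 0, 1}"
  by (simp add: \<phi>_def Legendre_def)

lemma \<phi>_eq_0_iff: "\<phi> a = 0 \<longleftrightarrow> int p dvd a"
  by (simp add: \<phi>_def Legendre_def cong_0_iff)

lemma \<phi>_cong: "[a = b] (mod int p) \<Longrightarrow> \<phi> a = \<phi> b"
  by (simp add: \<phi>_def Legendre_def QuadRes_def cong_def)

lemma \<phi>_power: "[\<phi> a = a ^ half] (mod int p)"
  using euler_criterion[OF prime_p, of a] p_gt_3 by (simp add: \<phi>_def half_def)

lemma eq_if_cong_small: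
  "[a = b] (mod int p) \<Longrightarrow> a \<in> {-1, 0, 1} \<Longrightarrow> b \<in> {-1, 0, 1} \<Longrightarrow> a = (b::int)"
  unfolding cong_iff_dvd_diff using p_gt_3 zdvd_not_zless[of "a - b" "int p"] zdvd_not_zless[of "b - a" "int p"]
    dvd_minus_iff[of "int p" "a - b"]
  by auto

lemma \<phi>_mult: "\<phi> (a * b) = \<phi> a * \<phi> b"
proof (rule eq_if_cong_small)
  have "[\<phi> (a * b) = (a * b) ^ half] (mod int p)" by (rule \<phi>_power)
  also have "[(a * b) ^ half = \<phi> a * \<phi> b] (mod int p)"
    unfolding power_mult_distrib by (intro cong_mult cong_sym[OF \<phi>_power])
  finally show "[\<phi> (a * b) = \<phi> a * \<phi> b] (mod int p)" .
qed (use \<phi>_values[of a] \<phi>_values[of b] \<phi>_values[of "a * b"] in auto)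

lemma \<phi>_square: "\<not> int p dvd a \<Longrightarrow> \<phi> a * \<phi> a = 1"
  using \<phi>_values[of a] \<phi>_eq_0_iff[of a] by auto

lemma \<phi>_eq_1: "\<phi> a = 1 \<Longrightarrow> \<exists>b. [a = b ^ 2] (mod int p)"
  by (auto simp: \<phi>_def Legendre_def QuadRes_def split: if_splits intro: cong_sym)

lemma \<phi>_minus_1: "even half \<Longrightarrow> \<phi> (-1) = 1"
  using \<phi>_power[of "-1"] by (intro eq_if_cong_small) (use \<phi>_values[of "-1"] in auto)

lemma primitive_root:
  obtains g where "\<not> p dvd g" "\<And>N. [g ^ N = 1] (mod p) \<longleftrightarrow> (p - 1) dvd N"
proof -
  obtain g where g: "residue_primroot p g" using prime_primitive_root_exists[OF prime_gt_1_nat[OF prime_p] prime_p] by blast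
  then have "coprime p g" and o: "ord p g = p - 1"
    using totient_prime[OF prime_p] by (auto simp: residue_primroot_def)
  then have "\<not> p dvd g"
    using prime_gt_1_nat[OF prime_p] coprime_common_divisor_nat[of p g p] by auto
  moreover have "[g ^ N = 1] (mod p) \<longleftrightarrow> (p - 1) dvd N" for N
    using ord_divides[of g N p] o by simp
  ultimately show ?thesis using that by blast
qed

lemma nonresidue: obtains g where "\<phi> g = -1"
proof -
  obtain g where g: "\<not> p dvd g" "\<And>N. [g ^ N = 1] (mod p) \<longleftrightarrow> (p - 1) dvd N" by (rule primitive_root) blast
  have "\<not> (p - 1) dvd half" using half_gt_1 p_eq dvd_imp_le[of "p - 1" half] by auto
  then have "\<not> [g ^ half = 1] (mod p)" using g by simp
  then have "\<not> [int (g ^ half) = int 1] (mod int p)" unfolding cong_int_iff .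
  then have "\<phi> (int g) \<noteq> 1" using \<phi>_power[of "int g"] by (auto simp: cong_def)
  moreover have "\<phi> (int g) \<noteq> 0" using g by (simp add: \<phi>_eq_0_iff)
  ultimately have "\<phi> (int g) = -1" using \<phi>_values[of "int g"] by auto
  then show ?thesis by (rule that)
qed

lemma sum_\<phi>: "(\<Sum>a\<in>residues_p. \<phi> a) = 0"
proof -
  obtain g where g: "\<phi> g = -1" by (rule nonresidue)
  then have "\<not> int p dvd g" using \<phi>_eq_0_iff[of g] by auto
  then have "(\<Sum>a\<in>residues_p. \<phi> (g * a + 0)) = (\<Sum>a\<in>residues_p. \<phi> a)"
    by (intro sum_residues_affine \<phi>_cong)
  then show ?thesis by (simp add: \<phi>_mult g sum_negf)
qed

lemma sum_residues_split: "(\<Sum>a\<in>residues_p. f a) = f 0 + (\<Sum>a\<in>{1..<int p}. f a)"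
proof -
  have "residues_p = insert 0 {1..<int p}" using p_gt_3 by auto
  then show ?thesis by simp
qed

lemma sum_\<phi>_square: "(\<Sum>a\<in>residues_p. \<phi> a * \<phi> a) = int p - 1"
proof -
  have "(\<Sum>a\<in>{1..<int p}. \<phi> a * \<phi> a) = (\<Sum>a\<in>{1..<int p}. 1)"
    by (intro sum.cong refl \<phi>_square) (auto simp: zdvd_not_zless)
  then show ?thesis unfolding sum_residues_split using p_gt_3 \<phi>_eq_0_iff[of 0] by simp
qed

text \<open>Rescaling \<open>a\<close> shows that the sum for \<open>d\<close> does not depend on \<open>d\<close>;
  summing over all \<open>d\<close> then determines it.\<close>

lemma sum_\<phi>_mult_diff:
  assumes "\<not> int p dvd d"
  shows "(\<Sum>a\<in>residues_p. \<phi> a * \<phi> (a - d)) = -1"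
proof -
  define K where "K = (\<Sum>a\<in>residues_p. \<phi> a * \<phi> (a - 1))"
  have K: "(\<Sum>a\<in>residues_p. \<phi> a * \<phi> (a - d)) = K" if d: "\<not> int p dvd d" for d
  proof -
    have "(\<Sum>a\<in>residues_p. \<phi> a * \<phi> (a - d)) = (\<Sum>a\<in>residues_p. \<phi> (d * a + 0) * \<phi> (d * a + 0 - d))"
      by (rule sum_residues_affine[symmetric, OF _ d, where f = "\<lambda>a. \<phi> a * \<phi> (a - d)"])
        (auto intro!: arg_cong2[where f = "(*)"] \<phi>_cong cong_diff)
    also have "\<dots> = (\<Sum>a\<in>residues_p. (\<phi> d * \<phi> d) * (\<phi> a * \<phi> (a - 1)))"
    proof (intro sum.cong refl)
      fix a
      have "d * a + 0 - d = d * (a - 1)" by (simp add: algebra_simps)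
      then show "\<phi> (d * a + 0) * \<phi> (d * a + 0 - d) = (\<phi> d * \<phi> d) * (\<phi> a * \<phi> (a - 1))"
        by (simp add: \<phi>_mult)
    qed
    also have "\<dots> = K" unfolding \<phi>_square[OF d] by (simp add: K_def)
    finally show ?thesis .
  qed
  have "(\<Sum>d\<in>residues_p. \<Sum>a\<in>residues_p. \<phi> a * \<phi> (a - d)) = (\<Sum>a\<in>residues_p. \<phi> a * (\<Sum>d\<in>residues_p. \<phi> (a - d)))"
    by (subst sum.swap) (simp add: sum_distrib_left)
  also have "\<dots> = 0"
  proof (intro sum.neutral ballI)
    fix a
    have "(\<Sum>d\<in>residues_p. \<phi> (-1 * d + a)) = (\<Sum>d\<in>residues_p. \<phi> d)"
      using prime_int_p not_prime_unit by (intro sum_residues_affine \<phi>_cong) auto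
    then show "\<phi> a * (\<Sum>d\<in>residues_p. \<phi> (a - d)) = 0" by (simp add: sum_\<phi>)
  qed
  finally have "(int p - 1) + (\<Sum>d\<in>{1..<int p}. \<Sum>a\<in>residues_p. \<phi> a * \<phi> (a - d)) = 0"
    unfolding sum_residues_split[of "\<lambda>d. \<Sum>a\<in>residues_p. \<phi> a * \<phi> (a - d)"] using sum_\<phi>_square by simp
  also have "(\<Sum>d\<in>{1..<int p}. \<Sum>a\<in>residues_p. \<phi> a * \<phi> (a - d)) = (\<Sum>d\<in>{1..<int p}. K)"
    by (intro sum.cong refl K) (auto simp: zdvd_not_zless)
  also have "\<dots> = (int p - 1) * K" using p_gt_3 by (simp add: of_nat_diff)
  finally have "(int p - 1) * (1 + K) = 0" by (simp add: algebra_simps)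
  then have "K = -1" using p_gt_3 by simp
  with K[OF assms] show ?thesis by simp
qed

lemma sum_\<phi>_diff_diff:
  "(\<Sum>a\<in>residues_p. \<phi> (a - b) * \<phi> (a - c)) = (if int p dvd b - c then int p else 0) - 1"
proof -
  have "(\<Sum>a\<in>residues_p. \<phi> (a - b) * \<phi> (a - c)) = (\<Sum>a\<in>residues_p. \<phi> (1 * a + b - b) * \<phi> (1 * a + b - c))"
    by (rule sum_residues_affine[symmetric, where f = "\<lambda>a. \<phi> (a - b) * \<phi> (a - c)"])
      (use prime_int_p not_prime_unit in \<open>auto intro!: arg_cong2[where f = "(*)"] \<phi>_cong cong_diff\<close>)
  also have "\<dots> = (\<Sum>a\<in>residues_p. \<phi> a * \<phi> (a - (c - b)))"
    by (simp add: algebra_simps)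
  also have "\<dots> = (if int p dvd b - c then int p else 0) - 1"
  proof (cases "int p dvd b - c")
    case True
    then have "[a - (c - b) = a] (mod int p)" for a
      by (simp add: cong_iff_dvd_diff dvd_diff_commute)
    then have "\<phi> (a - (c - b)) = \<phi> a" for a by (rule \<phi>_cong)
    then show ?thesis using True sum_\<phi>_square by simp
  next
    case False
    then have "\<not> int p dvd c - b" by (simp add: dvd_diff_commute)
    then show ?thesis using False sum_\<phi>_mult_diff by simp
  qed
  finally show ?thesis .
qed

text \<open>Up to sign the trace of Frobenius of the curve y^2 = s^3 - a s, which has complex
  multiplication by the Gaussian integers.\<close>

definition jacobsthal :: "int \<Rightarrow> int" where
  "jacobsthal a = (\<Sum>s\<in>residues_p. \<phi> s * \<phi> (s ^ 2 - a))"

lemma jacobsthal_cong: "[a = b] (mod int p) \<Longrightarrow> jacobsthal a = jacobsthal b"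
  unfolding jacobsthal_def
  by (intro sum.cong refl arg_cong2[where f = "(*)"] \<phi>_cong cong_diff) auto

lemma jacobsthal_0: "jacobsthal 0 = 0"
proof -
  have cube: "\<phi> s * \<phi> (s ^ 2 - 0) = \<phi> s" for s
    using \<phi>_values[of s] by (auto simp: power2_eq_square \<phi>_mult)
  show ?thesis unfolding jacobsthal_def cube by (rule sum_\<phi>)
qed

text \<open>Substituting b s for s multiplies the sum by the sign \<open>\<phi> b\<close>, which
  squaring removes. So the square depends only on the quadratic class of the argument.\<close>

lemma jacobsthal_scale:
  assumes "\<not> int p dvd b"
  shows "jacobsthal (b ^ 2 * a) ^ 2 = jacobsthal a ^ 2"
proof -
  have "jacobsthal (b ^ 2 * a) = (\<Sum>s\<in>residues_p. \<phi> (b * s + 0) * \<phi> ((b * s + 0) ^ 2 - b ^ 2 * a))"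
    unfolding jacobsthal_def
    by (rule sum_residues_affine[symmetric, OF _ assms, where f = "\<lambda>s. \<phi> s * \<phi> (s ^ 2 - b ^ 2 * a)"])
      (auto intro!: arg_cong2[where f = "(*)"] \<phi>_cong cong_diff cong_pow)
  also have "\<dots> = (\<Sum>s\<in>residues_p. \<phi> b * (\<phi> s * \<phi> (s ^ 2 - a)))"
  proof (intro sum.cong refl)
    fix s
    have "(b * s + 0) ^ 2 - b ^ 2 * a = b * b * (s ^ 2 - a)" by (simp add: power2_eq_square algebra_simps)
    then show "\<phi> (b * s + 0) * \<phi> ((b * s + 0) ^ 2 - b ^ 2 * a) = \<phi> b * (\<phi> s * \<phi> (s ^ 2 - a))"
      using \<phi>_square[OF assms] by (simp add: \<phi>_mult)
  qed
  also have "\<dots> = \<phi> b * jacobsthal a" by (simp add: jacobsthal_def sum_distrib_left)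
  finally show ?thesis using \<phi>_square[OF assms] by (simp add: power_mult_distrib power2_eq_square)
qed

text \<open>Expanding the square and summing over a first leaves, by the correlation formula, only
  the pairs with t = s or t = -s. Since -1 is a square when \<open>half\<close> is even, both
  contribute 1.\<close>

lemma sum_jacobsthal_square:
  assumes "even half"
  shows "(\<Sum>a\<in>residues_p. jacobsthal a ^ 2) = 2 * int p * (int p - 1)"
proof -
  let ?d = "\<lambda>s t. int p dvd s ^ 2 - t ^ 2"
  have minus: "\<phi> (- a) = \<phi> a" for a
    using \<phi>_mult[of "-1" a] \<phi>_minus_1[OF assms] by simp
  have "(\<Sum>a\<in>residues_p. jacobsthal a ^ 2)
      = (\<Sum>a\<in>residues_p. \<Sum>s\<in>residues_p. \<Sum>t\<in>residues_p. (\<phi> s * \<phi> t) * (\<phi> (a - s ^ 2) * \<phi> (a - t ^ 2)))"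
  proof (intro sum.cong refl)
    fix a
    have "\<phi> (s ^ 2 - a) = \<phi> (a - s ^ 2)" for s using minus[of "a - s ^ 2"] by simp
    then show "jacobsthal a ^ 2 = (\<Sum>s\<in>residues_p. \<Sum>t\<in>residues_p. (\<phi> s * \<phi> t) * (\<phi> (a - s ^ 2) * \<phi> (a - t ^ 2)))"
      unfolding jacobsthal_def power2_eq_square[of "sum _ _"] sum_product by (simp add: mult_ac)
  qed
  also have "\<dots> = (\<Sum>s\<in>residues_p. \<Sum>t\<in>residues_p. \<Sum>a\<in>residues_p. (\<phi> s * \<phi> t) * (\<phi> (a - s ^ 2) * \<phi> (a - t ^ 2)))"
    by (subst sum.swap, rule sum.cong[OF refl], rule sum.swap)
  also have "\<dots> = (\<Sum>s\<in>residues_p. \<Sum>t\<in>residues_p. (\<phi> s * \<phi> t) * ((if ?d s t then int p else 0) - 1))"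
    by (simp only: sum_distrib_left[symmetric] sum_\<phi>_diff_diff)
  also have "\<dots> = (\<Sum>s\<in>residues_p. int p * (\<Sum>t\<in>residues_p. if ?d s t then \<phi> s * \<phi> t else 0))"
  proof (intro sum.cong refl)
    fix s
    have "(\<Sum>t\<in>residues_p. (\<phi> s * \<phi> t) * ((if ?d s t then int p else 0) - 1))
        = (\<Sum>t\<in>residues_p. int p * (if ?d s t then \<phi> s * \<phi> t else 0)) - (\<Sum>t\<in>residues_p. \<phi> s * \<phi> t)"
      unfolding sum_subtractf[symmetric] by (intro sum.cong refl) (simp add: algebra_simps)
    also have "(\<Sum>t\<in>residues_p. \<phi> s * \<phi> t) = 0" by (simp add: sum_distrib_left[symmetric] sum_\<phi>)
    finally show "(\<Sum>t\<in>residues_p. (\<phi> s * \<phi> t) * ((if ?d s t then int p else 0) - 1))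
        = int p * (\<Sum>t\<in>residues_p. if ?d s t then \<phi> s * \<phi> t else 0)"
      by (simp add: sum_distrib_left)
  qed
  also have "\<dots> = (\<Sum>s\<in>{1..<int p}. int p * 2)"
  proof -
    have two: "(\<Sum>t\<in>residues_p. if ?d s t then \<phi> s * \<phi> t else 0) = 2" if s: "s \<in> {1..<int p}" for s
    proof -
      have ns: "\<not> int p dvd s" using s by (auto simp: zdvd_not_zless)
      have set: "{t \<in> residues_p. ?d s t} = {s, int p - s}"
      proof (intro equalityI subsetI)
        fix t assume "t \<in> {t \<in> residues_p. ?d s t}"
        then have t: "0 \<le> t" "t < int p" "int p dvd (s - t) * (s + t)"
          by (auto simp: power2_eq_square algebra_simps)
        then consider "int p dvd s - t" | "int p dvd s + t"
          using prime_int_p by (auto simp: prime_dvd_mult_iff)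
        then show "t \<in> {s, int p - s}"
        proof cases
          case 1
          then have "[s = t] (mod int p)" by (simp add: cong_iff_dvd_diff)
          then show ?thesis using s t by (auto simp: cong_def)
        next
          case 2
          then obtain k where k: "s + t = int p * k" by (auto elim: dvdE)
          have "1 \<le> s" "s < int p" using s by auto
          then have "int p * 0 < int p * k" "int p * k < int p * 2" using k t by linarith+
          then have "0 < k" "k < 2" using p_gt_3 by (simp_all only: mult_less_cancel_left_pos of_nat_0_less_iff)
          then have "k = 1" by simp
          then show ?thesis using k by simp
        qed
      next
        fix t assume "t \<in> {s, int p - s}"
        then show "t \<in> {t \<in> residues_p. ?d s t}"
          using s by (auto simp: power2_eq_square square_diff_square_factored)
      qed
      have ne: "s \<noteq> int p - s"
      proof
        assume "s = int p - s"
        then have "int p = 2 * s" by simp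
        then have "even p" by (metis dvd_triv_left even_of_nat_iff)
        then show False using odd_p by simp
      qed
      have "\<phi> (int p - s) = \<phi> (- s)" by (rule \<phi>_cong) (simp add: cong_iff_dvd_diff)
      then have "\<phi> (int p - s) = \<phi> s" by (simp add: minus)
      moreover have "(\<Sum>t\<in>residues_p. if ?d s t then \<phi> s * \<phi> t else 0)
          = (\<Sum>t\<in>{s, int p - s}. \<phi> s * \<phi> t)"
        unfolding set[symmetric] by (rule sum.inter_filter[symmetric]) simp
      ultimately show ?thesis using ne \<phi>_square[OF ns] by simp
    qed
    have zero: "(\<Sum>t\<in>residues_p. if ?d 0 t then \<phi> 0 * \<phi> t else 0) = 0"
      using \<phi>_eq_0_iff[of 0] by (intro sum.neutral) simp
    show ?thesis
      unfolding sum_residues_split[of "\<lambda>s. int p * (\<Sum>t\<in>residues_p. if ?d s t then \<phi> s * \<phi> t else 0)"] zero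
      using two by (simp only: mult_zero_right add_0 cong: sum.cong)
  qed
  also have "\<dots> = 2 * int p * (int p - 1)" using p_gt_3 by (simp add: of_nat_diff)
  finally show ?thesis .
qed

text \<open>The squares take one value on residues, at 1, and one on nonresidues, at g. Each class
  has (p - 1)/2 members, so the second moment 2 p (p - 1) determines the sum of the two
  values.\<close>

lemma jacobsthal_sum_of_squares:
  assumes "even half" and g: "\<phi> g = -1"
  shows "jacobsthal 1 ^ 2 + jacobsthal g ^ 2 = 4 * int p"
proof -
  have J: "2 * jacobsthal a ^ 2 = (1 + \<phi> a) * jacobsthal 1 ^ 2 + (1 - \<phi> a) * jacobsthal g ^ 2"
    if "\<not> int p dvd a" for a
  proof -
    have "\<phi> a \<noteq> 0" using that by (simp add: \<phi>_eq_0_iff)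
    then consider "\<phi> a = 1" | "\<phi> a = -1" using \<phi>_values[of a] by auto
    then show ?thesis
    proof cases
      case 1
      then obtain b where b: "[a = b ^ 2] (mod int p)" using \<phi>_eq_1 by blast
      then have "\<not> int p dvd b ^ 2" using that by (meson cong_dvd_iff)
      then have "\<not> int p dvd b" by (auto simp: power2_eq_square)
      then have "jacobsthal a ^ 2 = jacobsthal 1 ^ 2"
        using jacobsthal_cong[OF b] jacobsthal_scale[of b 1] by simp
      then show ?thesis using 1 by simp
    next
      case 2
      then have "\<phi> (a * g) = 1" using g by (simp add: \<phi>_mult)
      then obtain c where c: "[a * g = c ^ 2] (mod int p)" using \<phi>_eq_1 by blast
      have ng: "\<not> int p dvd g" using g \<phi>_eq_0_iff[of g] by auto
      then have "\<not> int p dvd a * g" using that prime_int_p by (simp add: prime_dvd_mult_iff)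
      then have "\<not> int p dvd c ^ 2" using c by (meson cong_dvd_iff)
      then have nc: "\<not> int p dvd c" by (auto simp: power2_eq_square)
      have "[g ^ 2 * a = c ^ 2 * g] (mod int p)"
        using cong_mult[OF c cong_refl[of g]] by (simp add: power2_eq_square mult_ac)
      then have "jacobsthal (g ^ 2 * a) = jacobsthal (c ^ 2 * g)" by (rule jacobsthal_cong)
      then have "jacobsthal a ^ 2 = jacobsthal g ^ 2"
        using jacobsthal_scale[OF ng, of a] jacobsthal_scale[OF nc, of g] by simp
      then show ?thesis using 2 by simp
    qed
  qed
  have sum1: "(\<Sum>a\<in>{1..<int p}. \<phi> a) = 0"
    using sum_\<phi> \<phi>_eq_0_iff[of 0] unfolding sum_residues_split by simp
  have card: "(\<Sum>a\<in>{1..<int p}. (1::int)) = int p - 1" using p_gt_3 by (simp add: of_nat_diff)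
  have "2 * (2 * int p * (int p - 1)) = (\<Sum>a\<in>{1..<int p}. 2 * jacobsthal a ^ 2)"
    unfolding sum_jacobsthal_square[OF assms(1), symmetric] sum_residues_split
    by (simp add: jacobsthal_0 sum_distrib_left)
  also have "\<dots> = (\<Sum>a\<in>{1..<int p}. (1 + \<phi> a) * jacobsthal 1 ^ 2 + (1 - \<phi> a) * jacobsthal g ^ 2)"
    by (intro sum.cong refl J) (auto simp: zdvd_not_zless)
  also have "\<dots> = (int p - 1) * (jacobsthal 1 ^ 2 + jacobsthal g ^ 2)"
    unfolding sum.distrib sum_distrib_right[symmetric] sum_subtractf sum1 card by (simp add: algebra_simps)
  finally have "(int p - 1) * (4 * int p) = (int p - 1) * (jacobsthal 1 ^ 2 + jacobsthal g ^ 2)"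
    by (simp add: algebra_simps)
  then show ?thesis using p_gt_3 by simp
qed

text \<open>The summand is invariant under s -> p - s. The factor 2 turns the representation of 4 p
  as a sum of two squares into one of p.\<close>

lemma jacobsthal_half:
  assumes "even half"
  shows "jacobsthal a = 2 * (\<Sum>s\<in>{1..int half}. \<phi> s * \<phi> (s ^ 2 - a))"
proof -
  let ?f = "\<lambda>s. \<phi> s * \<phi> (s ^ 2 - a)"
  have "{1..<int p} = {1..int half} \<union> {int half + 1..<int p}" using p_eq by auto
  then have "(\<Sum>s\<in>{1..<int p}. ?f s) = (\<Sum>s\<in>{1..int half}. ?f s) + (\<Sum>s\<in>{int half + 1..<int p}. ?f s)"
    by (simp only:) (rule sum.union_disjoint, auto)
  then have "jacobsthal a = (\<Sum>s\<in>{1..int half}. ?f s) + (\<Sum>s\<in>{int half + 1..<int p}. ?f s)"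
    unfolding jacobsthal_def sum_residues_split using \<phi>_eq_0_iff[of 0] by simp
  also have "(\<Sum>s\<in>{int half + 1..<int p}. ?f s) = (\<Sum>s\<in>{1..int half}. ?f (int p - s))"
    using p_eq by (intro sum.reindex_bij_witness[of _ "\<lambda>s. int p - s" "\<lambda>s. int p - s"]) auto
  also have "\<dots> = (\<Sum>s\<in>{1..int half}. ?f s)"
  proof (intro sum.cong refl arg_cong2[where f = "(*)"])
    fix s
    have "\<phi> (int p - s) = \<phi> (-1 * s)" by (rule \<phi>_cong) (simp add: cong_iff_dvd_diff)
    then show "\<phi> (int p - s) = \<phi> s" unfolding \<phi>_mult \<phi>_minus_1[OF assms] by simp
    show "\<phi> ((int p - s) ^ 2 - a) = \<phi> (s ^ 2 - a)"
      by (rule \<phi>_cong) (simp add: cong_iff_dvd_diff power2_eq_square algebra_simps)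
  qed
  finally show ?thesis by simp
qed

text \<open>The product identity for sums of two squares writes p^2 as such a sum. For a suitable
  sign of y one root is divisible by p; the other is odd, hence nonzero, so the first root must be
  0.\<close>

lemma sum_of_squares_unique:
  assumes "int p = x ^ 2 + 4 * y ^ 2" "int p = a ^ 2 + b ^ 2" "odd a"
  shows "x ^ 2 = a ^ 2"
proof -
  have oddp: "odd (int p)" using odd_p by simp
  have "even b" using oddp assms(2,3) by (metis even_add even_power pos2)
  have "odd x" using oddp assms(1) by (metis dvd_mult2 even_add even_numeral even_power pos2 even_mult_iff)
  have key: "x ^ 2 = a ^ 2" if d: "int p dvd x * b - 2 * z * a" and z: "z ^ 2 = y ^ 2" for z
  proof -
    have sq: "(x * a + 2 * z * b) ^ 2 + (x * b - 2 * z * a) ^ 2 = (x ^ 2 + 4 * z ^ 2) * (a ^ 2 + b ^ 2)"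
      by (simp add: power2_eq_square algebra_simps)
    then have pp: "(x * a + 2 * z * b) ^ 2 + (x * b - 2 * z * a) ^ 2 = int p * int p"
      unfolding z using assms(1,2) by simp
    have "odd (x * a + 2 * z * b)" using \<open>odd x\<close> assms(3) \<open>even b\<close> by simp
    then have nz: "x * a + 2 * z * b \<noteq> 0" by (metis even_zero)
    obtain k where k: "x * b - 2 * z * a = int p * k" using d by (auto elim: dvdE)
    have "(x * a + 2 * z * b) ^ 2 > 0" using nz by simp
    then have "int p * int p * k ^ 2 < int p * int p * 1"
      using pp unfolding k by (simp add: power2_eq_square mult_ac)
    then have "k ^ 2 < 1"
      using p_gt_3 mult_less_cancel_left_pos[of "int p * int p" "k ^ 2" 1] by simp
    then have "\<not> 0 < k ^ 2" by linarith
    then have "k = 0" by simp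
    then have "x * b = 2 * z * a" using k by simp
    then have "(x * b) ^ 2 = (2 * z * a) ^ 2" by simp
    then have "x ^ 2 * b ^ 2 = 4 * z ^ 2 * a ^ 2" by (simp add: power_mult_distrib)
    moreover have "b ^ 2 = int p - a ^ 2" "4 * z ^ 2 = int p - x ^ 2" using assms(1,2) z by simp_all
    ultimately have "x ^ 2 * (int p - a ^ 2) = (int p - x ^ 2) * a ^ 2" by simp
    then have "int p * x ^ 2 = int p * a ^ 2" by (simp add: algebra_simps)
    then show ?thesis using p_gt_3 by simp
  qed
  have "(x * b - 2 * y * a) * (x * b + 2 * y * a) = x ^ 2 * b ^ 2 - 4 * y ^ 2 * a ^ 2" by (simp add: power2_eq_square algebra_simps)
  also have "\<dots> = x ^ 2 * (int p - a ^ 2) - (int p - x ^ 2) * a ^ 2"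
  proof -
    have "b ^ 2 = int p - a ^ 2" "4 * y ^ 2 = int p - x ^ 2" using assms(1,2) by simp_all
    then show ?thesis by simp
  qed
  also have "\<dots> = int p * (x ^ 2 - a ^ 2)" by (simp add: algebra_simps)
  finally have "int p dvd (x * b - 2 * y * a) * (x * b + 2 * y * a)" by simp
  then consider "int p dvd x * b - 2 * y * a" | "int p dvd x * b - 2 * (- y) * a"
    using prime_int_p by (auto simp: prime_dvd_mult_iff)
  then show ?thesis using key[of y] key[of "- y"] by cases auto
qed

text \<open>Half the sum, A, is one of two integers whose squares add up to p. It is odd, since s =
  1 contributes 0 and the remaining \<open>half\<close> - 1 terms, an odd number, are all 1 or -1;
  so its square is the one matching x^2.\<close>

lemma jacobsthal_1:
  assumes "even half" "int p = x ^ 2 + 4 * y ^ 2"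
  shows "jacobsthal 1 ^ 2 = 4 * x ^ 2"
proof -
  obtain g where g: "\<phi> g = -1" by (rule nonresidue)
  define f where "f = (\<lambda>s::int. \<phi> s * \<phi> (s ^ 2 - 1))"
  define A where "A = (\<Sum>s\<in>{1..int half}. f s)"
  define B where "B = (\<Sum>s\<in>{1..int half}. \<phi> s * \<phi> (s ^ 2 - g))"
  have J: "jacobsthal 1 = 2 * A" "jacobsthal g = 2 * B"
    unfolding A_def B_def f_def using jacobsthal_half[OF assms(1)] by simp_all
  have "int p = A ^ 2 + B ^ 2"
    using jacobsthal_sum_of_squares[OF assms(1) g] unfolding J by (simp add: power_mult_distrib)
  moreover have "odd A"
  proof -
    have "{1..int half} = insert 1 {2..int half}" using half_gt_1 by auto
    then have "A = (\<Sum>s\<in>{2..int half}. f s)"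
      unfolding A_def using \<phi>_eq_0_iff[of 0] by (simp add: f_def)
    moreover have "odd (f s)" if s: "s \<in> {2..int half}" for s
    proof -
      have "\<not> int p dvd s" "\<not> int p dvd s - 1" "\<not> int p dvd s + 1"
        using s p_eq by (auto simp: zdvd_not_zless)
      moreover have "s ^ 2 - 1 = (s - 1) * (s + 1)" by (simp add: power2_eq_square algebra_simps)
      ultimately have "\<phi> s \<noteq> 0" "\<phi> (s ^ 2 - 1) \<noteq> 0"
        using prime_int_p by (simp_all add: \<phi>_eq_0_iff prime_dvd_mult_iff)
      then show ?thesis using \<phi>_values[of s] \<phi>_values[of "s ^ 2 - 1"] by (auto simp: f_def)
    qed
    then have "{s \<in> {2..int half}. odd (f s)} = {2..int half}" by auto
    then have "even (\<Sum>s\<in>{2..int half}. f s) = even (card {2..int half})"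
      by (subst even_sum_iff) simp_all
    moreover have "nat (int half - 1) = half - 1" by simp
    ultimately show ?thesis using assms(1) half_gt_1 by simp
  qed
  ultimately have "x ^ 2 = A ^ 2" using sum_of_squares_unique assms(2) by blast
  then show ?thesis by (simp add: J power_mult_distrib)
qed

end

section \<open>\<open>G_seq ((p - 1) div 2)\<close> modulo \<open>p ^ 2\<close>\<close>

lemma odd_harmonic_eq: "odd_harmonic n = harmonic (2 * n) - harmonic n / 2"
proof (induction n)
  case (Suc n)
  define c where "c = (1 / of_nat (Suc n) :: rat)"
  define d where "d = (1 / of_nat (2 * n + 1) :: rat)"
  have "2 * Suc n = Suc (Suc (2 * n))" by simp
  then have "harmonic (2 * Suc n) = harmonic (2 * n) + d + 1 / of_nat (2 * Suc n)"
    by (simp only: harmonic_Suc d_def) simp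
  moreover have "1 / of_nat (2 * Suc n) = c / 2" by (simp add: c_def mult.commute)
  moreover have "harmonic (Suc n) = harmonic n + c" by (simp add: harmonic_Suc c_def)
  moreover have "odd_harmonic (Suc n) = odd_harmonic n + d"
    by (simp add: odd_harmonic_def d_def)
  ultimately show ?case using Suc.IH by linarith
qed (simp add: odd_harmonic_def)

context prime_gt_3
begin

lemma prod_one_minus_even:
  assumes "k \<le> half"
  shows "pcong 2 (\<Prod>i<k. 1 - P / (2 * of_nat (Suc i))) (1 - P / 2 * harmonic k)"
proof -
  have nd: "\<not> p dvd Suc i" if "i < k" for i
    using that assms p_eq by (intro not_dvd_less) auto
  have int: "p_integral p (- 1 / 2 / of_nat (Suc i))" if "i < k" for i
    using nd[OF that] by (intro p_integral_divide_of_nat p_integral_intros)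
  have "(\<Prod>i<k. 1 - P / (2 * of_nat (Suc i))) = (\<Prod>i<k. 1 + P ^ 1 * (- 1 / 2 / of_nat (Suc i)))" by simp
  also have "pcong (2 * 1) \<dots> (1 + P ^ 1 * (\<Sum>i<k. - 1 / 2 / of_nat (Suc i)))"
    by (intro pcong_prod_one_add int) auto
  also have "1 + P ^ 1 * (\<Sum>i<k. - 1 / 2 / of_nat (Suc i)) = 1 - P / 2 * harmonic k"
    unfolding harmonic_def
    by (simp add: sum_distrib_left sum_negf sum.atLeast1_atMost_eq)
  finally show ?thesis by simp
qed

lemma prod_one_minus_odd:
  assumes "k \<le> half"
  shows "pcong 2 (\<Prod>i<k. 1 - P / of_nat (2 * i + 1)) (1 - P * odd_harmonic k)"
proof -
  have int: "p_integral p (- 1 / of_nat (2 * i + 1))" if "i < k" for i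
    using half_less[OF assms that] by (intro p_integral_divide_of_nat p_integral_intros not_dvd_less) auto
  have "(\<Prod>i<k. 1 - P / of_nat (2 * i + 1)) = (\<Prod>i<k. 1 + P ^ 1 * (- 1 / of_nat (2 * i + 1)))" by simp
  also have "pcong (2 * 1) \<dots> (1 + P ^ 1 * (\<Sum>i<k. - 1 / of_nat (2 * i + 1)))"
    by (intro pcong_prod_one_add int) auto
  also have "1 + P ^ 1 * (\<Sum>i<k. - 1 / of_nat (2 * i + 1)) = 1 - P * odd_harmonic k"
    unfolding odd_harmonic_def by (simp add: sum_negf)
  finally show ?thesis by simp
qed

text \<open>Since \<open>half\<close> - i = -((2i + 1) / 2) (1 - p / (2i + 1)), the coefficient is a
  perturbation of (-1/2) choose k, which is (-1)^k \<open>cbinom k\<close>.\<close>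

lemma choose_half:
  assumes "k \<le> half"
  shows "pcong 2 ((-1) ^ k * of_nat (half choose k)) (cbinom k * (1 - P * odd_harmonic k))"
proof -
  have "(-1) ^ k * of_nat (half choose k) = cbinom k * (\<Prod>i<k. 1 - P / of_nat (2 * i + 1))"
    using assms
  proof (induction k)
    case (Suc k)
    define a where "a = (of_nat (Suc k) :: rat)"
    define b where "b = (of_nat (2 * k + 1) :: rat)"
    have a: "a \<noteq> 0" by (simp add: a_def del: of_nat_Suc)
    have b: "b \<noteq> 0" by (simp add: b_def del: of_nat_Suc of_nat_add)
    have "of_nat half - of_nat k = (P - b) / 2" by (simp add: b_def P_eq field_simps)
    then have e: "of_nat (half choose Suc k) = of_nat (half choose k) * ((P - b) / 2) / a"
      by (simp only: binomial_Suc_rat a_def)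
    have IH: "(-1) ^ k * of_nat (half choose k) = cbinom k * (\<Prod>i<k. 1 - P / of_nat (2 * i + 1))"
      using Suc by simp
    have ce: "2 * of_nat k + 1 = b" "2 * of_nat k + 2 = 2 * a" by (simp_all add: a_def b_def)
    have "(-1) ^ Suc k * of_nat (half choose Suc k) = ((-1) ^ k * of_nat (half choose k)) * ((b - P) / (2 * a))"
      unfolding e using a by (simp add: field_simps)
    also have "\<dots> = cbinom (Suc k) * (\<Prod>i<Suc k. 1 - P / of_nat (2 * i + 1))"
      unfolding IH cbinom_Suc ce prod.lessThan_Suc b_def[symmetric] using a b by (simp add: field_simps)
    finally show ?case .
  qed simp
  then show ?thesis
    using pcong_scale[OF p_integral_cbinom prod_one_minus_odd[OF assms]] by simp
qed

text \<open>Going down from \<open>half\<close>, the ratio of consecutive values is (p - (2k + 1)) /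
  (p - (2k + 2)); going up it is (2k + 1) / (2k + 2). They agree modulo p, and the two products
  collect the corrections. The even one stays on the left, which avoids dividing by it.\<close>

lemma cbinom_reflect:
  assumes "k \<le> half"
  shows "pcong 2 (cbinom (half - k) * (1 - P / 2 * harmonic k)) (cbinom half * cbinom k * (1 - P * odd_harmonic k))"
proof -
  have e: "cbinom (half - k) * (\<Prod>i<k. 1 - P / (2 * of_nat (Suc i)))
      = cbinom half * cbinom k * (\<Prod>i<k. 1 - P / of_nat (2 * i + 1))"
    using assms
  proof (induction k)
    case (Suc k)
    define a where "a = (of_nat (Suc k) :: rat)"
    define b where "b = (of_nat (2 * k + 1) :: rat)"
    have a: "a \<noteq> 0" by (simp add: a_def del: of_nat_Suc)
    have b: "b \<noteq> 0" by (simp add: b_def del: of_nat_Suc of_nat_add)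
    have ba: "b = 2 * a - 1" by (simp add: a_def b_def)
    have hk: "of_nat (half - Suc k) = (P - 1) / 2 - a" using Suc.prems by (simp add: a_def of_nat_diff P_eq)
    have h: "half - k = Suc (half - Suc k)" using Suc.prems by simp
    have "of_nat (half - k) \<noteq> (0::rat)" using Suc.prems by simp
    moreover have "of_nat (half - k) = (P + 1) / 2 - a" using Suc.prems by (simp add: a_def of_nat_diff P_eq field_simps)
    ultimately have nz: "P + 1 - 2 * a \<noteq> 0" by (simp add: field_simps)
    have "cbinom (half - k) = cbinom (half - Suc k) * (P - 2 * a) / (P + 1 - 2 * a)"
    proof -
      have "2 * ((P - 1) / 2 - a) + 1 = P - 2 * a" "2 * ((P - 1) / 2 - a) + 2 = P + 1 - 2 * a"
        by (simp_all add: field_simps)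
      then show ?thesis unfolding h cbinom_Suc hk by (simp only:)
    qed
    then have c: "cbinom (half - Suc k) * (P - 2 * a) = cbinom (half - k) * (P - b)"
      using nz unfolding ba by (simp add: field_simps)
    have ce: "2 * of_nat k + 1 = b" "2 * of_nat k + 2 = 2 * a" by (simp_all add: a_def b_def)
    define X where "X = (\<Prod>i<k. 1 - P / (2 * of_nat (Suc i)))"
    define Y where "Y = (\<Prod>i<k. 1 - P / of_nat (2 * i + 1))"
    have IH: "cbinom (half - k) * X = cbinom half * cbinom k * Y"
      using Suc unfolding X_def Y_def by simp
    have "cbinom (half - Suc k) * (X * (1 - P / (2 * a))) = - (cbinom (half - Suc k) * (P - 2 * a)) * X / (2 * a)"
      using a by (simp add: field_simps)
    also have "\<dots> = (cbinom (half - k) * X) * (b - P) / (2 * a)"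
      unfolding c by (simp add: algebra_simps)
    also have "\<dots> = cbinom half * (cbinom k * b / (2 * a)) * (Y * (1 - P / b))"
    proof -
      have "b - P = b * (1 - P / b)" using b by (simp add: field_simps)
      then show ?thesis unfolding IH by simp
    qed
    finally show ?case
      unfolding cbinom_Suc ce prod.lessThan_Suc X_def[symmetric] Y_def[symmetric] a_def[symmetric] b_def[symmetric] .
  qed simp
  have m1: "pcong 2 (cbinom (half - k) * (\<Prod>i<k. 1 - P / (2 * of_nat (Suc i)))) (cbinom (half - k) * (1 - P / 2 * harmonic k))"
    by (intro pcong_scale p_integral_cbinom prod_one_minus_even assms)
  have m2: "pcong 2 (cbinom half * cbinom k * (\<Prod>i<k. 1 - P / of_nat (2 * i + 1)))
      (cbinom half * cbinom k * (1 - P * odd_harmonic k))"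
    by (intro pcong_scale p_integral_mult p_integral_cbinom prod_one_minus_odd assms)
  show ?thesis using pcong_trans[OF pcong_sym[OF m1[unfolded e]] m2] .
qed

lemma cbinom_half: "pcong 2 (cbinom half) ((-1) ^ half * (1 + P * fq))"
  using pcong_weaken[OF morley, of 2] unfolding power_2_fq by simp

lemma p_integral_inverse_cbinom:
  assumes "k \<le> half" shows "p_integral p (1 / cbinom k)"
proof -
  have "p_integral p (4 ^ k / of_nat ((2 * k) choose k))"
    using assms p_eq by (intro p_integral_divide_of_nat not_dvd_choose p_integral_intros) auto
  then show ?thesis by (simp add: cbinom_def)
qed

lemma cbinom_neq_0: "cbinom k \<noteq> 0"
  by (simp add: cbinom_def)

text \<open>From 2i + 1 = p - 2 (\<open>half\<close> - i). It lets the reversal of a sum over k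
  trade \<open>odd_harmonic\<close> for \<open>harmonic\<close>.\<close>

lemma odd_harmonic_reflect:
  assumes "k \<le> half"
  shows "pcong 1 (odd_harmonic k) (- (harmonic half - harmonic (half - k)) / 2)"
proof -
  have "(\<Sum>i<k. 1 / of_nat (2 * i + 1)) = (\<Sum>i<k. 1 / of_nat (p - 2 * (half - i)))"
    using assms p_eq by (intro sum.cong refl arg_cong[where f = "\<lambda>n. 1 / of_nat n"]) auto
  then have "odd_harmonic k = (\<Sum>i<k. 1 / of_nat (p - 2 * (half - i)))" by (simp add: odd_harmonic_def)
  also have "pcong 1 \<dots> (\<Sum>i<k. - 1 / of_nat (2 * (half - i)))"
    using assms p_eq by (intro pcong_sum pcong_inverse_reflect) auto
  also have "(\<Sum>i<k. - 1 / of_nat (2 * (half - i))) = - (harmonic half - harmonic (half - k)) / 2"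
    using assms
  proof (induction k)
    case (Suc k)
    have h: "half - k = Suc (half - Suc k)" using Suc.prems by simp
    have "harmonic (half - k) = harmonic (half - Suc k) + 1 / of_nat (half - k)"
      unfolding h harmonic_Suc ..
    moreover have "- 1 / of_nat (2 * (half - k)) = - (1 / (of_nat (half - k) :: rat)) / 2" by simp
    ultimately show ?case using Suc by (simp only: sum.lessThan_Suc) (simp add: algebra_simps diff_divide_distrib add_divide_distrib)
  qed simp
  finally show ?thesis .
qed

lemma sum_atMost_rev: "(\<Sum>k\<le>n. f k) = (\<Sum>k\<le>n. f (n - k))" for n :: nat
  by (rule sum.reindex_bij_witness[of _ "\<lambda>k. n - k" "\<lambda>k. n - k"]) auto

text \<open>The two expressions for the sum in \<open>sum_cbinom_convolution\<close> have different
  first-order expansions modulo \<open>p ^ 2\<close>; comparing them determines the correction terms.\<close>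

lemma G_seq_half:
  obtains B where "of_nat (G_seq half) = 16 ^ half * B"
    and "even half \<Longrightarrow> pcong 2 B (cbinom (half div 2) ^ 2)"
    and "odd half \<Longrightarrow> pcong 2 B 0"
proof
  define B where "B = (\<Sum>k\<le>half. (-1) ^ k * of_nat (half choose k) * cbinom k ^ 2)"
  define U where "U = (\<Sum>k\<le>half. cbinom k ^ 3)"
  define X where "X = (\<Sum>k\<le>half. cbinom k ^ 3 * odd_harmonic k)"
  define Z where "Z = (\<Sum>k\<le>half. cbinom k ^ 3 * harmonic k)"
  define s where "s = ((-1) ^ half :: rat)"
  let ?t = "\<lambda>k. s * (1 + P * fq) * (cbinom k ^ 3 - P * (cbinom k ^ 3 * odd_harmonic k) + P / 2 * (cbinom k ^ 3 * harmonic k))"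
  note cint = p_integral_cbinom
  have int: "p_integral p U" "p_integral p X" "p_integral p Z" "p_integral p s"
    unfolding U_def X_def Z_def s_def
    by (auto intro!: p_integral_intros cint p_integral_odd_harmonic p_integral_harmonic half_less_p)
  have B': "B = (\<Sum>k\<le>half. cbinom k ^ 2 * cbinom (half - k))"
    unfolding B_def sum_cbinom_convolution ..
  show "of_nat (G_seq half) = 16 ^ half * B"
    unfolding B' by (rule G_seq_cbinom)
  have B1: "pcong 2 B (U - P * X)"
  proof -
    have "pcong 2 B (\<Sum>k\<le>half. cbinom k ^ 3 - P * (cbinom k ^ 3 * odd_harmonic k))"
      unfolding B_def
    proof (rule pcong_sum)
      fix k assume "k \<in> {..half}"
      then have "pcong 2 (cbinom k ^ 2 * ((-1) ^ k * of_nat (half choose k))) (cbinom k ^ 2 * (cbinom k * (1 - P * odd_harmonic k)))"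
        by (intro pcong_scale choose_half p_integral_power cint) auto
      then show "pcong 2 ((-1) ^ k * of_nat (half choose k) * cbinom k ^ 2) (cbinom k ^ 3 - P * (cbinom k ^ 3 * odd_harmonic k))"
        by (simp add: algebra_simps power2_eq_square power3_eq_cube)
    qed
    then show ?thesis by (simp add: U_def X_def sum_subtractf sum_distrib_left)
  qed
  have B2: "pcong 2 B (s * (1 + P * fq) * (U - P * X + P / 2 * Z))"
  proof -
    have "pcong 2 B (\<Sum>k\<le>half. ?t k)"
      unfolding B'
    proof (rule pcong_sum)
      fix k assume "k \<in> {..half}"
      then have k: "k \<le> half" by simp
      define u where "u = cbinom k"
      define H where "H = harmonic k"
      define Q where "Q = odd_harmonic k"
      have i: "p_integral p u" "p_integral p H" "p_integral p Q"
        unfolding u_def H_def Q_def using k by (auto intro!: cint p_integral_odd_harmonic p_integral_harmonic half_less_p)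
      have "pcong 2 (cbinom (half - k)) ((1 + P / 2 * H) * (cbinom (half - k) * (1 - P / 2 * H)))"
        by (rule pcongI[of _ _ _ "H ^ 2 / 4 * cbinom (half - k)"])
          (auto simp: field_simps power2_eq_square intro!: p_integral_intros i cint)
      also have "pcong 2 \<dots> ((1 + P / 2 * H) * (cbinom half * u * (1 - P * Q)))"
        unfolding H_def u_def Q_def using k
        by (intro pcong_scale cbinom_reflect p_integral_intros p_integral_harmonic half_less_p)
      also have "\<dots> = ((1 + P / 2 * H) * u * (1 - P * Q)) * cbinom half" by simp
      also have "pcong 2 \<dots> (((1 + P / 2 * H) * u * (1 - P * Q)) * (s * (1 + P * fq)))"
        unfolding s_def by (intro pcong_scale cbinom_half p_integral_intros i)
      also have "pcong 2 \<dots> (s * (1 + P * fq) * (u - P * (u * Q) + P / 2 * (u * H)))"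
        by (rule pcongI[of _ _ _ "s * (1 + P * fq) * (- (H * u * Q / 2))"])
          (auto simp: field_simps power2_eq_square intro!: p_integral_intros i int p_integral_fq)
      finally have "pcong 2 (u ^ 2 * cbinom (half - k)) (u ^ 2 * (s * (1 + P * fq) * (u - P * (u * Q) + P / 2 * (u * H))))"
        by (intro pcong_scale p_integral_power i)
      then show "pcong 2 (cbinom k ^ 2 * cbinom (half - k))
          (?t k)"
        unfolding u_def[symmetric] H_def[symmetric] Q_def[symmetric]
        by (simp add: field_simps power2_eq_square power3_eq_cube)
    qed
    also have "(\<Sum>k\<le>half. ?t k)
        = s * (1 + P * fq) * (U - P * X + P / 2 * Z)"
      by (simp only: sum_distrib_left[symmetric] sum.distrib sum_subtractf U_def X_def Z_def)
    finally show ?thesis .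
  qed
  \<comment> \<open>Reversing k -> \<open>half\<close> - k: modulo p,
    \<open>cbinom (half - k)\<close> is s times \<open>cbinom k\<close>, so the weight
    \<open>odd_harmonic\<close> becomes a combination of a constant and
    \<open>harmonic\<close>.\<close>
  have X: "pcong 1 X (fq * U + s * Z / 2)"
  proof -
    have neg_half: "- x / 2 = (- 1 / 2) * x" for x :: rat by simp
    have "pcong 1 X (\<Sum>k\<le>half. cbinom k ^ 3 * (- (- 2 * fq - harmonic (half - k)) / 2))"
      unfolding X_def
    proof (rule pcong_sum)
      fix k assume "k \<in> {..half}"
      then have k: "k \<le> half" by simp
      have "pcong 1 (odd_harmonic k) (- (harmonic half - harmonic (half - k)) / 2)" by (rule odd_harmonic_reflect[OF k])
      also have "\<dots> = (- 1 / 2) * (harmonic half - harmonic (half - k))" by (rule neg_half)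
      also have "pcong 1 \<dots> ((- 1 / 2) * (- 2 * fq - harmonic (half - k)))"
        by (intro pcong_scale pcong_diff harmonic_half_1 pcong_refl p_integral_intros)
      also have "\<dots> = - (- 2 * fq - harmonic (half - k)) / 2" by (rule neg_half[symmetric])
      finally show "pcong 1 (cbinom k ^ 3 * odd_harmonic k) (cbinom k ^ 3 * (- (- 2 * fq - harmonic (half - k)) / 2))"
        by (intro pcong_scale p_integral_power cint)
    qed
    also have "\<dots> = fq * U + (\<Sum>k\<le>half. cbinom k ^ 3 * harmonic (half - k)) / 2"
      unfolding U_def sum_distrib_left sum_divide_distrib sum.distrib[symmetric]
      by (intro sum.cong refl) (simp add: field_simps)
    also have "(\<Sum>k\<le>half. cbinom k ^ 3 * harmonic (half - k)) = (\<Sum>k\<le>half. cbinom (half - k) ^ 3 * harmonic k)"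
      by (subst sum_atMost_rev) simp
    also have "pcong 1 (fq * U + (\<Sum>k\<le>half. cbinom (half - k) ^ 3 * harmonic k) / 2) (fq * U + s * Z / 2)"
    proof -
      have "pcong 1 (\<Sum>k\<le>half. harmonic k * cbinom (half - k) ^ 3) (\<Sum>k\<le>half. harmonic k * (s * cbinom k) ^ 3)"
      proof (intro pcong_sum pcong_scale pcong_power)
        fix k assume "k \<in> {..half}"
        then have k: "k \<le> half" by simp
        then show "p_integral p (harmonic k)" by (intro p_integral_harmonic half_less_p)
        show "p_integral p (s * cbinom k)" by (intro p_integral_mult int cint)
        have i: "p_integral p (harmonic k)" "p_integral p (odd_harmonic k)"
          using k by (auto intro: p_integral_harmonic half_less_p p_integral_odd_harmonic)
        have "pcong 1 (cbinom (half - k)) (cbinom (half - k) * (1 - P / 2 * harmonic k))"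
          by (rule pcongI[of _ _ _ "cbinom (half - k) * (harmonic k / 2)"])
            (auto simp: field_simps intro!: p_integral_intros i cint)
        also have "pcong 1 \<dots> (cbinom half * cbinom k * (1 - P * odd_harmonic k))"
          by (rule pcong_weaken[OF cbinom_reflect[OF k]]) simp
        also have "pcong 1 \<dots> (cbinom k * cbinom half)"
          by (rule pcongI[of _ _ _ "cbinom half * cbinom k * - odd_harmonic k"])
            (auto simp: algebra_simps intro!: p_integral_intros i cint)
        also have "pcong 1 \<dots> (cbinom k * (s * (1 + P * fq)))"
          unfolding s_def by (intro pcong_scale pcong_weaken[OF cbinom_half] cint) simp
        also have "pcong 1 \<dots> (s * cbinom k)"
          by (rule pcongI[of _ _ _ "cbinom k * s * fq"])
            (auto simp: algebra_simps intro!: p_integral_intros int cint p_integral_fq)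
        finally show "pcong 1 (cbinom (half - k)) (s * cbinom k)" .
      qed
      also have "\<dots> = s * Z"
      proof -
        have "s ^ 3 = s" by (cases "even half") (simp_all add: s_def)
        then show ?thesis by (simp add: Z_def sum_distrib_left power_mult_distrib mult_ac)
      qed
      finally have "pcong 1 (fq * U + 1 / 2 * (\<Sum>k\<le>half. harmonic k * cbinom (half - k) ^ 3)) (fq * U + 1 / 2 * (s * Z))"
        by (intro pcong_add pcong_refl pcong_scale p_integral_intros)
      then show ?thesis by (simp add: mult.commute)
    qed
    finally show ?thesis .
  qed
  have U: "pcong 2 U (\<Sum>k\<le>half. legendre_term k (of_nat half) * cbinom k)"
    unfolding U_def
  proof (rule pcong_sum)
    fix k assume "k \<in> {..half}"
    then have "pcong 2 (cbinom k * cbinom k ^ 2) (cbinom k * legendre_term k (of_nat half))"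
      by (intro pcong_scale cint pcong_sym[OF pcong_legendre_term_half_2]) simp
    then show "pcong 2 (cbinom k ^ 3) (legendre_term k (of_nat half) * cbinom k)"
      by (simp add: power2_eq_square power3_eq_cube mult.commute)
  qed
  obtain x where x: "p_integral p x" "X = fq * U + s * Z / 2 + P * x" using X by (auto elim: pcongE)
  obtain b c where b: "p_integral p b" "B = U - P * X + P ^ 2 * b"
    and c: "p_integral p c" "B = s * (1 + P * fq) * (U - P * X + P / 2 * Z) + P ^ 2 * c"
    using B1 B2 by (auto elim!: pcongE)
  show "pcong 2 B (cbinom (half div 2) ^ 2)" if "even half"
  proof -
    have s: "s = 1" using that by (simp add: s_def)
    \<comment> \<open>Equating the two expansions of B shows that p (q U + Z / 2) is 0 modulo p^2.
      Since X is q U + Z / 2 modulo p, this is exactly the correction p X in the first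
      expansion.\<close>
    have eq: "P * (fq * U + Z / 2) = P ^ 2 * (b - c + fq * X - fq * Z / 2)"
      using b(2) c(2) unfolding s by (simp add: field_simps power2_eq_square)
    have "B - U = P ^ 2 * (b - x) - P * (fq * U + Z / 2)"
      unfolding b(2) x(2) s by (simp add: algebra_simps power2_eq_square)
    also have "\<dots> = P ^ 2 * (b - x - (b - c + fq * X - fq * Z / 2))"
      unfolding eq by (simp add: algebra_simps)
    finally have "pcong 2 B U"
      by (rule pcongI) (intro p_integral_intros b c x int p_integral_fq)
    also note U
    also have "(\<Sum>k\<le>half. legendre_term k (of_nat half) * cbinom k) = cbinom (half div 2) ^ 2"
      using sum_legendre_term_cbinom(1)[of "half div 2"] that by simp
    finally show ?thesis .
  qed
  show "pcong 2 B 0" if "odd half"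
  proof -
    have s: "s = -1" using that by (simp add: s_def)
    have "(\<Sum>k\<le>half. legendre_term k (of_nat half) * cbinom k) = 0"
      using sum_legendre_term_cbinom(2)[of "half div 2"] that by simp
    then obtain u where u: "p_integral p u" "U = P ^ 2 * u" using U by (auto elim: pcongE)
    \<comment> \<open>Here U is 0 modulo p^2 and X is -Z / 2 modulo p, so the expansions read B = -p
      X and B = 2 p X modulo p^2. Twice the first plus the second is 0, and 3 is invertible.\<close>
    have "3 * B = 2 * B + B" by simp
    also have "\<dots> = 2 * (U - P * X + P ^ 2 * b) + (s * (1 + P * fq) * (U - P * X + P / 2 * Z) + P ^ 2 * c)"
      using b(2) c(2) by simp
    also have "\<dots> = U - P * (X + Z / 2) - P * fq * U + P ^ 2 * (2 * b + c + fq * (X - Z / 2))"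
      unfolding s by (simp add: field_simps power2_eq_square)
    also have "X + Z / 2 = fq * U + P * x" unfolding x(2) s by simp
    finally have "B = P ^ 2 * ((u - 2 * fq * P * u - x + (2 * b + c + fq * (X - Z / 2))) / 3)"
      unfolding u(2) by (simp add: algebra_simps power2_eq_square)
    then have "B - 0 = P ^ 2 * ((u - 2 * fq * P * u - x + (2 * b + c + fq * (X - Z / 2))) / 3)" by simp
    then show ?thesis by (rule pcongI) (intro p_integral_intros b c x u int p_integral_fq)
  qed
qed

end

section \<open>The Jacobsthal sum modulo \<open>p ^ 2\<close>\<close>

text \<open>The 4 m consecutive values of m + i + j span two periods of 2 m, so exactly two of them
  are multiples. Which ones depends on whether the window starts below 2 m.\<close>

lemma multiples_in_window:
  fixes m i :: nat
  assumes "m > 0"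
  shows "i < m \<Longrightarrow> {j \<in> {1..4 * m}. 2 * m dvd m + i + j} = {m - i, 3 * m - i}"
    and "m \<le> i \<Longrightarrow> i < 2 * m \<Longrightarrow> {j \<in> {1..4 * m}. 2 * m dvd m + i + j} = {3 * m - i, 5 * m - i}"
proof -
  \<comment> \<open>The bounds a and b enclose the quotient strictly: 0 and 3 for i < m, 1 and 4 for
    larger i.\<close>
  have q: "m + i + j = 2 * m \<and> a < 1 \<or> m + i + j = 4 * m \<or> m + i + j = 6 * m \<and> b > 3"
    if dvd: "2 * m dvd m + i + j" and bounds: "2 * m * a < m + i + j" "m + i + j < 2 * m * b" "b \<le> 4" for j a b
  proof -
    obtain q where q: "m + i + j = 2 * m * q" using dvd by (rule dvdE)
    then have "a < q" "q < b" using bounds by simp_all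
    then have "q = 1 \<or> q = 2 \<or> q = 3" using bounds(3) by linarith
    then show ?thesis using q \<open>a < q\<close> \<open>q < b\<close> by auto
  qed
  show "{j \<in> {1..4 * m}. 2 * m dvd m + i + j} = {m - i, 3 * m - i}" if "i < m"
  proof (intro equalityI subsetI)
    fix j assume "j \<in> {j \<in> {1..4 * m}. 2 * m dvd m + i + j}"
    then show "j \<in> {m - i, 3 * m - i}" using q[of j 0 3] that assms by auto
  next
    fix j assume "j \<in> {m - i, 3 * m - i}"
    then have "1 \<le> j \<and> j \<le> 4 * m \<and> (m + i + j = 2 * m * 1 \<or> m + i + j = 2 * m * 2)" using that by auto
    then show "j \<in> {j \<in> {1..4 * m}. 2 * m dvd m + i + j}" by (metis (mono_tags, lifting) atLeastAtMost_iff dvd_triv_left mem_Collect_eq)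
  qed
  show "{j \<in> {1..4 * m}. 2 * m dvd m + i + j} = {3 * m - i, 5 * m - i}" if "m \<le> i" "i < 2 * m"
  proof (intro equalityI subsetI)
    fix j assume "j \<in> {j \<in> {1..4 * m}. 2 * m dvd m + i + j}"
    then show "j \<in> {3 * m - i, 5 * m - i}" using q[of j 1 4] that assms by auto
  next
    fix j assume "j \<in> {3 * m - i, 5 * m - i}"
    then have "1 \<le> j \<and> j \<le> 4 * m \<and> (m + i + j = 2 * m * 2 \<or> m + i + j = 2 * m * 3)" using that by auto
    then show "j \<in> {j \<in> {1..4 * m}. 2 * m dvd m + i + j}" by (metis (mono_tags, lifting) atLeastAtMost_iff dvd_triv_left mem_Collect_eq)
  qed
qed

lemma one_minus_power:
  fixes x :: rat
  shows "(1 - x) ^ n = (\<Sum>i\<le>n. (-1) ^ i * of_nat (n choose i) * x ^ i)"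
  using binomial_ring[of "- x" 1 n]
  by (simp add: power_minus[of x] mult_ac)

text \<open>The \<open>p\<close>-part of the expanded Jacobsthal sum for \<open>p = 4 * m + 1\<close>; the divisibility
  condition selects the exponents that are divisible by \<open>p - 1\<close>.\<close>

definition residue_sum :: "nat \<Rightarrow> rat" where
  "residue_sum m = (\<Sum>i\<le>2 * m - 1. \<Sum>j | j \<in> {1..4 * m} \<and> 2 * m dvd m + i + j.
     (-1) ^ i * of_nat ((2 * m - 1) choose i) / of_nat j)"

context prime_gt_3
begin

section \<open>Teichmueller representatives modulo p^2\<close>

text \<open>In x^p - y^p the cofactor of x - y is p y^(p - 1) modulo p, so the p-th power gains one
  factor p.\<close>

lemma pcong_power_p:
  assumes "pcong 1 x y" "p_integral p y"
  shows "pcong 2 (x ^ p) (y ^ p)"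
proof -
  obtain c where c: "p_integral p c" "x - y = P * c" using assms(1) unfolding pcong_def by auto
  have "pcong 1 (\<Sum>i<p. y ^ (p - Suc i) * x ^ i) (\<Sum>i<p. y ^ (p - Suc i) * y ^ i)"
    by (intro pcong_sum pcong_scale pcong_power assms p_integral_power)
  also have "(\<Sum>i<p. y ^ (p - Suc i) * y ^ i) = (\<Sum>i<p. y ^ (p - 1))"
    by (intro sum.cong refl) (simp flip: power_add)
  also have "\<dots> = P ^ 1 * y ^ (p - 1)" by simp
  also have "pcong 1 \<dots> 0" by (intro pcong_P_0 p_integral_power assms)
  finally obtain d where d: "p_integral p d" "(\<Sum>i<p. y ^ (p - Suc i) * x ^ i) = P * d" by (auto elim: pcongE)
  have "x ^ p - y ^ p = P ^ 2 * (c * d)"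
    unfolding power_diff_sumr2 c(2) d(2) by (simp add: power2_eq_square)
  then show ?thesis by (rule pcongI) (intro p_integral_mult c d)
qed

abbreviation teich :: "int \<Rightarrow> rat" where "teich a \<equiv> of_int a ^ p"

lemma p_integral_teich: "p_integral p (teich a)"
  by (intro p_integral_intros)

lemma teich_cong: "[a = b] (mod int p) \<Longrightarrow> pcong 2 (teich a) (teich b)"
  by (intro pcong_power_p p_integral_of_int) (simp add: pcong_of_int)

text \<open>Euler's criterion raised to the p-th power; the values -1, 0, 1 are unchanged because p
  is odd.\<close>

lemma \<phi>_teich: "pcong 2 (of_int (\<phi> a)) (teich a ^ half)"
proof -
  have "\<phi> a ^ p = \<phi> a" using \<phi>_values[of a] odd_p p_gt_3 by auto
  then have "(of_int (\<phi> a) :: rat) = of_int (\<phi> a) ^ p" by (metis of_int_power)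
  also have "pcong 2 \<dots> ((of_int a ^ half) ^ p)"
  proof (intro pcong_power_p p_integral_intros)
    have "pcong 1 (of_int (\<phi> a)) (of_int (a ^ half))"
      unfolding pcong_of_int using \<phi>_power by simp
    then show "pcong 1 (of_int (\<phi> a)) (of_int a ^ half)" by simp
  qed
  also have "(of_int a ^ half) ^ p = teich a ^ half" by (simp add: mult.commute flip: power_mult)
  finally show ?thesis .
qed

lemma teich_order: "\<not> int p dvd a \<Longrightarrow> pcong 2 (teich a ^ (p - 1)) 1"
proof -
  assume "\<not> int p dvd a"
  then have "[a ^ (p - 1) = 1] (mod int p)"
  proof -
    have "[\<phi> a * \<phi> a = a ^ half * a ^ half] (mod int p)" by (intro cong_mult \<phi>_power)
    also have "a ^ half * a ^ half = a ^ (p - 1)"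
      using p_eq by (metis add_diff_cancel_right' mult_2 power_add)
    finally show ?thesis using \<phi>_square[OF \<open>\<not> int p dvd a\<close>] by (simp add: cong_sym_eq)
  qed
  then have "pcong 1 (of_int (a ^ (p - 1))) (of_int 1)" unfolding pcong_of_int by simp
  then have "pcong 2 (of_int (a ^ (p - 1)) ^ p) (of_int 1 ^ p)" by (intro pcong_power_p p_integral_of_int)
  then show "pcong 2 (teich a ^ (p - 1)) 1" by (simp add: mult.commute flip: power_mult)
qed

text \<open>Multiplication by a primitive root permutes the residues and multiplies the sum by some
  w. Unless p - 1 divides N, w - 1 is prime to p, so the sum vanishes to the full precision p^2.
  Positivity of N makes the residue 0 contribute nothing.\<close>

lemma sum_teich_power:
  assumes "N > 0"
  shows "pcong 2 (\<Sum>a\<in>residues_p. teich a ^ N) (if (p - 1) dvd N then P - 1 else 0)"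
proof (cases "(p - 1) dvd N")
  case True
  then obtain k where k: "N = (p - 1) * k" by (auto elim: dvdE)
  have "residues_p = insert 0 {1..<int p}" using p_gt_3 by auto
  then have "(\<Sum>a\<in>residues_p. teich a ^ N) = (\<Sum>a\<in>{1..<int p}. teich a ^ N)"
    using assms p_gt_3 by simp
  also have "pcong 2 \<dots> (\<Sum>a\<in>{1..<int p}. 1 ^ k)"
    unfolding k power_mult
    by (intro pcong_sum pcong_power teich_order p_integral_1) (auto simp: zdvd_not_zless)
  also have "(\<Sum>a\<in>{1..<int p}. 1 ^ k) = P - 1" using p_gt_3 by (simp add: of_nat_diff)
  finally show ?thesis using True by simp
next
  case False
  obtain g where g: "\<not> p dvd g" "\<And>N. [g ^ N = 1] (mod p) \<longleftrightarrow> (p - 1) dvd N"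
    by (rule primitive_root) blast
  \<comment> \<open>Reducing a first makes f exactly periodic, as \<open>sum_residues_affine\<close>
    demands; \<open>teich\<close> itself is periodic only modulo p^2.\<close>
  define f where "f = (\<lambda>a. teich (a mod int p) ^ N)"
  define S where "S = (\<Sum>a\<in>residues_p. teich a ^ N)"
  define w where "w = teich (int g) ^ N"
  have f: "pcong 2 (f a) (teich a ^ N)" for a
    unfolding f_def by (intro pcong_power teich_cong p_integral_teich) simp
  have "S = (\<Sum>a\<in>residues_p. f a)"
    unfolding S_def f_def by (intro sum.cong refl) simp
  also have "\<dots> = (\<Sum>a\<in>residues_p. f (int g * a + 0))"
    using g(1) by (intro sum_residues_affine[symmetric]) (auto simp: f_def cong_def)
  also have "pcong 2 \<dots> (\<Sum>a\<in>residues_p. teich (int g * a + 0) ^ N)" by (intro pcong_sum f)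
  also have "\<dots> = w * S"
    by (simp add: S_def w_def sum_distrib_left power_mult_distrib)
  finally have wS: "pcong 2 S (w * S)" .
  obtain c where c: "p_integral p c" "S - w * S = P ^ 2 * c" using wS unfolding pcong_def by auto
  define G where "G = g ^ (p * N)"
  have wG: "w = of_nat G" by (simp add: w_def G_def power_mult)
  have "G > 0" using g(1) by (auto simp: G_def intro: Nat.gr0I)
  have nd: "\<not> p dvd G - 1"
  proof
    assume "p dvd G - 1"
    then have "[G = 1] (mod p)" using \<open>G > 0\<close> by (simp add: cong_altdef_nat)
    then have "(p - 1) dvd p * N" unfolding G_def g(2) .
    \<comment> \<open>Since p is 1 modulo p - 1, the additional exponent p does not affect
      divisibility by p - 1.\<close>
    moreover have "p * N = (p - 1) * N + N" using p_gt_3 by (simp add: algebra_simps flip: mult_Suc)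
    ultimately have "(p - 1) dvd N" using dvd_add_right_iff[of "p - 1" "(p - 1) * N" N] by simp
    with False show False by simp
  qed
  have "of_nat (G - 1) * (- S) = P ^ 2 * c"
    using c(2) \<open>G > 0\<close> unfolding wG by (simp add: of_nat_diff algebra_simps)
  moreover have "of_nat (G - 1) \<noteq> (0::rat)" using nd by (metis dvd_0_right of_nat_eq_0_iff)
  ultimately have "S - 0 = P ^ 2 * (- c / of_nat (G - 1))"
    by (simp add: field_simps del: of_nat_diff)
  then have "pcong 2 S 0"
    by (rule pcongI) (intro p_integral_divide_of_nat nd p_integral_uminus c)
  then show ?thesis using False by (simp add: S_def)
qed

text \<open>For 0 < j < p, p choose j is p / j times (p - 1) choose (j - 1), and the latter is
  (-1)^(j - 1) modulo p. The truncated logarithm measures how far p-th powering is from being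
  additive.\<close>

lemma one_minus_power_p:
  assumes "p_integral p z"
  shows "pcong 2 ((1 - z) ^ p) (1 - z ^ p - P * (\<Sum>j=1..p - 1. z ^ j / of_nat j))"
proof -
  have "{..p} = insert 0 (insert p {1..p - 1})" using p_gt_3 by auto
  then have "(1 - z) ^ p = 1 + ((-1) ^ p * z ^ p + (\<Sum>j=1..p - 1. (-1) ^ j * of_nat (p choose j) * z ^ j))"
    unfolding one_minus_power using p_gt_3 by simp
  also have "pcong 2 \<dots> (1 + ((-1) ^ p * z ^ p + (\<Sum>j=1..p - 1. P * (- (z ^ j / of_nat j)))))"
  proof (intro pcong_add pcong_refl pcong_sum)
    fix j assume "j \<in> {1..p - 1}"
    then have j: "1 \<le> j" "j < p" using p_gt_3 by auto
    then have nd: "\<not> p dvd j" by (intro not_dvd_less) auto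
    obtain k where k: "j = Suc k" using j by (cases j) auto
    have kp: "k \<le> p - 1" "k < p" using j k by auto
    have "j * (p choose j) = p * ((p - 1) choose k)"
      using binomial_absorption[of k p] by (simp add: k)
    then have "of_nat j * of_nat (p choose j) = P * of_nat ((p - 1) choose k)"
      by (simp only: of_nat_mult[symmetric])
    then have e: "of_nat (p choose j) = P * of_nat ((p - 1) choose k) / of_nat j"
      using j by (simp add: field_simps)
    have "pcong 1 ((-1) ^ k * of_nat ((p - 1) choose k)) (1 - P * harmonic k + P ^ 2 / 2 * (harmonic k ^ 2 - harmonic2 k))"
      by (rule pcong_weaken[OF pcong_choose_p_minus_1[OF kp(1)]]) simp
    also have "pcong 1 \<dots> 1"
      by (rule pcongI[of _ _ _ "- harmonic k + P / 2 * (harmonic k ^ 2 - harmonic2 k)"])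
        (auto simp: field_simps power2_eq_square intro!: p_integral_intros p_integral_harmonic p_integral_harmonic2 kp)
    finally have "pcong 1 (- (z ^ j / of_nat j) * ((-1) ^ k * of_nat ((p - 1) choose k))) (- (z ^ j / of_nat j) * 1)"
      by (intro pcong_scale p_integral_uminus p_integral_divide_of_nat p_integral_power assms nd)
    then have "pcong (Suc 1) (P * (- (z ^ j / of_nat j) * ((-1) ^ k * of_nat ((p - 1) choose k)))) (P * (- (z ^ j / of_nat j) * 1))"
      by (rule pcong_mult_P1)
    moreover have "P * (- (z ^ j / of_nat j) * ((-1) ^ k * of_nat ((p - 1) choose k))) = (-1) ^ j * of_nat (p choose j) * z ^ j"
      unfolding e by (simp add: k)
    ultimately show "pcong 2 ((-1) ^ j * of_nat (p choose j) * z ^ j) (P * (- (z ^ j / of_nat j)))"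
      by (simp add: numeral_2_eq_2)
  qed
  also have "\<dots> = 1 - z ^ p - P * (\<Sum>j=1..p - 1. z ^ j / of_nat j)"
    using odd_p by (simp add: sum_distrib_left sum_negf)
  finally show ?thesis .
qed

lemma pcong_power_perturb:
  assumes "p_integral p y" "p_integral p c"
  shows "pcong 2 ((y - P * c) ^ Suc n) (y ^ Suc n - P * of_nat (Suc n) * c * y ^ n)"
proof (induction n)
  case (Suc n)
  have "pcong 2 ((y - P * c) * (y - P * c) ^ Suc n) ((y - P * c) * (y ^ Suc n - P * of_nat (Suc n) * c * y ^ n))"
    by (intro pcong_scale Suc.IH p_integral_intros assms)
  also have "pcong 2 \<dots> (y ^ Suc (Suc n) - P * of_nat (Suc (Suc n)) * c * y ^ Suc n)"
    by (rule pcongI[of _ _ _ "of_nat (Suc n) * c ^ 2 * y ^ n"])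
      (auto simp: algebra_simps power2_eq_square intro!: p_integral_intros assms)
  finally show ?case by simp
qed simp

text \<open>Pulling out the sign of -1 brings 1 - s^2 into play, whose p-th power is 1 - t^2 minus p
  times a truncated logarithm in s^2. In that correction s may be replaced by t = s^p, as a factor p
  is already present; the rest is expansion to first order in p.\<close>

lemma jacobsthal_term:
  assumes "half = Suc n" and that: "\<phi>' = of_int (\<phi> (-1))"
  shows "pcong 2 (of_int (\<phi> s * \<phi> (s ^ 2 - 1)))
    (\<phi>' * ((\<Sum>i\<le>half. (-1) ^ i * of_nat (half choose i) * teich s ^ (half + 2 * i))
      - P * of_nat half * (\<Sum>i\<le>n. \<Sum>j=1..p - 1. (-1) ^ i * of_nat (n choose i) / of_nat j * teich s ^ (half + 2 * i + 2 * j))))"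
proof -
  define t where "t = teich s"
  have t: "p_integral p t" by (simp add: t_def p_integral_teich)
  define g where "g = (\<Sum>j=1..p - 1. (t ^ 2) ^ j / of_nat j)"
  have nd: "\<not> p dvd j" if "j \<in> {1..p - 1}" for j using that p_gt_3 by (intro not_dvd_less) auto
  have g: "p_integral p g"
    unfolding g_def using nd by (intro p_integral_sum p_integral_divide_of_nat p_integral_power t)
  have st: "pcong 1 (of_int s) t"
  proof -
    have "[s = s ^ p] (mod int p)"
    proof (cases "int p dvd s")
      case True
      moreover have "s dvd s ^ p" using p_gt_3 by (intro dvd_power) simp
      ultimately have "int p dvd s ^ p" by (rule dvd_trans)
      then show ?thesis using True by (simp add: cong_iff_dvd_diff dvd_diff)
    next
      case False
      have "[\<phi> s * \<phi> s * s = s ^ half * s ^ half * s] (mod int p)" by (intro cong_mult \<phi>_power cong_refl)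
      moreover have "s ^ half * s ^ half * s = s ^ p"
        using p_eq by (metis mult_2 power_Suc2 Suc_eq_plus1 power_add)
      ultimately show ?thesis using \<phi>_square[OF False] by simp
    qed
    then have "pcong 1 (of_int s) (of_int (s ^ p))" unfolding pcong_of_int by simp
    then show ?thesis by (simp add: t_def)
  qed
  have "\<phi> s * \<phi> (s ^ 2 - 1) = \<phi> (-1) * (\<phi> s * \<phi> (1 - s ^ 2))"
    using \<phi>_mult[of "-1" "1 - s ^ 2"] by simp
  then have "of_int (\<phi> s * \<phi> (s ^ 2 - 1)) = \<phi>' * (of_int (\<phi> s) * of_int (\<phi> (1 - s ^ 2)))"
    by (simp only: that of_int_mult)
  also have "pcong 2 \<dots> (\<phi>' * (t ^ half * teich (1 - s ^ 2) ^ half))"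
    unfolding t_def that by (intro pcong_scale pcong_mult \<phi>_teich p_integral_intros)
  also have "pcong 2 \<dots> (\<phi>' * (t ^ half * (1 - t ^ 2 - P * g) ^ half))"
  proof (intro pcong_scale pcong_power p_integral_intros t g)
    have "pcong 2 ((1 - of_int s ^ 2) ^ p) (1 - (of_int s ^ 2) ^ p - P * (\<Sum>j=1..p - 1. (of_int s ^ 2) ^ j / of_nat j))"
      by (intro one_minus_power_p p_integral_intros)
    also have "(of_int s ^ 2) ^ p = t ^ 2" by (simp add: t_def mult.commute flip: power_mult)
    also have "pcong 2 (1 - t ^ 2 - P * (\<Sum>j=1..p - 1. (of_int s ^ 2) ^ j / of_nat j)) (1 - t ^ 2 - P * g)"
    proof (intro pcong_diff pcong_refl)
      have "pcong 1 (\<Sum>j=1..p - 1. (of_int s ^ 2) ^ j / of_nat j) g"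
        unfolding g_def using nd by (intro pcong_sum pcong_divide_of_nat pcong_power st p_integral_power t)
      from pcong_mult_P1[OF this]
      show "pcong 2 (P * (\<Sum>j=1..p - 1. (of_int s ^ 2) ^ j / of_nat j)) (P * g)" by (simp add: numeral_2_eq_2)
    qed
    finally show "pcong 2 (teich (1 - s ^ 2)) (1 - t ^ 2 - P * g)" by simp
    show "p_integral p \<phi>'" by (simp add: that p_integral_of_int)
  qed
  also have "pcong 2 \<dots> (\<phi>' * (t ^ half * ((1 - t ^ 2) ^ half - P * of_nat half * g * (1 - t ^ 2) ^ n)))"
    unfolding assms(1) that by (intro pcong_scale pcong_power_perturb p_integral_intros t g)
  also have "t ^ half * ((1 - t ^ 2) ^ half - P * of_nat half * g * (1 - t ^ 2) ^ n)
      = (\<Sum>i\<le>half. (-1) ^ i * of_nat (half choose i) * t ^ (half + 2 * i))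
      - P * of_nat half * (\<Sum>i\<le>n. \<Sum>j=1..p - 1. (-1) ^ i * of_nat (n choose i) / of_nat j * t ^ (half + 2 * i + 2 * j))"
  proof -
    have "t ^ half * (1 - t ^ 2) ^ half = (\<Sum>i\<le>half. (-1) ^ i * of_nat (half choose i) * t ^ (half + 2 * i))"
      unfolding one_minus_power sum_distrib_left
      by (intro sum.cong refl) (simp add: power_add power_mult)
    moreover have "t ^ half * (g * (1 - t ^ 2) ^ n) = (\<Sum>i\<le>n. \<Sum>j=1..p - 1. (-1) ^ i * of_nat (n choose i) / of_nat j * t ^ (half + 2 * i + 2 * j))"
      unfolding one_minus_power g_def mult.commute[of "sum _ {1..p - 1}"] sum_product sum_distrib_left
      by (intro sum.cong refl) (simp add: power_add power_mult)
    ultimately show ?thesis by (simp add: algebra_simps)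
  qed
  finally show ?thesis unfolding t_def .
qed

text \<open>Power sums keep only exponents divisible by p - 1 = 4 m, with weight p - 1. In the
  leading part this selects i = m; in the part with factor p it selects the pairs in
  \<open>residue_sum\<close>, and there the weight may be taken as -1, which turns the minus sign
  into a plus.\<close>

lemma jacobsthal_expand:
  assumes m: "half = 2 * m"
  shows "pcong 2 (of_int (jacobsthal 1))
    ((-1) ^ m * of_nat ((2 * m) choose m) * (P - 1)
     + P * of_nat half * residue_sum m)"
proof -
  let ?b = "\<lambda>i. (-1) ^ i * of_nat (half choose i) :: rat"
  define n where "n = 2 * m - 1"
  let ?c = "\<lambda>i j. (-1) ^ i * of_nat (n choose i) / of_nat j :: rat"
  have mpos: "m > 0" using m half_gt_1 by auto
  have n: "half = Suc n" using m mpos by (simp add: n_def)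
  have p1: "p - 1 = 4 * m" using p_eq m by simp
  have \<phi>1: "\<phi> (-1) = 1" using m by (intro \<phi>_minus_1) simp
  have dvd: "(p - 1) dvd half + 2 * i \<longleftrightarrow> 2 * m dvd m + i" for i
  proof -
    have "p - 1 = 2 * (2 * m)" "half + 2 * i = 2 * (m + i)" using p1 m by simp_all
    then show ?thesis by (simp only: nat_mult_dvd_cancel_disj) simp
  qed
  define T where "T = (\<lambda>N. \<Sum>s\<in>residues_p. teich s ^ N)"
  have T: "pcong 2 (T N) (if (p - 1) dvd N then P - 1 else 0)" if "N > 0" for N
    unfolding T_def by (rule sum_teich_power[OF that])
  have "of_int (jacobsthal 1) = (\<Sum>s\<in>residues_p. of_int (\<phi> s * \<phi> (s ^ 2 - 1)))"
    by (simp add: jacobsthal_def)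
  also have "pcong 2 \<dots> (\<Sum>s\<in>residues_p. of_int (\<phi> (-1)) * ((\<Sum>i\<le>half. ?b i * teich s ^ (half + 2 * i))
      - P * of_nat half * (\<Sum>i\<le>n. \<Sum>j=1..p - 1. ?c i j * teich s ^ (half + 2 * i + 2 * j))))"
    by (intro pcong_sum jacobsthal_term n refl)
  also have "\<dots> = (\<Sum>i\<le>half. ?b i * T (half + 2 * i))
      - P * of_nat half * (\<Sum>i\<le>n. \<Sum>j=1..p - 1. ?c i j * T (half + 2 * i + 2 * j))"
  proof -
    have 1: "(\<Sum>s\<in>residues_p. \<Sum>i\<le>half. ?b i * teich s ^ (half + 2 * i))
        = (\<Sum>i\<le>half. ?b i * T (half + 2 * i))"
      unfolding T_def sum_distrib_left by (rule sum.swap)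
    have 2: "(\<Sum>s\<in>residues_p. \<Sum>i\<le>n. \<Sum>j=1..p - 1. ?c i j * teich s ^ (half + 2 * i + 2 * j))
        = (\<Sum>i\<le>n. \<Sum>j=1..p - 1. ?c i j * T (half + 2 * i + 2 * j))"
      unfolding T_def sum_distrib_left by (subst sum.swap, intro sum.cong refl, rule sum.swap)
    show ?thesis
      unfolding \<phi>1 of_int_1 mult_1 sum_subtractf sum_distrib_left[of "P * of_nat half", symmetric] 1 2 ..
  qed
  also have "pcong 2 \<dots> ((\<Sum>i\<le>half. ?b i * (if (p - 1) dvd half + 2 * i then P - 1 else 0))
      - P * of_nat half * (\<Sum>i\<le>n. \<Sum>j=1..p - 1. ?c i j * (if (p - 1) dvd half + 2 * i + 2 * j then P - 1 else 0)))"
    using half_gt_1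
    by (intro pcong_diff pcong_sum pcong_scale T p_integral_divide_of_nat not_dvd_less p_integral_intros) auto
  also have "(\<Sum>i\<le>half. ?b i * (if (p - 1) dvd half + 2 * i then P - 1 else 0))
      = (-1) ^ m * of_nat ((2 * m) choose m) * (P - 1)"
  proof -
    have "2 * m dvd m + i \<longleftrightarrow> i = m" if "i \<le> 2 * m" for i
    proof
      assume "2 * m dvd m + i"
      then obtain q where q: "m + i = 2 * m * q" by (auto elim: dvdE)
      then have "2 * m * 0 < 2 * m * q" "2 * m * q < 2 * m * 2" using q that mpos by linarith+
      then have "q = 1" using mpos by simp
      then show "i = m" using q by simp
    qed (simp flip: mult_2)
    then have "(\<Sum>i\<le>half. ?b i * (if (p - 1) dvd half + 2 * i then P - 1 else 0))
        = (\<Sum>i\<in>{m}. ?b i * (P - 1))"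
      unfolding dvd by (intro sum.mono_neutral_cong_right) (auto simp: m)
    then show ?thesis by (simp add: m)
  qed
  also have "(\<Sum>i\<le>n. \<Sum>j=1..p - 1. ?c i j * (if (p - 1) dvd half + 2 * i + 2 * j then P - 1 else 0))
      = (P - 1) * (\<Sum>i\<le>n. \<Sum>j | j \<in> {1..4 * m} \<and> 2 * m dvd m + i + j. ?c i j)"
    unfolding sum_distrib_left
  proof (rule sum.cong[OF refl])
    fix i
    have d: "(p - 1) dvd half + 2 * i + 2 * j \<longleftrightarrow> 2 * m dvd m + i + j" for j
      using dvd[of "i + j"] by (simp add: algebra_simps)
    show "(\<Sum>j=1..p - 1. ?c i j * (if (p - 1) dvd half + 2 * i + 2 * j then P - 1 else 0))
        = (\<Sum>j | j \<in> {1..4 * m} \<and> 2 * m dvd m + i + j. (P - 1) * (?c i j))"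
      unfolding d unfolding p1 by (rule sum.mono_neutral_cong_right) auto
  qed
  finally have main: "pcong 2 (of_int (jacobsthal 1)) ((-1) ^ m * of_nat ((2 * m) choose m) * (P - 1)
      - P * of_nat half * ((P - 1) * (\<Sum>i\<le>n. \<Sum>j | j \<in> {1..4 * m} \<and> 2 * m dvd m + i + j. ?c i j)))" .
  define W where "W = (\<Sum>i\<le>n. \<Sum>j | j \<in> {1..4 * m} \<and> 2 * m dvd m + i + j. ?c i j)"
  have W: "p_integral p W"
    unfolding W_def using p1 p_gt_3 by (intro p_integral_sum p_integral_divide_of_nat not_dvd_less p_integral_intros) auto
  note main[folded W_def]
  also have "pcong 2 ((-1) ^ m * of_nat ((2 * m) choose m) * (P - 1) - P * of_nat half * ((P - 1) * W))
      ((-1) ^ m * of_nat ((2 * m) choose m) * (P - 1) + P * of_nat half * W)"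
    by (rule pcongI[of _ _ _ "- (of_nat half * W)"]) (auto simp: algebra_simps power2_eq_square intro!: p_integral_intros W)
  finally show ?thesis unfolding W_def n_def residue_sum_def .
qed

section \<open>Harmonic numbers and binomial coefficients at (p - 1) / 4\<close>

text \<open>The index m is the fixed point of k -> \<open>half\<close> - k. There
  \<open>cbinom m\<close> cancels from the reflection formula, and the terms of order p give the
  claim.\<close>

lemma harmonic_quarter:
  assumes m: "half = 2 * m"
  shows "pcong 1 (harmonic (2 * m) - harmonic m) fq"
proof -
  have mh: "m \<le> half" "half - m = m" using m by simp_all
  have s: "(-1) ^ half = (1::rat)" using m by simp
  have int: "p_integral p (harmonic m)" "p_integral p (odd_harmonic m)"
    using mh by (auto intro: p_integral_harmonic half_less_p p_integral_odd_harmonic)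
  have "pcong 2 (cbinom m * (1 - P / 2 * harmonic m)) (cbinom m * (cbinom half * (1 - P * odd_harmonic m)))"
    using cbinom_reflect[OF mh(1)] unfolding mh(2) by (simp only: mult_ac)
  then have "pcong 2 (1 - P / 2 * harmonic m) (cbinom half * (1 - P * odd_harmonic m))"
    by (rule pcong_cancel) (intro p_integral_inverse_cbinom mh cbinom_neq_0)+
  also have "\<dots> = (1 - P * odd_harmonic m) * cbinom half" by simp
  also have "pcong 2 \<dots> ((1 - P * odd_harmonic m) * (1 + P * fq))"
    using cbinom_half unfolding s by (intro pcong_scale p_integral_intros int) simp
  finally obtain c where c: "p_integral p c"
    "1 - P / 2 * harmonic m - (1 - P * odd_harmonic m) * (1 + P * fq) = P ^ 2 * c"
    unfolding pcong_def by auto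
  have "P * (odd_harmonic m - harmonic m / 2 - fq) = P * (P * (c - odd_harmonic m * fq))"
    using c(2) by (simp add: algebra_simps power2_eq_square)
  then have "odd_harmonic m - harmonic m / 2 - fq = P ^ 1 * (c - odd_harmonic m * fq)" by simp
  moreover have "odd_harmonic m - harmonic m / 2 = harmonic (2 * m) - harmonic m"
    by (simp add: odd_harmonic_eq)
  ultimately have "harmonic (2 * m) - harmonic m - fq = P ^ 1 * (c - odd_harmonic m * fq)" by simp
  then show ?thesis by (rule pcongI) (intro p_integral_intros c int p_integral_fq)
qed

lemma power_16_quarter: "half = 2 * m \<Longrightarrow> (16::rat) ^ m = 1 + P * fq"
proof -
  assume m: "half = 2 * m"
  have "(16::rat) ^ m = 4 ^ half" unfolding m by (simp add: power_mult)
  then show ?thesis by (simp only: power_2_p_minus_1[symmetric] power_2_fq)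
qed

text \<open>The comparison of \<open>legendre_term m\<close> at \<open>half\<close> with
  \<open>cbinom m ^ 2\<close>: the former is (-1)^m times (2m choose m) times (3m choose m), and
  16^m is 1 modulo p.\<close>

lemma choose_three_quarters:
  assumes m: "half = 2 * m"
  shows "pcong 1 (1 / of_nat ((3 * m) choose m)) ((-1) ^ m / of_nat ((2 * m) choose m))"
proof -
  define C where "C = (of_nat ((2 * m) choose m) :: rat)"
  define D where "D = (of_nat ((3 * m) choose m) :: rat)"
  define s where "s = ((-1) ^ m :: rat)"
  have ss: "s * s = 1" by (simp add: s_def flip: power_mult_distrib)
  have "2 * m < p" "3 * m < p" using p_eq m by simp_all
  then have nd: "\<not> p dvd ((2 * m) choose m)" "\<not> p dvd ((3 * m) choose m)"
    by (simp_all add: not_dvd_choose)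
  have int: "p_integral p C" "p_integral p D" "p_integral p (1 / C)" "p_integral p (1 / D)" "p_integral p s"
    unfolding C_def D_def s_def using nd by (auto intro: p_integral_intros p_integral_inverse_of_nat)
  have nz: "C \<noteq> 0" "D \<noteq> 0" unfolding C_def D_def by simp_all
  have "legendre_term m (of_nat half) = C * (s * D)"
    unfolding legendre_term_of_nat m C_def D_def s_def by (simp add: algebra_simps)
  moreover have "cbinom m ^ 2 = C * (C / 16 ^ m)"
    using power_mult_distrib[of "4::rat" 4 m] by (simp add: cbinom_def C_def power2_eq_square)
  ultimately have "pcong 1 (C * (s * D)) (C * (C / 16 ^ m))"
    using pcong_weaken[OF pcong_legendre_term_half_2[of m], of 1] m by simp
  then have "pcong 1 (s * D) (C / 16 ^ m)" using int(3) nz(1) by (rule pcong_cancel)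
  then have "pcong 1 (16 ^ m * (s * D)) (16 ^ m * (C / 16 ^ m))" by (intro pcong_scale p_integral_intros)
  then have "pcong 1 ((1 + P * fq) * (s * D)) C" unfolding power_16_quarter[OF m, symmetric] by simp
  moreover have "pcong 1 (s * D) ((1 + P * fq) * (s * D))"
    by (rule pcongI[of _ _ _ "- (fq * s * D)"]) (auto simp: algebra_simps intro!: p_integral_intros int p_integral_fq)
  ultimately have "pcong 1 (s * D) C" using pcong_trans by blast
  then have "pcong 1 ((s / C * (1 / D)) * (s * D)) ((s / C * (1 / D)) * C)"
    using int(3) int by (intro pcong_scale p_integral_mult) (simp_all add: p_integral_mult[OF int(5) int(3), simplified])
  moreover have "(s / C * (1 / D)) * (s * D) = (s * s) / C" "(s / C * (1 / D)) * C = s * (1 / D)"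
    using nz by simp_all
  ultimately have "pcong 1 (1 / C) (s * (1 / D))" unfolding ss by simp
  then have "pcong 1 (s * (1 / C)) (s * (s * (1 / D)))" by (intro pcong_scale int)
  then have "pcong 1 (s / C) (1 / D)" using ss by (simp flip: mult.assoc)
  then show ?thesis unfolding C_def D_def s_def by (rule pcong_sym)
qed

text \<open>Every i has the partner j = 3 m - i, whose inverse is -1 / (m + 1 + i) modulo p; these
  give -Y. The other partners are m - i for i < m and, for the mirrored index 2 m - 1 - i, the
  number p - (m - i). Since c changes sign under that mirroring, both give X. Then X is a derivative
  of a binomial coefficient and Y a partial fraction sum.\<close>

lemma jacobsthal_double_sum:
  assumes m: "half = 2 * m"
  shows "pcong 1 (of_nat half * residue_sum m)
    (- ((-1) ^ m) * of_nat ((2 * m) choose m) * (1 - fq / 2) - 1 / of_nat ((3 * m) choose m))"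
proof -
  define c where "c = (\<lambda>i. (-1) ^ i * (of_nat ((2 * m - 1) choose i) :: rat))"
  define X where "X = (\<Sum>i<m. c i / of_nat (m - i))"
  define Y where "Y = (\<Sum>i\<le>2 * m - 1. c i * (1 / (of_nat (m + 1) + of_nat i)))"
  define C where "C = (of_nat ((2 * m) choose m) :: rat)"
  have mpos: "m > 0" using m half_gt_1 by auto
  have p: "p = 4 * m + 1" using p_eq m by simp
  have cint: "p_integral p (c i)" for i unfolding c_def by (intro p_integral_intros)
  have split: "(\<Sum>i\<le>2 * m - 1. f i) = (\<Sum>i<m. f i) + (\<Sum>i<m. f (2 * m - 1 - i))" for f :: "nat \<Rightarrow> rat"
  proof -
    have "{..2 * m - 1} = {..<m} \<union> {m..<2 * m}" using mpos by auto
    then have "(\<Sum>i\<le>2 * m - 1. f i) = (\<Sum>i<m. f i) + (\<Sum>i\<in>{m..<2 * m}. f i)"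
      by (simp only:) (rule sum.union_disjoint, auto)
    also have "(\<Sum>i\<in>{m..<2 * m}. f i) = (\<Sum>i<m. f (2 * m - 1 - i))"
      by (rule sum.reindex_bij_witness[of _ "\<lambda>i. 2 * m - 1 - i" "\<lambda>i. 2 * m - 1 - i"]) auto
    finally show ?thesis .
  qed
  have crev: "c (2 * m - 1 - i) = - c i" if "i < m" for i
  proof -
    have "(2 * m - 1) choose (2 * m - 1 - i) = (2 * m - 1) choose i"
      using that by (intro binomial_symmetric[symmetric]) auto
    moreover have "even (2 * m - 1 - i) \<longleftrightarrow> odd i" using that by (cases "even i") auto
    then have "(-1) ^ (2 * m - 1 - i) = - ((-1) ^ i :: rat)" by (simp add: minus_one_power_iff)
    ultimately show ?thesis by (simp add: c_def)
  qed
  have "residue_sum m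
      = (\<Sum>i\<le>2 * m - 1. \<Sum>j\<in>{j \<in> {1..4 * m}. 2 * m dvd m + i + j}. c i / of_nat j)"
    by (simp add: c_def residue_sum_def)
  also have "\<dots> = (\<Sum>i<m. c i / of_nat (m - i) + c i / of_nat (3 * m - i))
      + (\<Sum>i<m. c (2 * m - 1 - i) / of_nat (3 * m - (2 * m - 1 - i)) + c (2 * m - 1 - i) / of_nat (5 * m - (2 * m - 1 - i)))"
    unfolding split
  proof (intro arg_cong2[where f = "(+)"] sum.cong refl)
    fix i assume "i \<in> {..<m}"
    then have i: "i < m" by simp
    show "(\<Sum>j\<in>{j \<in> {1..4 * m}. 2 * m dvd m + i + j}. c i / of_nat j) = c i / of_nat (m - i) + c i / of_nat (3 * m - i)"
      unfolding multiples_in_window(1)[OF mpos i] using i mpos by (subst sum.insert) auto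
    have i': "m \<le> 2 * m - 1 - i" "2 * m - 1 - i < 2 * m" using i by auto
    show "(\<Sum>j\<in>{j \<in> {1..4 * m}. 2 * m dvd m + (2 * m - 1 - i) + j}. c (2 * m - 1 - i) / of_nat j)
        = c (2 * m - 1 - i) / of_nat (3 * m - (2 * m - 1 - i)) + c (2 * m - 1 - i) / of_nat (5 * m - (2 * m - 1 - i))"
      unfolding multiples_in_window(2)[OF mpos i'] using i mpos by (subst sum.insert) auto
  qed
  also have "\<dots> = X + (\<Sum>i<m. - c i * (1 / of_nat (p - (m - i)))) + (\<Sum>i\<le>2 * m - 1. c i * (1 / of_nat (p - (m + 1 + i))))"
  proof -
    have e1: "(\<Sum>i<m. c (2 * m - 1 - i) / of_nat (5 * m - (2 * m - 1 - i))) = (\<Sum>i<m. - c i * (1 / of_nat (p - (m - i))))"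
    proof (intro sum.cong refl)
      fix i assume "i \<in> {..<m}"
      then have i: "i < m" by simp
      then have "5 * m - (2 * m - 1 - i) = p - (m - i)" using p by simp
      then show "c (2 * m - 1 - i) / of_nat (5 * m - (2 * m - 1 - i)) = - c i * (1 / of_nat (p - (m - i)))"
        using crev[OF i] by simp
    qed
    have e2: "p - (m + 1 + i) = 3 * m - i" for i using p by simp
    show ?thesis unfolding e2 split X_def e1[symmetric] by (simp add: sum.distrib)
  qed
  also have "pcong 1 \<dots> (X + (\<Sum>i<m. - c i * (- 1 / of_nat (m - i))) + (\<Sum>i\<le>2 * m - 1. c i * (- 1 / of_nat (m + 1 + i))))"
    using p mpos by (intro pcong_add pcong_refl pcong_sum pcong_scale pcong_inverse_reflect p_integral_uminus cint) auto
  also have "\<dots> = 2 * X - Y"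
    by (simp add: X_def Y_def sum_negf algebra_simps)
  finally have W: "pcong 1 (residue_sum m) (2 * X - Y)" .
  \<comment> \<open>One factor 2 turns (2m - 1) choose m into C; the other, with m, multiplies the
    harmonic difference. The summand 1 comes from moving its endpoints from 2m - 1 and m - 1 to 2m
    and m.\<close>
  have X: "of_nat half * (2 * X) = - ((-1) ^ m) * C * (2 * of_nat m * (harmonic (2 * m) - harmonic m) + 1)"
  proof -
    have "X = (\<Sum>r=1..m. (-1) ^ (m + 1) * ((-1) ^ (r + 1) * of_nat ((2 * m - 1) choose (m - r)) / of_nat r))"
      unfolding X_def
    proof (rule sum.reindex_bij_witness[of _ "\<lambda>r. m - r" "\<lambda>i. m - i"])
      fix i assume "i \<in> {..<m}"
      then have i: "i < m" by simp
      then have "even (m + 1 + (m - i + 1)) \<longleftrightarrow> even i" by auto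
      then have "(-1) ^ (m + 1 + (m - i + 1)) = ((-1) ^ i :: rat)"
        by (simp only: minus_one_power_iff)
      then have "(-1) ^ (m + 1) * (-1) ^ (m - i + 1) = ((-1) ^ i :: rat)"
        by (simp only: power_add)
      moreover have "m - (m - i) = i" using i by simp
      ultimately show "(-1) ^ (m + 1) * ((-1) ^ (m - i + 1) * of_nat ((2 * m - 1) choose (m - (m - i))) / of_nat (m - i)) = c i / of_nat (m - i)"
        unfolding c_def by (simp only: times_divide_eq_right mult.assoc[symmetric])
    qed auto
    also have "\<dots> = (-1) ^ (m + 1) * (of_nat ((2 * m - 1) choose m) * (harmonic (2 * m - 1) - harmonic (2 * m - 1 - m)))"
      unfolding sum_distrib_left[symmetric] using mpos by (subst sum_alternating_binomial_log) auto
    finally have X: "X = (-1) ^ (m + 1) * (of_nat ((2 * m - 1) choose m) * (harmonic (2 * m - 1) - harmonic (m - 1)))"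
      by simp
    have "2 * of_nat ((2 * m - 1) choose m) = C"
    proof -
      obtain k where k: "m = Suc k" using mpos by (cases m) auto
      have "(2 * k + 1) choose (k + 1) = (2 * k + 1) choose k"
        using binomial_symmetric[of "k + 1" "2 * k + 1"] by simp
      then have "(2 * m) choose m = 2 * ((2 * m - 1) choose m)" unfolding k by simp
      then show ?thesis by (simp add: C_def)
    qed
    moreover have "2 * of_nat m * (harmonic (2 * m - 1) - harmonic (m - 1)) = 2 * of_nat m * (harmonic (2 * m) - harmonic m) + 1"
    proof -
      have "harmonic (2 * m) = harmonic (2 * m - 1) + 1 / of_nat (2 * m)" "harmonic m = harmonic (m - 1) + 1 / of_nat m"
        using harmonic_Suc[of "2 * m - 1"] harmonic_Suc[of "m - 1"] mpos by simp_all
      then show ?thesis using mpos by (simp add: field_simps)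
    qed
    moreover have "of_nat half * (2 * X) = (-1) ^ (m + 1) * (2 * of_nat ((2 * m - 1) choose m)) * (2 * of_nat m * (harmonic (2 * m - 1) - harmonic (m - 1)))"
      unfolding X m by simp
    ultimately show ?thesis by simp
  qed
  have Y: "of_nat half * Y = 1 / of_nat ((3 * m) choose m)"
  proof -
    have prod: "(\<Prod>j\<le>n. of_nat (m + 1) + of_nat j) * fact m = (fact (m + 1 + n) :: rat)" for n
    proof (induction n)
      case (Suc n)
      have "(\<Prod>j\<le>Suc n. of_nat (m + 1) + of_nat j) * fact m
          = (of_nat (m + 1) + of_nat (Suc n)) * ((\<Prod>j\<le>n. of_nat (m + 1) + of_nat j) * (fact m :: rat))"
        by (simp only: prod.atMost_Suc mult_ac)
      also have "\<dots> = of_nat (Suc (m + 1 + n)) * fact (m + 1 + n)"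
        unfolding Suc.IH by simp
      finally show ?case by (simp only: add_Suc_right fact_Suc)
    qed (simp add: algebra_simps)
    have "Y = fact (2 * m - 1) / (\<Prod>j\<le>2 * m - 1. of_nat (m + 1) + of_nat j)"
      unfolding Y_def c_def by (rule sum_alternating_binomial_inverse) simp
    also have "(\<Prod>j\<le>2 * m - 1. of_nat (m + 1) + of_nat j) = (fact (3 * m) / fact m :: rat)"
      using prod[of "2 * m - 1"] mpos by (simp add: field_simps)
    finally have Y: "Y = fact (2 * m - 1) * fact m / fact (3 * m)" by simp
    have "of_nat half * fact (2 * m - 1) = (fact (2 * m) :: rat)"
      using fact_reduce[of "2 * m", where 'a = rat] mpos m by simp
    then have "of_nat half * Y = fact (2 * m) * fact m / fact (3 * m)"
      unfolding Y by (simp add: mult.assoc[symmetric])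
    also have "\<dots> = 1 / of_nat ((3 * m) choose m)"
      by (subst binomial_fact) (simp_all add: field_simps)
    finally show ?thesis .
  qed
  have "pcong 1 (of_nat half * residue_sum m)
      (of_nat half * (2 * X - Y))"
    by (intro pcong_scale W p_integral_of_nat)
  also have "\<dots> = - ((-1) ^ m) * C * (2 * of_nat m * (harmonic (2 * m) - harmonic m) + 1) - 1 / of_nat ((3 * m) choose m)"
    unfolding right_diff_distrib X Y ..
  also have "pcong 1 \<dots> (- ((-1) ^ m) * C * (- 1 / 2 * fq + 1) - 1 / of_nat ((3 * m) choose m))"
  proof (intro pcong_diff pcong_scale pcong_add pcong_refl)
    show "p_integral p (- ((-1) ^ m) * C)" unfolding C_def by (intro p_integral_intros)
    \<comment> \<open>2 m = \<open>half\<close> is -1/2 modulo p.\<close>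
    have h: "2 * of_nat m = P / 2 - 1 / 2" using P_eq m by (simp add: field_simps)
    have int: "p_integral p (harmonic (m * 2))" "p_integral p (harmonic m)"
      using p_integral_harmonic[OF half_less_p[of "m * 2"]] p_integral_harmonic[OF half_less_p[of m]] m
      by simp_all
    have "pcong 1 (2 * of_nat m * (harmonic (2 * m) - harmonic m)) (- 1 / 2 * (harmonic (2 * m) - harmonic m))"
      unfolding h by (rule pcongI[of _ _ _ "(harmonic (2 * m) - harmonic m) / 2"])
        (auto simp: field_simps intro!: p_integral_intros int)
    also have "pcong 1 \<dots> (- 1 / 2 * fq)" by (intro pcong_scale harmonic_quarter[OF m] p_integral_intros)
    finally show "pcong 1 (2 * of_nat m * (harmonic (2 * m) - harmonic m)) (- 1 / 2 * fq)" .
  qed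
  finally show ?thesis unfolding C_def by (simp add: add.commute)
qed

text \<open>The squared form of the Chowla-Dwork-Evans congruence for (p - 1)/2 choose (p - 1)/4.
  Squaring the value R of the Jacobsthal sum, the cross term of C with p / C gives 2 p, and C^2 (1 -
  p q) is \<open>cbinom m ^ 2\<close> because C^2 = (1 + p q) \<open>cbinom m ^ 2\<close>.\<close>

lemma cbinom_quarter:
  assumes m: "half = 2 * m" and xy: "int p = x ^ 2 + 4 * y ^ 2"
  shows "pcong 2 (cbinom m ^ 2) (4 * of_int x ^ 2 - 2 * P)"
proof -
  define C where "C = (of_nat ((2 * m) choose m) :: rat)"
  define s where "s = ((-1) ^ m :: rat)"
  have ss: "s * s = 1" by (simp add: s_def flip: power_mult_distrib)
  have nd: "\<not> p dvd ((2 * m) choose m)" using p_eq m by (intro not_dvd_choose) auto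
  have int: "p_integral p C" "p_integral p (1 / C)" "p_integral p s" "p_integral p fq"
    unfolding C_def s_def using nd by (auto intro: p_integral_intros p_integral_inverse_of_nat p_integral_fq)
  have C: "C \<noteq> 0" by (simp add: C_def)
  define R where "R = - s * (C - P * C * fq / 2 + P * (1 / C))"
  have Rint: "p_integral p R" unfolding R_def by (intro p_integral_intros int)
  have "pcong 2 (of_int (jacobsthal 1)) (s * C * (P - 1) + P * (- s * C * (1 - fq / 2) - s * (1 / C)))"
  proof -
    let ?W = "of_nat half * residue_sum m"
    have "pcong 1 ?W (- s * C * (1 - fq / 2) - 1 / of_nat ((3 * m) choose m))"
      unfolding s_def C_def by (rule jacobsthal_double_sum[OF m])
    also have "pcong 1 \<dots> (- s * C * (1 - fq / 2) - s * (1 / C))"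
      using choose_three_quarters[OF m] unfolding s_def C_def by (intro pcong_diff pcong_refl) simp
    finally have "pcong (Suc 1) (P * ?W) (P * (- s * C * (1 - fq / 2) - s * (1 / C)))" by (rule pcong_mult_P1)
    then have W: "pcong 2 (P * ?W) (P * (- s * C * (1 - fq / 2) - s * (1 / C)))" by (simp add: numeral_2_eq_2)
    have "pcong 2 (of_int (jacobsthal 1)) (s * C * (P - 1) + P * ?W)"
      using jacobsthal_expand[OF m] unfolding s_def C_def by (simp only: mult.assoc)
    also have "pcong 2 \<dots> (s * C * (P - 1) + P * (- s * C * (1 - fq / 2) - s * (1 / C)))"
      by (intro pcong_add pcong_refl W)
    finally show ?thesis .
  qed
  also have "s * C * (P - 1) + P * (- s * C * (1 - fq / 2) - s * (1 / C)) = R"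
    unfolding R_def by (simp add: algebra_simps)
  finally have "pcong 2 (of_int (jacobsthal 1) ^ 2) (R ^ 2)" by (rule pcong_power[OF _ Rint])
  moreover have "of_int (jacobsthal 1) ^ 2 = (4 * of_int x ^ 2 :: rat)"
    using jacobsthal_1[OF _ xy] m by (metis dvd_triv_left of_int_mult of_int_numeral of_int_power)
  ultimately have 1: "pcong 2 (4 * of_int x ^ 2) (R ^ 2)" by simp
  also have "R ^ 2 = C ^ 2 * (1 - P * fq) + 2 * P + P ^ 2 * (- C * fq / 2 + 1 / C) ^ 2"
  proof -
    have "R ^ 2 = (s * s) * (C - P * C * fq / 2 + P * (1 / C)) ^ 2"
      unfolding R_def by (simp add: power2_eq_square algebra_simps)
    also have "\<dots> = C ^ 2 * (1 - P * fq) + 2 * P * (C * (1 / C)) + P ^ 2 * (- C * fq / 2 + 1 / C) ^ 2"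
      unfolding ss power2_eq_square by (simp only: mult_1) (simp add: algebra_simps)
    finally show ?thesis using C by simp
  qed
  also have "pcong 2 \<dots> (cbinom m ^ 2 + 2 * P)"
  proof -
    have "C = 4 ^ m * cbinom m" by (simp add: cbinom_def C_def)
    then have "C ^ 2 = 16 ^ m * cbinom m ^ 2"
      using power_mult_distrib[of "4::rat" 4 m] by (simp add: power2_eq_square)
    then have C2: "C ^ 2 = (1 + P * fq) * cbinom m ^ 2" unfolding power_16_quarter[OF m] .
    have "C ^ 2 * (1 - P * fq) + 2 * P + P ^ 2 * e - (cbinom m ^ 2 + 2 * P)
        = P ^ 2 * (- (cbinom m ^ 2 * fq ^ 2) + e)" for e
      unfolding C2 by (simp add: algebra_simps power2_eq_square)
    then show ?thesis
      by (rule pcongI) (intro p_integral_intros int p_integral_cbinom)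
  qed
  finally have "pcong 2 (4 * of_int x ^ 2 - 2 * P) (cbinom m ^ 2 + 2 * P - 2 * P)"
    by (rule pcong_diff) simp
  then show ?thesis by (simp add: pcong_sym)
qed

end

theorem theorem2p2:
  fixes p :: nat
  assumes "prime p" and "p > 3"
  shows "rat_cong_prime_power p 3
           (of_nat (G_seq (p - 1)))
           ((-1) ^ ((p - 1) div 2) * 256 ^ (p - 1)
            + of_nat p ^ 2 *
                (of_int (euler_number (p - 3))
                 - 8 * (-1) ^ ((p - 1) div 2) * fermat_quotient p 2 ^ 2
                 + 1 / 2 * (\<Sum>k=0..(p - 1) div 2.
                     of_nat ((2*k) choose k) ^ 2 / 16 ^ k * harmonic k ^ 2)))
       \<and> (p mod 4 = 1 \<longrightarrow>
           (\<forall>x y :: int. int p = x ^ 2 + 4 * y ^ 2 \<longrightarrow>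
              [int (G_seq ((p - 1) div 2)) = 4 ^ p * x ^ 2 - 2 * int p] (mod (int p ^ 2))))
       \<and> (p mod 4 = 3 \<longrightarrow>
           [int (G_seq ((p - 1) div 2)) = 0] (mod (int p ^ 2)))"
proof -
  interpret prime_gt_3 p using assms by unfold_locales
  obtain B where B: "of_nat (G_seq half) = 16 ^ half * B"
    "even half \<Longrightarrow> pcong 2 B (cbinom (half div 2) ^ 2)" "odd half \<Longrightarrow> pcong 2 B 0"
    using G_seq_half by blast
  have 16: "16 ^ half = (1 + P * fq) ^ 2"
  proof -
    have "(16::rat) ^ half = 4 ^ half * 4 ^ half" by (simp flip: power_mult_distrib)
    then show ?thesis by (simp only: power_2_p_minus_1[symmetric] power_2_fq power2_eq_square)
  qed
  show ?thesis
  proof (intro conjI impI allI)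
    let ?R = "(-1) ^ half * 256 ^ (p - 1) + P ^ 2 * (of_int (euler_number (p - 3)) - 8 * (-1) ^ half * fq ^ 2
        + 1 / 2 * (\<Sum>k\<le>half. cbinom k ^ 2 * harmonic k ^ 2))"
    have "p_integral p ?R"
      by (intro p_integral_intros p_integral_fq p_integral_cbinom p_integral_harmonic half_less_p) auto
    then have "rat_cong_prime_power p 3 (of_nat (G_seq (p - 1))) ?R"
      using G_seq_p_minus_1 p_integral_of_nat by (simp add: rat_cong_prime_power_def pcong_def)
    moreover have "of_nat ((2*k) choose k) ^ 2 / 16 ^ k = cbinom k ^ 2" for k
      using power_mult_distrib[of "4::rat" 4 k] by (simp add: cbinom_def power_divide power2_eq_square)
    ultimately show "rat_cong_prime_power p 3 (of_nat (G_seq (p - 1)))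
       ((-1) ^ ((p - 1) div 2) * 256 ^ (p - 1)
        + P ^ 2 * (of_int (euler_number (p - 3)) - 8 * (-1) ^ ((p - 1) div 2) * fq ^ 2
           + 1 / 2 * (\<Sum>k=0..(p - 1) div 2. of_nat ((2*k) choose k) ^ 2 / 16 ^ k * harmonic k ^ 2)))"
      by (simp only: half_def[symmetric] atLeast0AtMost)
  next
    fix x y :: int
    assume "p mod 4 = 1" and xy: "int p = x ^ 2 + 4 * y ^ 2"
    then have even: "even half" using p_eq by presburger
    then have m: "half = 2 * (half div 2)" by simp
    have "pcong 2 B (4 * of_int x ^ 2 - 2 * P)"
      using pcong_trans[OF B(2)[OF even] cbinom_quarter[OF m xy]] .
    then have "pcong 2 (16 ^ half * B) (16 ^ half * (4 * of_int x ^ 2 - 2 * P))"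
      by (intro pcong_scale p_integral_intros)
    also have "pcong 2 (16 ^ half * (4 * of_int x ^ 2 - 2 * P)) (16 ^ half * 4 * of_int x ^ 2 - 2 * P)"
      by (rule pcongI[of _ _ _ "- 2 * (2 * fq + P * fq ^ 2)"])
        (simp add: 16 algebra_simps power2_eq_square, intro p_integral_intros p_integral_fq)
    also have "16 ^ half * 4 * of_int x ^ 2 - 2 * P = of_int (4 ^ p * x ^ 2 - 2 * int p)"
    proof -
      have "(4::rat) ^ p = 16 ^ half * 4" by (subst p_eq) (simp add: power_mult)
      then show ?thesis by simp
    qed
    finally have "pcong 2 (of_int (int (G_seq half))) (of_int (4 ^ p * x ^ 2 - 2 * int p))"
      using B(1) by simp
    then show "[int (G_seq ((p - 1) div 2)) = 4 ^ p * x ^ 2 - 2 * int p] (mod (int p ^ 2))"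
      unfolding pcong_of_int half_def .
  next
    assume "p mod 4 = 3"
    then have "odd half" using p_eq by presburger
    then have "pcong 2 (16 ^ half * B) (16 ^ half * 0)"
      by (intro pcong_scale B(3) p_integral_intros)
    then have "pcong 2 (of_int (int (G_seq half))) (of_int 0)" using B(1) by simp
    then show "[int (G_seq ((p - 1) div 2)) = 0] (mod (int p ^ 2))"
      unfolding pcong_of_int half_def .
  qed
qed

end
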